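(* Let $d\ge2$ and assume that the radius is constant, $R_1\equiv c$ almost surely with $0<c<1$. If balls (and the Hausdorff distance) are taken with respect to the $\ell_1$-norm, then $$D^{(q)}(r)=\exp\Big(-\sqrt{\tfrac{2}{d-1}\,r\log r}\cdot(1+o(1))\Big),\qquad r\to\infty.$$ If balls (and the Hausdorff distance) are taken with respect to the $\ell_2$-norm, then $$\exp\Big(-\sqrt{\tfrac{4(d+1)}{d(d-1)}\,r\log r}\cdot(1+o(1))\Big)\le D^{(q)}(r)\le\exp\Big(-\sqrt{\tfrac{2}{d-1}\,r\log r}\cdot(1+o(1))\Big),\qquad r\to\infty.$$
   Context: Setting: fix a norm $\|\cdot\|$ on $\mathbb{R}^d$ and let $B(x,r)$ be the closed ball of centre $x$ and radius $r$ in this norm. Let $(\xi_i)_{i\ge1}$ be i.i.d. uniform on $[0,1]^d$, $(R_i)_{i\ge1}$ i.i.d. positive random variables, $N$ a Poisson random variable with parameter $\lambda>0$; the families $(\xi_i)$, $(R_i)$ and $N$ are independent. Define the random set $S:=\bigcup_{i=1}^N B(\xi_i,R_i)\cap[0,1]^d$. Let $d_H$ be the Hausdorff distance between closed subsets of $\mathbb{R}^d$ with respect to $\|\cdot\|$, with the convention $d_H(\emptyset,\emptyset)=0$ and $d_H(\emptyset,A)=+\infty$ for $A\ne\emptyset$. The quantization error is $$D^{(q)}(r):=\inf_{\#\mathcal{C}\le e^r}\mathbb{E}\min_{A\in\mathcal{C}}d_H(S,A),\qquad r>0,$$ where the infimum is over finite nonempty collections (codebooks) $\mathcal{C}$ of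 closed subsets of $\mathbb{R}^d$ (the empty set is allowed as an element) with at most $e^r$ elements. Notation: $f(r)=\exp(-g(r)(1+o(1)))$ (resp. $\le$, $\ge$) means there is a function $\varepsilon(r)\to0$ as $r\to\infty$ with $f(r)=\exp(-g(r)(1+\varepsilon(r)))$ (resp. $\le$, $\ge$) for all large $r$. *)

theory Defs
  imports "HOL-Probability.Probability"
begin

definition l1_norm :: "real ^ 'n \<Rightarrow> real" where
  "l1_norm x = (\<Sum>i\<in>UNIV. \<bar>x $ i\<bar>)"

definition norm_cball :: "(real ^ 'n \<Rightarrow> real) \<Rightarrow> real ^ 'n \<Rightarrow> real \<Rightarrow> (real ^ 'n) set" where
  "norm_cball nrm x \<rho> = {y. nrm (y - x) \<le> \<rho>}"

(* Values in ennreal: there the supremum of the empty set is 0 and the infimum of the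
   empty set is infinity, which yields the conventions for the empty set proved below. *)
definition hausdorff_dist ::
    "(real ^ 'n \<Rightarrow> real) \<Rightarrow> (real ^ 'n) set \<Rightarrow> (real ^ 'n) set \<Rightarrow> ennreal" where
  "hausdorff_dist nrm A B =
     max (SUP a\<in>A. INF b\<in>B. ennreal (nrm (a - b))) (SUP b\<in>B. INF a\<in>A. ennreal (nrm (a - b)))"

lemma hausdorff_dist_empty_empty: "hausdorff_dist nrm {} {} = 0"
  by (simp add: hausdorff_dist_def bot_ennreal)

lemma hausdorff_dist_empty_left: "A \<noteq> {} \<Longrightarrow> hausdorff_dist nrm {} A = \<infinity>"
  by (simp add: hausdorff_dist_def)

lemma hausdorff_dist_empty_right: "A \<noteq> {} \<Longrightarrow> hausdorff_dist nrm A {} = \<infinity>"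
  by (simp add: hausdorff_dist_def)

(* Sequences are indexed from 0, so the N grains are those with index i < N.
   The last assumption is the mutual independence of the sigma-algebras generated by the
   centres, the radii and the number of grains. *)
locale boolean_model = prob_space M
  for M :: "'a measure"
    and \<xi> :: "nat \<Rightarrow> 'a \<Rightarrow> real ^ 'n"
    and R :: "nat \<Rightarrow> 'a \<Rightarrow> real"
    and N :: "'a \<Rightarrow> nat"
    and rate :: real +
  assumes rate_pos: "0 < rate"
    and centres_indep: "indep_vars (\<lambda>_. borel) \<xi> UNIV"
    and centres_uniform: "\<And>i. distr M borel (\<xi> i) = uniform_measure lborel (cbox 0 1)"
    and radii_indep: "indep_vars (\<lambda>_. borel) R UNIV"
    and radii_ident: "\<And>i. distr M borel (R i) = distr M borel (R 0)"
    and radii_pos: "\<And>i. AE \<omega> in M. 0 < R i \<omega>"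
    and number_measurable: "N \<in> measurable M (count_space UNIV)"
    and number_poisson: "distr M (count_space UNIV) N = measure_pmf (poisson_pmf rate)"
    and families_indep:
      "indep_sets ((!)
         [sets (vimage_algebra (space M) (\<lambda>\<omega> i. \<xi> i \<omega>) (Pi\<^sub>M UNIV (\<lambda>_. borel))),
          sets (vimage_algebra (space M) (\<lambda>\<omega> i. R i \<omega>) (Pi\<^sub>M UNIV (\<lambda>_. borel))),
          sets (vimage_algebra (space M) N (count_space UNIV))]) {..<3}"

definition boolean_set ::
    "(real ^ 'n \<Rightarrow> real) \<Rightarrow> (nat \<Rightarrow> 'a \<Rightarrow> real ^ 'n) \<Rightarrow> (nat \<Rightarrow> 'a \<Rightarrow> real) \<Rightarrow> ('a \<Rightarrow> nat)
      \<Rightarrow> 'a \<Rightarrow> (real ^ 'n) set" where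
  "boolean_set nrm \<xi> R N \<omega> = (\<Union>i<N \<omega>. norm_cball nrm (\<xi> i \<omega>) (R i \<omega>) \<inter> cbox 0 1)"

definition codebooks :: "real \<Rightarrow> (real ^ 'n) set set set" where
  "codebooks r = {C. finite C \<and> C \<noteq> {} \<and> (\<forall>A\<in>C. closed A) \<and> real (card C) \<le> exp r}"

definition quantization_error ::
    "'a measure \<Rightarrow> (real ^ 'n \<Rightarrow> real) \<Rightarrow> ('a \<Rightarrow> (real ^ 'n) set) \<Rightarrow> real \<Rightarrow> ennreal" where
  "quantization_error M nrm S r =
     (INF C\<in>codebooks r. \<integral>\<^sup>+ \<omega>. (MIN A\<in>C. hausdorff_dist nrm (S \<omega>) A) \<partial>M)"

(* For rel one of =, \<le>, \<ge>: f(r) rel exp(-g(r) (1 + o(1))) as r tends to infinity. *)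
definition exp_asymp ::
    "(ennreal \<Rightarrow> ennreal \<Rightarrow> bool) \<Rightarrow> (real \<Rightarrow> ennreal) \<Rightarrow> (real \<Rightarrow> real) \<Rightarrow> bool" where
  "exp_asymp rel f g \<longleftrightarrow>
     (\<exists>\<epsilon> :: real \<Rightarrow> real. (\<epsilon> \<longlongrightarrow> 0) at_top \<and>
        (\<forall>\<^sub>F r in at_top. rel (f r) (ennreal (exp (- g r * (1 + \<epsilon> r))))))"

end

theory Submission
  imports Defs "HOL-Real_Asymp.Real_Asymp"
begin

text \<open>
  The proof compares two effects: a picture with many grains is unlikely, and it is expensive to
  encode. A picture determined by \<open>m\<close> visible grains has \<open>d m\<close> free coordinates, so \<open>e\<^sup>r\<close> code words
  describe it with error about \<open>exp (- r / (d m))\<close>; if the probability of seeing \<open>m\<close> such grains is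
  about \<open>exp (- s m ln m)\<close>, then the total error is governed by the minimum over \<open>m\<close> of
  \<open>r / (d m) + s m ln m\<close>. It is attained at \<open>m\<close> of order \<open>sqrt (r / ln r)\<close>, where \<open>ln m\<close> is about
  \<open>(ln r) / 2\<close>, and the minimum is \<open>sqrt ((2 s / d) r ln r)\<close>. The whole problem is to identify \<open>s\<close>.

  The Poisson number of grains alone gives \<open>s = 1\<close>. For a constant radius more is true, because
  a grain inside the union of the others is invisible. After discarding redundant grains, every
  remaining grain has a private point that it alone covers. Grains that are close together and
  have their private points in roughly the same direction must then lie near a Lipschitz graph over
  a coordinate hyperplane: a centre shifted towards the private point would cover that point as
  well (\<open>irredundant_in_region\<close>). Confining \<open>m\<close> uniform points to within \<open>m\<close> to the power
  \<open>- 1 / (d - 1)\<close> of a surface costs another factor \<open>exp (- (m ln m) / (d - 1))\<close>, so that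
  \<open>s = d / (d - 1)\<close> (\<open>prob_irredundant\<close>, \<open>crowded_region_asymp\<close>), and \<open>2 s / d = 2 / (d - 1)\<close>.
  Rounding the irredundant centres to a grid gives the upper bound for both norms
  (\<open>quantization_error_upper\<close>).

  For the lower bounds, \<open>n = K\<close> to the power \<open>d - 1\<close> grains are placed in separate boxes above a
  grid of mesh \<open>1 / K\<close> on a face of the cube, inside a slab of thickness of order \<open>K\<close> to the power
  \<open>- p\<close>. If the slab is thin enough, the top point of each ball stays outside all the other balls,
  so the picture determines all the centres in a quantitative way (\<open>configurations_close\<close>):
  two pictures at Hausdorff distance of order \<open>t\<^sup>q\<close> have centres within a multiple of \<open>t\<close> of each
  other. Hence a code word serves only a small set of configurations, and too small a codebook
  misses at least half of them (\<open>quantization_error_ge\<close>). The \<open>\<ell>\<^sub>1\<close> ball has a conical top, which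
  permits \<open>p = q = 1\<close> and matches the upper bound. The \<open>\<ell>\<^sub>2\<close> ball is flat at its top, which forces
  \<open>p = 2\<close>, and its top point controls horizontal displacements only up to a square root, so \<open>q = 2\<close>;
  this is the source of the gap between the two Euclidean bounds.
\<close>

section \<open>Exponential asymptotics up to a factor tending to one\<close>

text \<open>
  If \<open>f\<close> stays above \<open>exp (- (1 + \<eta>) g)\<close> for each fixed \<open>\<eta>\<close>, then the amount by which
  \<open>- ln f\<close> exceeds \<open>g\<close>, relative to \<open>g\<close>, is an admissible error term; it is cut off at \<open>0\<close> so that
  it converges even where \<open>f\<close> is much larger than the bound.
\<close>
lemma exp_asymp_geI:
  fixes f :: "real \<Rightarrow> ennreal" and g :: "real \<Rightarrow> real"
  assumes g: "\<forall>\<^sub>F r in at_top. 0 < g r"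
    and lower: "\<And>\<eta>. 0 < \<eta> \<Longrightarrow> \<forall>\<^sub>F r in at_top. ennreal (exp (- (1 + \<eta>) * g r)) \<le> f r"
  shows "exp_asymp (\<ge>) f g"
  unfolding exp_asymp_def
proof (intro exI conjI)
  let ?\<epsilon> = "\<lambda>r. max 0 (- ln (enn2real (f r)) / g r - 1)"
  have ln: "- ln (enn2real (f r)) / g r - 1 \<le> \<eta>"
    if g: "0 < g r" and f: "ennreal (exp (- (1 + \<eta>) * g r)) \<le> f r" and \<eta>: "0 < \<eta>" for r \<eta>
  proof (cases "f r = \<infinity>")
    case False
    then have "exp (- (1 + \<eta>) * g r) \<le> enn2real (f r)"
      using f enn2real_mono[OF f] by (simp add: less_top)
    then have "- (1 + \<eta>) * g r \<le> ln (enn2real (f r))"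
      by (metis exp_gt_zero ln_exp ln_mono order_less_le_trans)
    then have "- ln (enn2real (f r)) \<le> (1 + \<eta>) * g r" by (simp add: algebra_simps)
    then show ?thesis using g by (simp add: field_simps)
  qed (use \<eta> in simp)
  show "(?\<epsilon> \<longlongrightarrow> 0) at_top"
  proof (rule tendstoI)
    fix e :: real assume e: "0 < e"
    then have e2: "0 < e / 2" by simp
    from lower[OF e2] g show "\<forall>\<^sub>F r in at_top. dist (?\<epsilon> r) 0 < e"
    proof eventually_elim
      case (elim r)
      then have "- ln (enn2real (f r)) / g r - 1 < e" using ln[of r "e / 2"] e by linarith
      then show ?case using e by (auto simp: dist_real_def)
    qed
  qed
  show "\<forall>\<^sub>F r in at_top. ennreal (exp (- g r * (1 + ?\<epsilon> r))) \<le> f r"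
    using lower[of 1, simplified] g
  proof eventually_elim
    case (elim r)
    show ?case
    proof (cases "f r = \<infinity>")
      case False
      have "0 < f r" using elim(1) by (metis ennreal_less_zero_iff exp_gt_zero not_le order_less_le_trans)
      then have pos: "0 < enn2real (f r)" using False by (simp add: enn2real_positive_iff less_top)
      have "- ln (enn2real (f r)) = g r * (1 + (- ln (enn2real (f r)) / g r - 1))" using elim by simp
      also have "\<dots> \<le> g r * (1 + ?\<epsilon> r)" using elim by (intro mult_left_mono) auto
      finally have "exp (- g r * (1 + ?\<epsilon> r)) \<le> exp (ln (enn2real (f r)))" by simp
      then have "exp (- g r * (1 + ?\<epsilon> r)) \<le> enn2real (f r)" using pos by simp
      then have "ennreal (exp (- g r * (1 + ?\<epsilon> r))) \<le> ennreal (enn2real (f r))"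
        by (rule ennreal_leI)
      also have "ennreal (enn2real (f r)) = f r" using False by (simp add: less_top)
      finally show ?thesis .
    qed simp
  qed
qed

lemma exp_asymp_leI:
  fixes f :: "real \<Rightarrow> ennreal" and g :: "real \<Rightarrow> real"
  assumes g: "\<forall>\<^sub>F r in at_top. 0 < g r"
    and upper: "\<And>\<eta>. 0 < \<eta> \<Longrightarrow> \<forall>\<^sub>F r in at_top. f r \<le> ennreal (exp (- (1 - \<eta>) * g r))"
  shows "exp_asymp (\<le>) f g"
  unfolding exp_asymp_def
proof (intro exI conjI)
  let ?\<epsilon> = "\<lambda>r. if f r = 0 then 0 else min 0 (- ln (enn2real (f r)) / g r - 1)"
  have ln: "- \<eta> \<le> - ln (enn2real (f r)) / g r - 1"
    if g: "0 < g r" and f: "f r \<le> ennreal (exp (- (1 - \<eta>) * g r))" and f0: "f r \<noteq> 0" for r \<eta>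
  proof -
    have "f r < \<infinity>" using f by (metis ennreal_less_top infinity_ennreal_def le_less_trans)
    then have pos: "0 < enn2real (f r)"
      using f0 by (simp add: enn2real_positive_iff less_top zero_less_iff_neq_zero)
    have "enn2real (f r) \<le> exp (- (1 - \<eta>) * g r)"
      using enn2real_mono[OF f] by simp
    then have "ln (enn2real (f r)) \<le> - (1 - \<eta>) * g r"
      using pos by (metis exp_gt_zero ln_exp ln_mono)
    then have "(1 - \<eta>) * g r \<le> - ln (enn2real (f r))" by (simp add: algebra_simps)
    then show ?thesis using g by (simp add: field_simps)
  qed
  show "(?\<epsilon> \<longlongrightarrow> 0) at_top"
  proof (rule tendstoI)
    fix e :: real assume e: "0 < e"
    then have e2: "0 < e / 2" by simp
    from upper[OF e2] g show "\<forall>\<^sub>F r in at_top. dist (?\<epsilon> r) 0 < e"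
    proof eventually_elim
      case (elim r)
      then have "f r \<noteq> 0 \<Longrightarrow> - e < - ln (enn2real (f r)) / g r - 1" using ln[of r "e / 2"] e
        by linarith
      then show ?case using e by (auto simp: dist_real_def)
    qed
  qed
  show "\<forall>\<^sub>F r in at_top. f r \<le> ennreal (exp (- g r * (1 + ?\<epsilon> r)))"
    using upper[of 1, simplified] g
  proof eventually_elim
    case (elim r)
    show ?case
    proof (cases "f r = 0")
      case False
      have fin: "f r < \<infinity>"
        using elim(1) by (metis ennreal_less_top ennreal_1 infinity_ennreal_def le_less_trans)
      then have pos: "0 < enn2real (f r)"
        using False by (simp add: enn2real_positive_iff less_top zero_less_iff_neq_zero)
      have "g r * (1 + ?\<epsilon> r) \<le> g r * (1 + (- ln (enn2real (f r)) / g r - 1))"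
        using elim False by (intro mult_left_mono) auto
      also have "\<dots> = - ln (enn2real (f r))" using elim by simp
      finally have "exp (ln (enn2real (f r))) \<le> exp (- g r * (1 + ?\<epsilon> r))" by simp
      then have "enn2real (f r) \<le> exp (- g r * (1 + ?\<epsilon> r))" using pos by simp
      then have "ennreal (enn2real (f r)) \<le> ennreal (exp (- g r * (1 + ?\<epsilon> r)))"
        by (rule ennreal_leI)
      moreover have "ennreal (enn2real (f r)) = f r" using fin by (simp add: less_top)
      ultimately show ?thesis by simp
    qed simp
  qed
qed

lemma exp_asymp_eqI:
  fixes f :: "real \<Rightarrow> ennreal" and g :: "real \<Rightarrow> real"
  assumes g: "\<forall>\<^sub>F r in at_top. 0 < g r" and "exp_asymp (\<le>) f g" "exp_asymp (\<ge>) f g"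
  shows "exp_asymp (=) f g"
proof -
  obtain u where u: "(u \<longlongrightarrow> 0) at_top" "\<forall>\<^sub>F r in at_top. f r \<le> ennreal (exp (- g r * (1 + u r)))"
    using assms(2) unfolding exp_asymp_def by auto
  obtain l where l: "(l \<longlongrightarrow> 0) at_top" "\<forall>\<^sub>F r in at_top. ennreal (exp (- g r * (1 + l r))) \<le> f r"
    using assms(3) unfolding exp_asymp_def by auto
  let ?\<epsilon> = "\<lambda>r. - ln (enn2real (f r)) / g r - 1"
  have *: "\<forall>\<^sub>F r in at_top. u r \<le> ?\<epsilon> r \<and> ?\<epsilon> r \<le> l r \<and> f r = ennreal (exp (- g r * (1 + ?\<epsilon> r)))"
    using g u(2) l(2)
  proof eventually_elim
    case (elim r)
    have fin: "f r < \<infinity>" using elim(2) by (metis ennreal_less_top infinity_ennreal_def le_less_trans)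
    have "0 < f r" using elim(3) by (metis ennreal_less_zero_iff exp_gt_zero not_le order_less_le_trans)
    then have pos: "0 < enn2real (f r)" using fin by (simp add: enn2real_positive_iff less_top)
    have e: "exp (ln (enn2real (f r))) = enn2real (f r)" using pos by simp
    have "exp (- g r * (1 + l r)) \<le> exp (ln (enn2real (f r)))"
      unfolding e using enn2real_mono[OF elim(3)] fin by (simp add: less_top)
    moreover have "exp (ln (enn2real (f r))) \<le> exp (- g r * (1 + u r))"
      unfolding e using enn2real_mono[OF elim(2)] by simp
    ultimately have "g r * (1 + u r) \<le> - ln (enn2real (f r))" "- ln (enn2real (f r)) \<le> g r * (1 + l r)"
      by auto
    then have "1 + u r \<le> - ln (enn2real (f r)) / g r" "- ln (enn2real (f r)) / g r \<le> 1 + l r"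
      using elim(1) by (auto simp: field_simps)
    moreover have "- g r * (1 + ?\<epsilon> r) = ln (enn2real (f r))" using elim(1) by simp
    then have "ennreal (exp (- g r * (1 + ?\<epsilon> r))) = f r" using e fin by (simp add: less_top)
    ultimately show ?case by auto
  qed
  show ?thesis unfolding exp_asymp_def
  proof (intro exI conjI)
    show "(?\<epsilon> \<longlongrightarrow> 0) at_top"
      by (rule tendsto_sandwich[OF _ _ u(1) l(1)]) (use * in \<open>auto elim: eventually_mono\<close>)
    show "\<forall>\<^sub>F r in at_top. f r = ennreal (exp (- g r * (1 + ?\<epsilon> r)))"
      using * by (auto elim: eventually_mono)
  qed
qed


section \<open>The Poisson number of uniform centres\<close>

locale fixed_radius_model = boolean_model M \<xi> R N rate
  for M :: "'a measure" and \<xi> :: "nat \<Rightarrow> 'a \<Rightarrow> real ^ 'n" and R N rate +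
  fixes c :: real
  assumes radius_pos: "0 < c" and radius_less_1: "c < 1"
    and radius_const: "AE \<omega> in M. R 0 \<omega> = c"
begin

lemma centre_measurable [measurable]: "\<xi> i \<in> borel_measurable M"
  using centres_indep by (auto simp: indep_vars_def)

lemma number_measurable' [measurable]: "N \<in> measurable M (count_space UNIV)"
  by (rule number_measurable)

lemma radius_measurable [measurable]: "R i \<in> borel_measurable M"
  using radii_indep by (auto simp: indep_vars_def)

lemma AE_radius: "AE \<omega> in M. \<forall>i. R i \<omega> = c"
proof (subst AE_all_countable, intro allI)
  fix i
  have "AE x in distr M borel (R 0). x = c"
    using radius_const by (subst AE_distr_iff) auto
  then have "AE x in distr M borel (R i). x = c"
    by (subst radii_ident)
  then show "AE \<omega> in M. R i \<omega> = c"
    by (subst (asm) AE_distr_iff) auto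
qed

lemma unit_cube_measure: "emeasure lborel (cbox 0 1 :: (real ^ 'n) set) = 1"
proof -
  have "0 \<le> (1 :: real ^ 'n) \<bullet> b" "(0 :: real ^ 'n) \<bullet> b \<le> 1 \<bullet> b" if "b \<in> Basis" for b
    using that by (auto simp: Basis_vec_def inner_axis)
  moreover have "(1 :: real ^ 'n) \<bullet> b = 1" if "b \<in> Basis" for b
    using that by (auto simp: Basis_vec_def inner_axis)
  ultimately show ?thesis
    by (simp add: emeasure_lborel_cbox_eq)
qed

lemma AE_centre: "AE \<omega> in M. \<forall>i. \<xi> i \<omega> \<in> cbox 0 1"
proof (subst AE_all_countable, intro allI)
  fix i
  have "AE x in distr M borel (\<xi> i). x \<in> cbox 0 1"
    unfolding centres_uniform by (rule AE_uniform_measureI) auto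
  then show "AE \<omega> in M. \<xi> i \<omega> \<in> cbox 0 1"
    by (subst (asm) AE_distr_iff) auto
qed

lemma prob_centre:
  assumes [measurable]: "A \<in> sets borel"
  shows "emeasure M {\<omega> \<in> space M. \<xi> i \<omega> \<in> A} = emeasure lborel (cbox 0 1 \<inter> A)"
proof -
  have "emeasure M {\<omega> \<in> space M. \<xi> i \<omega> \<in> A} = emeasure (distr M borel (\<xi> i)) A"
    by (subst emeasure_distr) (auto intro!: arg_cong[where f = "emeasure M"])
  also have "\<dots> = emeasure lborel (cbox 0 1 \<inter> A)"
    unfolding centres_uniform
    by (subst emeasure_uniform_measure) (auto simp: unit_cube_measure divide_ennreal_def)
  finally show ?thesis .
qed

lemma prob_number: "prob {\<omega> \<in> space M. N \<omega> = n} = pmf (poisson_pmf rate) n"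
proof -
  have "prob {\<omega> \<in> space M. N \<omega> = n} = measure (distr M (count_space UNIV) N) {n}"
    by (subst measure_distr) (auto intro!: arg_cong[where f = prob])
  then show ?thesis by (simp add: number_poisson pmf.rep_eq)
qed

text \<open>
  The three families are independent as wholes, whereas each event below concerns only finitely
  many centres; this is the product formula for them and the number of grains.
\<close>
lemma prob_grains:
  assumes J: "finite J" and A[measurable]: "\<And>i. A i \<in> sets borel"
  shows "prob {\<omega> \<in> space M. N \<omega> = n \<and> (\<forall>i\<in>J. \<xi> i \<omega> \<in> A i)} =
         pmf (poisson_pmf rate) n * (\<Prod>i\<in>J. measure lborel (cbox 0 1 \<inter> A i))"
proof -
  let ?X = "{\<omega> \<in> space M. \<forall>i\<in>J. \<xi> i \<omega> \<in> A i}" and ?Y = "{\<omega> \<in> space M. N \<omega> = n}"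
  let ?F = "(!)
         [sets (vimage_algebra (space M) (\<lambda>\<omega> i. \<xi> i \<omega>) (Pi\<^sub>M UNIV (\<lambda>_. borel))),
          sets (vimage_algebra (space M) (\<lambda>\<omega> i. R i \<omega>) (Pi\<^sub>M UNIV (\<lambda>_. borel))),
          sets (vimage_algebra (space M) N (count_space UNIV))]"
  have J': "{f \<in> space (Pi\<^sub>M UNIV (\<lambda>_. borel)). \<forall>i\<in>J. f i \<in> A i} \<in> sets (Pi\<^sub>M UNIV (\<lambda>_::nat. borel :: (real^'n) measure))"
    using J by measurable
  have X: "?X \<in> ?F 0"
    using in_vimage_algebra[OF J', of "\<lambda>\<omega> i. \<xi> i \<omega>" "space M"]
    by (simp add: vimage_def Int_def space_PiM conj_commute)
  have Y: "?Y \<in> ?F 2"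
    using in_vimage_algebra[of "{n}" "count_space UNIV" N "space M"]
    by (simp add: vimage_def Int_def numeral_2_eq_2 conj_commute)
  have "prob (\<Inter>j\<in>{0,2::nat}. if j = 0 then ?X else ?Y) = (\<Prod>j\<in>{0,2::nat}. prob (if j = 0 then ?X else ?Y))"
    by (rule indep_setsD[OF families_indep]) (use X Y in auto)
  then have "prob (?X \<inter> ?Y) = prob ?X * prob ?Y" by (simp add: Int_commute)
  moreover have "prob ?X = (\<Prod>i\<in>J. prob {\<omega> \<in> space M. \<xi> i \<omega> \<in> A i})"
  proof (cases "J = {}")
    case False
    have "prob (\<Inter>i\<in>J. \<xi> i -` A i \<inter> space M) = (\<Prod>i\<in>J. prob (\<xi> i -` A i \<inter> space M))"
      by (rule indep_varsD[OF centres_indep]) (use J False in auto)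
    moreover have "(\<Inter>i\<in>J. \<xi> i -` A i \<inter> space M) = ?X" using False by auto
    moreover have "\<xi> i -` A i \<inter> space M = {\<omega> \<in> space M. \<xi> i \<omega> \<in> A i}" for i
      by auto
    ultimately show ?thesis by simp
  qed (simp add: prob_space)
  moreover have "prob {\<omega> \<in> space M. \<xi> i \<omega> \<in> A i} = measure lborel (cbox 0 1 \<inter> A i)" for i
    using prob_centre[OF A] by (simp add: measure_def)
  moreover have "?X \<inter> ?Y = {\<omega> \<in> space M. N \<omega> = n \<and> (\<forall>i\<in>J. \<xi> i \<omega> \<in> A i)}"
    by auto
  ultimately show ?thesis by (simp add: prob_number)
qed

text \<open>
  The number of subsets of \<open>m\<close> grains with all centres in \<open>T\<close> has the expectation
  \<open>(rate v) ^ m / fact m\<close> when \<open>v\<close> is the volume of \<open>T\<close>: by Poisson thinning it is a factorial moment.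
  The factor \<open>1 / fact m\<close> is what makes many grains unlikely.
\<close>
lemma prob_many_centres:
  assumes T[measurable]: "T \<in> sets borel" and v: "measure lborel (cbox 0 1 \<inter> T) \<le> v"
  shows "emeasure M {\<omega> \<in> space M. \<exists>J. J \<subseteq> {..<N \<omega>} \<and> card J = m \<and> (\<forall>i\<in>J. \<xi> i \<omega> \<in> T)}
    \<le> ennreal ((rate * v) ^ m / fact m)"
    and "{\<omega> \<in> space M. \<exists>J. J \<subseteq> {..<N \<omega>} \<and> card J = m \<and> (\<forall>i\<in>J. \<xi> i \<omega> \<in> T)} \<in> sets M"
proof -
  define E where "E n J = {\<omega> \<in> space M. N \<omega> = n \<and> (\<forall>i\<in>J. \<xi> i \<omega> \<in> T)}" for n :: nat and J
  define \<J> where "\<J> n = {J. J \<subseteq> {..<n} \<and> card J = m}" for n :: nat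
  have fin: "finite (\<J> n)" for n by (rule finite_subset[of _ "Pow {..<n}"]) (auto simp: \<J>_def)
  have v0: "0 \<le> v" using v measure_nonneg order_trans by blast
  have Em: "E n J \<in> sets M" if "J \<in> \<J> n" for n J
  proof -
    have "finite J" using that finite_subset by (auto simp: \<J>_def)
    then show ?thesis unfolding E_def by measurable
  qed
  have PE: "prob (E n J) \<le> pmf (poisson_pmf rate) n * v ^ m" if "J \<in> \<J> n" for n J
  proof -
    have f: "finite J" and cJ: "card J = m" using that finite_subset by (auto simp: \<J>_def)
    have "prob (E n J) = pmf (poisson_pmf rate) n * (\<Prod>i\<in>J. measure lborel (cbox 0 1 \<inter> T))"
      unfolding E_def by (rule prob_grains[OF f]) simp
    also have "\<dots> \<le> pmf (poisson_pmf rate) n * v ^ m"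
      using v cJ by (auto intro!: mult_left_mono power_mono)
    finally show ?thesis .
  qed
  have cardJ: "card (\<J> n) = n choose m" for n
    unfolding \<J>_def by (simp add: n_subsets)
  have eq: "{\<omega> \<in> space M. \<exists>J. J \<subseteq> {..<N \<omega>} \<and> card J = m \<and> (\<forall>i\<in>J. \<xi> i \<omega> \<in> T)}
        = (\<Union>n. \<Union>J\<in>\<J> n. E n J)"
    by (auto simp: E_def \<J>_def)
  show "{\<omega> \<in> space M. \<exists>J. J \<subseteq> {..<N \<omega>} \<and> card J = m \<and> (\<forall>i\<in>J. \<xi> i \<omega> \<in> T)} \<in> sets M"
    unfolding eq using Em fin by (intro sets.countable_UN' sets.finite_UN) auto
  have "emeasure M (\<Union>n. \<Union>J\<in>\<J> n. E n J) \<le> (\<Sum>n. emeasure M (\<Union>J\<in>\<J> n. E n J))"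
    by (rule emeasure_subadditive_countably) (use Em fin in auto)
  also have "\<dots> \<le> (\<Sum>n. ennreal (pmf (poisson_pmf rate) n * (real (n choose m) * v ^ m)))"
  proof (rule suminf_le)
    fix n
    have "emeasure M (\<Union>J\<in>\<J> n. E n J) = ennreal (prob (\<Union>J\<in>\<J> n. E n J))"
      by (rule emeasure_eq_measure)
    also have "prob (\<Union>J\<in>\<J> n. E n J) \<le> (\<Sum>J\<in>\<J> n. prob (E n J))"
      by (rule finite_measure_subadditive_finite[OF fin]) (use Em in auto)
    also have "\<dots> \<le> (\<Sum>J\<in>\<J> n. pmf (poisson_pmf rate) n * v ^ m)"
      by (rule sum_mono[OF PE])
    finally show "emeasure M (\<Union>J\<in>\<J> n. E n J) \<le> ennreal (pmf (poisson_pmf rate) n * (real (n choose m) * v ^ m))"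
      by (simp add: cardJ ennreal_leI algebra_simps)
  qed auto
  also have "\<dots> = ennreal ((rate * v) ^ m / fact m)"
  proof (rule suminf_ennreal_eq)
    have "(\<lambda>n. (rate ^ n /\<^sub>R fact n) * ((rate * v) ^ m / fact m * exp (- rate))) sums (exp rate * ((rate * v) ^ m / fact m * exp (- rate)))"
      by (rule sums_mult2) (rule exp_converges)
    also have "(\<lambda>n. (rate ^ n /\<^sub>R fact n) * ((rate * v) ^ m / fact m * exp (- rate)))
       = (\<lambda>n. pmf (poisson_pmf rate) (n + m) * (real ((n + m) choose m) * v ^ m))"
      using rate_pos by (auto simp: fun_eq_iff binomial_fact field_simps power_add scaleR_conv_of_real)
    also have "exp rate * ((rate * v) ^ m / fact m * exp (- rate)) = (rate * v) ^ m / fact m"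
      by (simp add: exp_minus field_simps)
    finally show "(\<lambda>n. pmf (poisson_pmf rate) n * (real (n choose m) * v ^ m)) sums ((rate * v) ^ m / fact m)"
      by (subst (asm) sums_iff_shift) (simp add: binomial_eq_0)
  qed (use v0 in auto)
  finally show "emeasure M {\<omega> \<in> space M. \<exists>J. J \<subseteq> {..<N \<omega>} \<and> card J = m \<and> (\<forall>i\<in>J. \<xi> i \<omega> \<in> T)}
    \<le> ennreal ((rate * v) ^ m / fact m)"
    unfolding eq .
qed
end

section \<open>Unions of balls and their Hausdorff distance\<close>

text \<open>
  All estimates except those about the shape of the ball hold for any norm between the maximum
  norm and the \<open>\<ell>\<^sub>1\<close> norm, and they are proved once at this level.
\<close>
locale sandwiched_norm =
  fixes nrm :: "real ^ 'n \<Rightarrow> real"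
  assumes nrm_triangle: "nrm (x + y) \<le> nrm x + nrm y"
    and nrm_scaleR: "nrm (a *\<^sub>R x) = \<bar>a\<bar> * nrm x"
    and component_le_nrm: "\<bar>x $ i\<bar> \<le> nrm x"
    and nrm_le_l1: "nrm x \<le> (\<Sum>i\<in>UNIV. \<bar>x $ i\<bar>)"
begin

lemma nrm_zero [simp]: "nrm 0 = 0"
  using nrm_scaleR[of 0 0] by simp

lemma nrm_minus [simp]: "nrm (- x) = nrm x"
  using nrm_scaleR[of "-1" x] by simp

lemma nrm_commute: "nrm (x - y) = nrm (y - x)"
  using nrm_minus[of "x - y"] by simp

lemma nrm_nonneg [simp]: "0 \<le> nrm x"
  using component_le_nrm[of x undefined] abs_ge_zero order_trans by blast

lemma nrm_triangle3: "nrm (x - z) \<le> nrm (x - y) + nrm (y - z)"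
  using nrm_triangle[of "x - y" "y - z"] by simp

lemma nrm_le_max:
  assumes "\<And>i. \<bar>x $ i\<bar> \<le> b"
  shows "nrm x \<le> real CARD('n) * b"
  using nrm_le_l1[of x] sum_bounded_above[of UNIV "\<lambda>i. \<bar>x $ i\<bar>" b] assms by fastforce

lemma continuous_nrm: "continuous_on UNIV nrm"
proof (rule continuous_on_iff[THEN iffD2], intro ballI allI impI)
  fix x :: "real ^ 'n" and e :: real
  assume e: "0 < e"
  show "\<exists>d>0. \<forall>x'\<in>UNIV. dist x' x < d \<longrightarrow> dist (nrm x') (nrm x) < e"
  proof (intro exI[of _ "e / real CARD('n)"] conjI ballI impI)
    fix x' assume d: "dist x' x < e / real CARD('n)"
    have "\<bar>(x' - x) $ i\<bar> \<le> dist x' x" for i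
      unfolding dist_norm by (rule component_le_norm_cart)
    then have "nrm (x' - x) \<le> real CARD('n) * dist x' x"
      by (rule nrm_le_max)
    also have "\<dots> < e" using d by (simp add: field_simps)
    finally have "nrm (x' - x) < e" .
    then show "dist (nrm x') (nrm x) < e"
      using nrm_triangle[of "x' - x" x] nrm_triangle[of "x - x'" x'] nrm_commute[of x x']
      by (simp add: dist_real_def)
  qed (use e in simp)
qed

lemma closed_norm_cball: "closed (norm_cball nrm x \<rho>)"
proof -
  have "norm_cball nrm x \<rho> = (\<lambda>y. nrm (y - x)) -` {..\<rho>}"
    by (auto simp: norm_cball_def)
  moreover have "continuous_on UNIV (\<lambda>y. nrm (y - x))"
    by (rule continuous_on_compose2[OF continuous_nrm]) (auto intro!: continuous_intros)
  ultimately show ?thesis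
    by (metis closed_vimage closed_atMost)
qed

lemma nrm_le_cube:
  assumes "x \<in> cbox 0 1" "y \<in> cbox 0 1"
  shows "nrm (x - y) \<le> real CARD('n)"
proof -
  have "\<bar>(x - y) $ i\<bar> \<le> 1" for i
    using assms[unfolded mem_box_cart, THEN spec, of i] by (auto simp: abs_le_iff)
  from nrm_le_max[OF this] show ?thesis by simp
qed

lemma hausdorff_dist_le:
  assumes "\<And>a. a \<in> A \<Longrightarrow> \<exists>b\<in>B. nrm (a - b) \<le> \<delta>" "\<And>b. b \<in> B \<Longrightarrow> \<exists>a\<in>A. nrm (a - b) \<le> \<delta>"
  shows "hausdorff_dist nrm A B \<le> ennreal \<delta>"
proof -
  have "(INF b\<in>B. ennreal (nrm (a - b))) \<le> ennreal \<delta>" if "a \<in> A" for a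
    using assms(1)[OF that] by (meson INF_lower2 ennreal_leI)
  moreover have "(INF a\<in>A. ennreal (nrm (a - b))) \<le> ennreal \<delta>" if "b \<in> B" for b
    using assms(2)[OF that] by (meson INF_lower2 ennreal_leI)
  ultimately show ?thesis
    unfolding hausdorff_dist_def by (auto intro!: SUP_least)
qed

lemma hausdorff_dist_less:
  assumes "hausdorff_dist nrm A B < ennreal \<delta>"
  shows "a \<in> A \<Longrightarrow> \<exists>b\<in>B. nrm (a - b) < \<delta>" "b \<in> B \<Longrightarrow> \<exists>a\<in>A. nrm (a - b) < \<delta>"
proof -
  have *: "(SUP a\<in>A. INF b\<in>B. ennreal (nrm (a - b))) < \<delta>" "(SUP b\<in>B. INF a\<in>A. ennreal (nrm (a - b))) < \<delta>"
    using assms by (auto simp: hausdorff_dist_def)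
  { assume "a \<in> A"
    then have "(INF b\<in>B. ennreal (nrm (a - b))) < \<delta>"
      using *(1) by (meson SUP_upper le_less_trans)
    then show "\<exists>b\<in>B. nrm (a - b) < \<delta>"
      by (auto simp: INF_less_iff ennreal_less_iff) }
  { assume "b \<in> B"
    then have "(INF a\<in>A. ennreal (nrm (a - b))) < \<delta>"
      using *(2) by (meson SUP_upper le_less_trans)
    then show "\<exists>a\<in>A. nrm (a - b) < \<delta>"
      by (auto simp: INF_less_iff ennreal_less_iff) }
qed

lemma hausdorff_dist_cube_le:
  assumes "A \<subseteq> cbox 0 1" "B \<subseteq> cbox 0 1" "A \<noteq> {}" "B \<noteq> {}"
  shows "hausdorff_dist nrm A B \<le> ennreal (real CARD('n))"
  by (rule hausdorff_dist_le) (use assms nrm_le_cube in blast)+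

definition ball_union :: "real \<Rightarrow> ('b \<Rightarrow> real ^ 'n) \<Rightarrow> 'b set \<Rightarrow> (real ^ 'n) set" where
  "ball_union c x I = (\<Union>i\<in>I. norm_cball nrm (x i) c \<inter> cbox 0 1)"

lemma closed_ball_union: "finite I \<Longrightarrow> closed (ball_union c x I)"
  unfolding ball_union_def by (auto intro!: closed_Int closed_norm_cball)

lemma ball_union_subset: "ball_union c x I \<subseteq> cbox 0 1"
  unfolding ball_union_def by auto

lemma ball_union_empty_iff:
  assumes "0 < c" "\<And>i. i \<in> I \<Longrightarrow> x i \<in> cbox 0 1"
  shows "ball_union c x I = {} \<longleftrightarrow> I = {}"
proof -
  have "x i \<in> norm_cball nrm (x i) c \<inter> cbox 0 1" if "i \<in> I" for i
    using that assms by (auto simp: norm_cball_def)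
  then show ?thesis unfolding ball_union_def by blast
qed

text \<open>
  Moving a centre by \<open>\<delta>\<close> moves the truncated ball by at most \<open>\<delta>\<close>. Translating a point of the first
  ball could leave the cube, so it is contracted towards the new centre instead, which stays in the
  cube by convexity.
\<close>
lemma cube_ball_shift:
  assumes c: "0 < c" and xy: "x \<in> cbox 0 1" "y \<in> cbox 0 1" "nrm (x - y) \<le> \<delta>"
    and z: "z \<in> norm_cball nrm x c \<inter> cbox 0 1"
  shows "\<exists>z' \<in> norm_cball nrm y c \<inter> cbox 0 1. nrm (z - z') \<le> \<delta>"
proof -
  have \<delta>: "0 \<le> \<delta>" using xy(3) nrm_nonneg order_trans by blast
  \<comment> \<open>The old point is within \<open>c + \<delta>\<close> of the new centre; moving it by this fraction of the way to
    the centre brings it within \<open>c\<close>.\<close>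
  define t where "t = \<delta> / (c + \<delta>)"
  have t: "0 \<le> t" "t \<le> 1" "t * (c + \<delta>) = \<delta>" "(1 - t) * (c + \<delta>) = c"
    using c \<delta> by (auto simp: t_def field_simps)
  define z' where "z' = (1 - t) *\<^sub>R z + t *\<^sub>R y"
  have zy: "nrm (z - y) \<le> c + \<delta>"
    using nrm_triangle3[of z y x] xy z by (auto simp: norm_cball_def)
  have "z' \<in> cbox 0 1"
    unfolding z'_def using convex_box(1)[of "0 :: real^'n" 1] z xy t by (intro convexD) auto
  moreover have "z' - y = (1 - t) *\<^sub>R (z - y)" "z - z' = t *\<^sub>R (z - y)"
    by (auto simp: z'_def algebra_simps)
  then have "nrm (z' - y) \<le> (1 - t) * (c + \<delta>)" "nrm (z - z') \<le> t * (c + \<delta>)"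
    using t(1,2) zy by (auto simp: nrm_scaleR intro!: mult_left_mono)
  ultimately show ?thesis
    using t(3,4) by (intro bexI[of _ z']) (auto simp: norm_cball_def)
qed

lemma hausdorff_dist_ball_union_le:
  assumes c: "0 < c" and xy: "\<And>i. i \<in> I \<Longrightarrow> x i \<in> cbox 0 1" "\<And>i. i \<in> I \<Longrightarrow> y i \<in> cbox 0 1"
    "\<And>i. i \<in> I \<Longrightarrow> nrm (x i - y i) \<le> \<delta>"
  shows "hausdorff_dist nrm (ball_union c x I) (ball_union c y I) \<le> ennreal \<delta>"
proof (rule hausdorff_dist_le)
  fix a assume "a \<in> ball_union c x I"
  then show "\<exists>b\<in>ball_union c y I. nrm (a - b) \<le> \<delta>"
    unfolding ball_union_def using cube_ball_shift[OF c xy] by fast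
next
  fix b assume "b \<in> ball_union c y I"
  then obtain i where i: "i \<in> I" "b \<in> norm_cball nrm (y i) c \<inter> cbox 0 1"
    unfolding ball_union_def by blast
  have "nrm (y i - x i) \<le> \<delta>" using xy(3)[OF i(1)] nrm_commute by metis
  from cube_ball_shift[OF c xy(2)[OF i(1)] xy(1)[OF i(1)] this i(2)] i
  show "\<exists>a\<in>ball_union c x I. nrm (a - b) \<le> \<delta>"
    unfolding ball_union_def by (subst nrm_commute) blast
qed

text \<open>
  Seen from its centre, a point \<open>q\<close> near the boundary of the ball of radius \<open>c\<close> has a coordinate
  direction, with sign \<open>s\<close>, such that moving the centre by \<open>v\<close> mainly in this direction does not
  increase the distance to \<open>q\<close>. The vectors \<open>v\<close> concerned form a truncated cone whose opening is
  measured by \<open>L\<close> and whose height is \<open>\<rho>\<close>.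
\<close>
definition indented :: "real \<Rightarrow> real \<Rightarrow> real \<Rightarrow> bool" where
  "indented c L \<rho> \<longleftrightarrow> (\<forall>q. c / 2 \<le> nrm q \<and> nrm q \<le> c \<longrightarrow>
     (\<exists>j s. (s = 1 \<or> s = - 1) \<and> (\<forall>v h. 0 \<le> h \<longrightarrow> (\<forall>l. l \<noteq> j \<longrightarrow> \<bar>v $ l\<bar> \<le> h) \<longrightarrow> L * h \<le> s * v $ j \<longrightarrow> s * v $ j \<le> \<rho>
        \<longrightarrow> nrm (q - v) \<le> nrm q)))"

end

lemma sandwiched_norm_l1: "sandwiched_norm (l1_norm :: real ^ 'n \<Rightarrow> real)"
proof
  fix x y :: "real ^ 'n" and a :: real and i
  show "l1_norm (x + y) \<le> l1_norm x + l1_norm y"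
    unfolding l1_norm_def sum.distrib[symmetric] by (rule sum_mono) (simp add: abs_triangle_ineq)
  show "l1_norm (a *\<^sub>R x) = \<bar>a\<bar> * l1_norm x"
    by (simp add: l1_norm_def sum_distrib_left abs_mult)
  show "\<bar>x $ i\<bar> \<le> l1_norm x"
    unfolding l1_norm_def by (rule member_le_sum) auto
qed (simp add: l1_norm_def)

lemma sandwiched_norm_l2: "sandwiched_norm (norm :: real ^ 'n \<Rightarrow> real)"
  by unfold_locales (auto simp: norm_triangle_ineq component_le_norm_cart norm_le_l1_cart)

lemma exists_large_component:
  fixes q :: "real ^ 'n"
  assumes "a \<le> (\<Sum>i\<in>UNIV. \<bar>q $ i\<bar>)"
  shows "\<exists>j. a / real CARD('n) \<le> \<bar>q $ j\<bar>"
proof (rule ccontr)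
  assume "\<not> ?thesis"
  then have "(\<Sum>i\<in>UNIV. \<bar>q $ i\<bar>) < (\<Sum>i\<in>(UNIV :: 'n set). a / real CARD('n))"
    by (intro sum_strict_mono) (auto simp: not_le)
  with assms show False by simp
qed

text \<open>
  Moving along a coordinate in which \<open>q\<close> is large decreases the \<open>\<ell>\<^sub>1\<close> norm at unit speed, and this
  outweighs the change in the other coordinates when the cone is narrow.
\<close>
lemma indented_l1:
  assumes c: "0 < c"
  shows "sandwiched_norm.indented (l1_norm :: real ^ 'n \<Rightarrow> real) c (real CARD('n)) (c / (2 * real CARD('n)))"
proof -
  interpret sandwiched_norm "l1_norm :: real ^ 'n \<Rightarrow> real" by (rule sandwiched_norm_l1)
  show ?thesis unfolding indented_def
  proof (intro allI impI)
    fix q :: "real ^ 'n"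
    assume q: "c / 2 \<le> l1_norm q \<and> l1_norm q \<le> c"
    obtain j where j: "c / 2 / real CARD('n) \<le> \<bar>q $ j\<bar>"
      using exists_large_component[of "c / 2" q] q by (auto simp: l1_norm_def)
    define s :: real where "s = (if q $ j \<ge> 0 then 1 else - 1)"
    have s: "s = 1 \<or> s = - 1" "\<bar>q $ j\<bar> = s * q $ j" by (auto simp: s_def)
    show "\<exists>j s. (s = 1 \<or> s = - 1) \<and> (\<forall>v h. 0 \<le> h \<longrightarrow> (\<forall>l. l \<noteq> j \<longrightarrow> \<bar>v $ l\<bar> \<le> h) \<longrightarrow>
        real CARD('n) * h \<le> s * v $ j \<longrightarrow> s * v $ j \<le> c / (2 * real CARD('n)) \<longrightarrow> l1_norm (q - v) \<le> l1_norm q)"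
    proof (intro exI conjI allI impI)
      fix v :: "real ^ 'n" and h
      assume h0: "0 \<le> h" and h: "\<forall>l. l \<noteq> j \<longrightarrow> \<bar>v $ l\<bar> \<le> h" and v: "real CARD('n) * h \<le> s * v $ j" "s * v $ j \<le> c / (2 * real CARD('n))"
      have "l1_norm (q - v) = \<bar>q $ j - v $ j\<bar> + (\<Sum>i\<in>UNIV - {j}. \<bar>q $ i - v $ i\<bar>)"
        unfolding l1_norm_def by (subst sum.remove[of _ j]) auto
      also have "(\<Sum>i\<in>UNIV - {j}. \<bar>q $ i - v $ i\<bar>) \<le> (\<Sum>i\<in>UNIV - {j}. \<bar>q $ i\<bar> + h)"
        by (rule sum_mono) (use h in fastforce)
      also have "\<dots> = (\<Sum>i\<in>UNIV - {j}. \<bar>q $ i\<bar>) + real (CARD('n) - 1) * h"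
        by (simp add: sum.distrib card_Diff_singleton)
      also have "\<bar>q $ j - v $ j\<bar> = \<bar>q $ j\<bar> - s * v $ j"
      proof -
        have "s * v $ j \<le> s * q $ j" 
          using j v(2) s(2) by (simp add: divide_divide_eq_left)
        then show ?thesis using s by auto
      qed
      finally have "l1_norm (q - v) \<le> l1_norm q - s * v $ j + real (CARD('n) - 1) * h"
        unfolding l1_norm_def by (subst (2) sum.remove[of _ j]) auto
      moreover have "real (CARD('n) - 1) * h \<le> s * v $ j"
        using v mult_right_mono[OF _ h0, of "real (CARD('n) - 1)" "real CARD('n)"] by simp
      ultimately show "l1_norm (q - v) \<le> l1_norm q" by simp
    qed (use s in auto)
  qed
qed


text \<open>
  Here \<open>norm (q - v) \<le> norm q\<close> amounts to \<open>v \<bullet> v \<le> 2 * (q \<bullet> v)\<close>. The right-hand side is linear in the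
  height of \<open>v\<close>, with a slope bounded below because some coordinate of \<open>q\<close> is large, while the
  left-hand side is quadratic; thus a short narrow cone suffices.
\<close>
lemma indented_l2:
  assumes c: "0 < c"
  shows "sandwiched_norm.indented (norm :: real ^ 'n \<Rightarrow> real) c (4 * (real CARD('n))\<^sup>2) (c / (4 * real CARD('n)))"
proof -
  interpret sandwiched_norm "norm :: real ^ 'n \<Rightarrow> real" by (rule sandwiched_norm_l2)
  define D where "D = real CARD('n)"
  have D: "1 \<le> D" by (simp add: D_def Suc_leI)
  show ?thesis unfolding indented_def D_def[symmetric]
  proof (intro allI impI)
    fix q :: "real ^ 'n"
    assume q: "c / 2 \<le> norm q \<and> norm q \<le> c"
    obtain j where j: "c / 2 / D \<le> \<bar>q $ j\<bar>"
      using exists_large_component[of "c / 2" q] q norm_le_l1_cart[of q] by (auto simp: D_def)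
    define s :: real where "s = (if q $ j \<ge> 0 then 1 else - 1)"
    have s: "s = 1 \<or> s = - 1" "\<bar>q $ j\<bar> = s * q $ j" by (auto simp: s_def)
    show "\<exists>j s. (s = 1 \<or> s = - 1) \<and> (\<forall>v h. 0 \<le> h \<longrightarrow> (\<forall>l. l \<noteq> j \<longrightarrow> \<bar>v $ l\<bar> \<le> h) \<longrightarrow>
        4 * D\<^sup>2 * h \<le> s * v $ j \<longrightarrow> s * v $ j \<le> c / (4 * D) \<longrightarrow> norm (q - v) \<le> norm q)"
    proof (intro exI conjI allI impI)
      fix v :: "real ^ 'n" and h
      define w where "w = s * v $ j"
      assume h0: "0 \<le> h" and h: "\<forall>l. l \<noteq> j \<longrightarrow> \<bar>v $ l\<bar> \<le> h"
        and "4 * D\<^sup>2 * h \<le> s * v $ j" "s * v $ j \<le> c / (4 * D)"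
      then have w: "4 * D\<^sup>2 * h \<le> w" "w \<le> c / (4 * D)" by (auto simp: w_def)
      have w0: "0 \<le> w"
        using w(1) h0 D by (meson mult_nonneg_nonneg order_trans zero_le_numeral zero_le_power2)
      have rest: "real (CARD('n) - 1) \<le> D" by (simp add: D_def)
      have Dh: "D * h \<le> w / (4 * D)" using w(1) D by (simp add: field_simps power2_eq_square)
      have "v \<bullet> v = v $ j * v $ j + (\<Sum>i\<in>UNIV - {j}. v $ i * v $ i)"
        unfolding inner_vec_def by (subst sum.remove[of _ j]) auto
      also have "(\<Sum>i\<in>UNIV - {j}. v $ i * v $ i) \<le> (\<Sum>i\<in>UNIV - {j}. h * h)"
        using h h0 by (intro sum_mono) (metis DiffD2 abs_ge_zero abs_mult_self_eq insertI1 mult_mono)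
      also have "\<dots> = real (CARD('n) - 1) * (h * h)" by (simp add: card_Diff_singleton)
      also have "\<dots> \<le> D * (h * h)" using rest by (intro mult_right_mono) auto
      also have "\<dots> \<le> (D * h) * (D * h)" 
        using mult_right_mono[OF D, of "D * (h * h)"] D h0 by (simp add: mult_ac)
      also have "\<dots> \<le> w * w"
      proof -
        have "w / (4 * D) \<le> w / 1" using D w0 by (intro divide_left_mono) auto
        then have "D * h \<le> w" using Dh by simp
        then show ?thesis using h0 D by (intro mult_mono) (auto simp: w0)
      qed
      also have "v $ j * v $ j = w * w" using s(1) by (auto simp: w_def)
      finally have vv: "v \<bullet> v \<le> 2 * (w * w)" by simp
      have "q \<bullet> v = q $ j * v $ j + (\<Sum>i\<in>UNIV - {j}. q $ i * v $ i)"
        unfolding inner_vec_def by (subst sum.remove[of _ j]) auto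
      moreover have "q $ j * v $ j = \<bar>q $ j\<bar> * w" using s by (auto simp: w_def)
      moreover have "\<dots> \<ge> c / 2 / D * w" by (rule mult_right_mono[OF j w0])
      moreover have "(\<Sum>i\<in>UNIV - {j}. - (q $ i * v $ i)) \<le> (\<Sum>i\<in>UNIV - {j}. c * h)"
      proof (rule sum_mono)
        fix i assume i: "i \<in> UNIV - {j}"
        have "\<bar>q $ i\<bar> \<le> c" using component_le_norm_cart[of q i] q by linarith
        then have "\<bar>q $ i * v $ i\<bar> \<le> c * h"
          using h i unfolding abs_mult by (intro mult_mono) auto
        then show "- (q $ i * v $ i) \<le> c * h" by simp
      qed
      moreover have "(\<Sum>i\<in>UNIV - {j}. c * h) = real (CARD('n) - 1) * (c * h)"
        by (simp add: card_Diff_singleton)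
      moreover have "\<dots> \<le> D * (c * h)" using rest h0 c by (intro mult_right_mono) auto
      moreover have "D * (c * h) \<le> c * (w / (4 * D))"
        using mult_left_mono[OF Dh, of c] c by (simp add: mult_ac)
      ultimately have "c / 2 / D * w - c * (w / (4 * D)) \<le> q \<bullet> v" by (simp add: sum_negf)
      moreover have "c / 2 / D * w - c * (w / (4 * D)) = c / (4 * D) * w" using D by (simp add: field_simps)
      moreover have "w * w \<le> c / (4 * D) * w" by (rule mult_right_mono[OF w(2) w0])
      ultimately have "v \<bullet> v \<le> 2 * (q \<bullet> v)" using vv by linarith
      then have "(q - v) \<bullet> (q - v) \<le> q \<bullet> q"
        by (simp add: inner_diff_left inner_diff_right inner_commute)
      then show "norm (q - v) \<le> norm q" by (simp add: norm_le)
    qed (use s in auto)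
  qed
qed

section \<open>Irredundant grains lie near few Lipschitz graphs\<close>

locale fixed_radius_norm_model = fixed_radius_model M \<xi> R N rate c + sandwiched_norm nrm
  for M :: "'a measure" and \<xi> :: "nat \<Rightarrow> 'a \<Rightarrow> real ^ 'n" and R N rate c and nrm :: "real ^ 'n \<Rightarrow> real" +
  assumes dim: "2 \<le> CARD('n)"

context sandwiched_norm
begin

text \<open>
  The witness \<open>p\<close> is the private point of the grain \<open>i\<close>. Private points outside the cube are
  admitted: this may keep more grains, but the geometry of their centres is the same.
\<close>
definition irredundant :: "real \<Rightarrow> ('b \<Rightarrow> real ^ 'n) \<Rightarrow> 'b set \<Rightarrow> bool" where
  "irredundant c x I \<longleftrightarrow> (\<forall>i\<in>I. \<exists>p. nrm (p - x i) \<le> c \<and> (\<forall>k\<in>I - {i}. c < nrm (p - x k)))"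

lemma irredundant_subset: "irredundant c x I \<Longrightarrow> J \<subseteq> I \<Longrightarrow> irredundant c x J"
  unfolding irredundant_def by (meson DiffD1 DiffD2 DiffI subsetD)

lemma exists_irredundant:
  "finite I \<Longrightarrow> \<exists>J\<subseteq>I. irredundant c x J \<and> ball_union c x J = ball_union c x I"
proof (induction I rule: finite_psubset_induct)
  case (psubset I)
  show ?case
  proof (cases "irredundant c x I")
    case False
    then obtain i where i: "i \<in> I" "\<And>p. nrm (p - x i) \<le> c \<Longrightarrow> \<exists>k\<in>I - {i}. nrm (p - x k) \<le> c"
      unfolding irredundant_def by (meson not_less)
    have "ball_union c x (I - {i}) = ball_union c x I"
      unfolding ball_union_def norm_cball_def using i by blast
    moreover have "I - {i} \<subset> I" using i by blast
    ultimately show ?thesis using psubset.IH[of "I - {i}"] by (metis Diff_subset subset_trans)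
  qed blast
qed

end

text \<open>
  A column of the grid of mesh \<open>1 / K\<close> in direction \<open>j\<close> is given by \<open>\<kappa>\<close>, and the box is its
  section of height \<open>W / K\<close> starting at level \<open>t\<close>.
\<close>
definition column_box :: "nat \<Rightarrow> real \<Rightarrow> 'n \<Rightarrow> ('n \<Rightarrow> nat) \<Rightarrow> nat \<Rightarrow> (real ^ 'n) set" where
  "column_box K W j \<kappa> t =
     cbox (\<chi> l. if l = j then real t / K else real (\<kappa> l) / K)
          (\<chi> l. if l = j then (real t + W) / K else (real (\<kappa> l) + 1) / K)"

lemma measure_column_box:
  assumes "0 < K" "0 \<le> W"
  shows "measure lborel (column_box K W j \<kappa> t :: (real ^ 'n) set) = W / real K ^ CARD('n)"
proof -
  have "measure lborel (column_box K W j \<kappa> t :: (real ^ 'n) set) =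
        (\<Prod>l\<in>UNIV. (if l = j then W / K else 1 / real K))"
    unfolding column_box_def
    by (subst content_cbox_cart)
      (use assms in \<open>auto simp: interval_ne_empty_cart field_simps intro!: prod.cong\<close>)
  also have "\<dots> = W / K * (1 / real K) ^ (CARD('n) - 1)"
    by (subst prod.remove[of _ j]) (auto simp: card_Diff_singleton)
  also have "\<dots> = W / real K ^ CARD('n)"
    by (cases "CARD('n)") (auto simp: power_divide)
  finally show ?thesis .
qed

text \<open>
  A label records all that is needed to compare two grains: the direction \<open>j\<close> and the sign of the
  cone at the private point, the slice of thickness \<open>\<rho>\<close> (numbered up to \<open>B\<close>) containing the \<open>j\<close>-th
  coordinate, and the column. Coordinates equal to \<open>1\<close> are the reason for the index \<open>K\<close> being
  included.
\<close>
definition column_labels :: "nat \<Rightarrow> nat \<Rightarrow> ('n::finite \<times> bool \<times> nat \<times> ('n \<Rightarrow> nat)) set" where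
  "column_labels B K = (SIGMA j:UNIV. UNIV \<times> {..B} \<times> (UNIV - {j} \<rightarrow>\<^sub>E {..K}))"

lemma finite_column_labels: "finite (column_labels B K)"
  unfolding column_labels_def by (intro finite_SigmaI finite_cartesian_product finite_PiE) auto

lemma card_column_labels:
  "card (column_labels B K :: ('n::finite \<times> _) set) = CARD('n) * 2 * Suc B * Suc K ^ (CARD('n) - 1)"
proof -
  have "card (column_labels B K :: ('n::finite \<times> _) set) =
      (\<Sum>j\<in>(UNIV :: 'n set). card ((UNIV :: bool set) \<times> {..B} \<times> (UNIV - {j} \<rightarrow>\<^sub>E {..K})))"
    unfolding column_labels_def by (rule card_SigmaI) (auto intro!: finite_cartesian_product finite_PiE)
  then show ?thesis
    by (simp add: card_cartesian_product card_PiE card_Diff_singleton algebra_simps)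
qed

text \<open>
  One box in each labelled column: a discretised union of boundedly many graphs over the
  coordinate hyperplanes, with arbitrary height functions \<open>\<phi>\<close>.
\<close>
definition region :: "nat \<Rightarrow> nat \<Rightarrow> real \<Rightarrow> (('n::finite \<times> bool \<times> nat \<times> ('n \<Rightarrow> nat)) \<Rightarrow> nat) \<Rightarrow> (real ^ 'n) set" where
  "region B K W \<phi> = (\<Union>(j, s, b, \<kappa>)\<in>column_labels B K. column_box K W j \<kappa> (\<phi> (j, s, b, \<kappa>)))"

lemma region_measurable [measurable]: "region B K W \<phi> \<in> sets borel"
  unfolding region_def column_box_def
  by (intro sets.finite_UN finite_column_labels) auto

lemma measure_region_le:
  fixes \<phi> :: "('n::finite \<times> bool \<times> nat \<times> ('n \<Rightarrow> nat)) \<Rightarrow> nat"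
  assumes "0 < K" "0 \<le> W"
  shows "measure lborel (cbox 0 1 \<inter> region B K W \<phi>)
         \<le> real (card (column_labels B K :: ('n \<times> _) set)) * (W / real K ^ CARD('n))"
proof -
  let ?f = "\<lambda>(j, s, b, \<kappa>). column_box K W j \<kappa> (\<phi> (j, s, b, \<kappa>))"
  have lm: "?f a \<in> lmeasurable" for a by (cases a) (auto simp: column_box_def)
  have box: "measure lebesgue (column_box K W j \<kappa> t :: (real ^ 'n) set) = W / real K ^ CARD('n)" for j \<kappa> t
    by (subst measure_completion) (use measure_column_box[OF assms] in \<open>auto simp: column_box_def\<close>)
  have "measure lborel (cbox 0 1 \<inter> region B K W \<phi>) = measure lebesgue (cbox 0 1 \<inter> region B K W \<phi>)"
    by (subst measure_completion) auto
  also have "\<dots> \<le> measure lebesgue (region B K W \<phi>)"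
  proof (rule measure_mono_fmeasurable)
    show "region B K W \<phi> \<in> lmeasurable"
      unfolding region_def by (intro fmeasurable.finite_UN finite_column_labels) (use lm in auto)
  qed auto
  also have "\<dots> \<le> (\<Sum>a\<in>column_labels B K. measure lebesgue (?f a))"
    unfolding region_def by (intro measure_UNION_le finite_column_labels) (use lm in \<open>auto simp: fmeasurableD\<close>)
  also have "\<dots> = (\<Sum>a\<in>(column_labels B K :: ('n \<times> _) set). W / real K ^ CARD('n))"
    by (intro sum.cong refl) (auto simp: box split: prod.splits)
  finally show ?thesis by simp
qed

lemma in_column_box_iff:
  assumes "0 < K"
  shows "x \<in> column_box K W j \<kappa> t \<longleftrightarrow>
    real t \<le> K * x $ j \<and> K * x $ j \<le> real t + W \<and>
    (\<forall>l. l \<noteq> j \<longrightarrow> real (\<kappa> l) \<le> K * x $ l \<and> K * x $ l \<le> real (\<kappa> l) + 1)"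
  using assms unfolding column_box_def mem_box_cart
  by (auto simp: pos_divide_le_eq pos_le_divide_eq mult.commute)

text \<open>
  Two irredundant grains with the same label cannot differ by more than \<open>L / K\<close> in direction \<open>j\<close>:
  otherwise one centre would lie in the cone at the other, towards the private point of the
  latter, and would cover that point too. Hence each labelled column needs a single box, placed at
  the lowest grain of that label.
\<close>
lemma (in sandwiched_norm) irredundant_in_region:
  fixes x :: "'b \<Rightarrow> real ^ 'n"
  assumes ind: "indented c L \<rho>" and L: "0 < L" and c: "0 < c" and \<rho>: "0 < \<rho>" "real CARD('n) * \<rho> \<le> c / 2"
    and K: "0 < K" "1 / real K \<le> \<rho>"
    and J: "finite J" "\<And>i. i \<in> J \<Longrightarrow> x i \<in> cbox 0 1" "irredundant c x J"
  shows "\<exists>\<phi> \<in> column_labels (nat \<lfloor>1 / \<rho>\<rfloor>) K \<rightarrow>\<^sub>E {..K}. \<forall>i\<in>J. x i \<in> region (nat \<lfloor>1 / \<rho>\<rfloor>) K (L + 1) \<phi>"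
proof -
  define B where "B = nat \<lfloor>1 / \<rho>\<rfloor>"
  obtain p where p: "\<And>i. i \<in> J \<Longrightarrow> nrm (p i - x i) \<le> c"
    "\<And>i k. i \<in> J \<Longrightarrow> k \<in> J \<Longrightarrow> k \<noteq> i \<Longrightarrow> c < nrm (p i - x k)"
    using J(3) unfolding irredundant_def by (metis DiffI singletonD)
  define good :: "real ^ 'n \<Rightarrow> 'n \<times> real \<Rightarrow> bool" where
    "good q js \<longleftrightarrow> (snd js = 1 \<or> snd js = - 1) \<and> (\<forall>v h. 0 \<le> h \<longrightarrow> (\<forall>l. l \<noteq> fst js \<longrightarrow> \<bar>v $ l\<bar> \<le> h) \<longrightarrow>
       L * h \<le> snd js * v $ fst js \<longrightarrow> snd js * v $ fst js \<le> \<rho> \<longrightarrow> nrm (q - v) \<le> nrm q)" for q js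
  have "\<forall>q. \<exists>js. c / 2 \<le> nrm q \<and> nrm q \<le> c \<longrightarrow> good q js"
    using ind unfolding indented_def good_def by auto
  from choice[OF this] obtain f where f: "\<And>q. c / 2 \<le> nrm q \<Longrightarrow> nrm q \<le> c \<Longrightarrow> good q (f q)"
    by blast
  define jj where "jj i = fst (f (p i - x i))" for i
  define ss where "ss i = snd (f (p i - x i))" for i
  define lab where "lab i = (jj i, 0 < ss i, nat \<lfloor>x i $ jj i / \<rho>\<rfloor>,
     restrict (\<lambda>l. nat \<lfloor>K * x i $ l\<rfloor>) (UNIV - {jj i}))" for i
  define ht where "ht i = nat \<lfloor>K * x i $ jj i\<rfloor>" for i
  have x01: "0 \<le> x i $ l" "x i $ l \<le> 1" if "i \<in> J" for i l
    using J(2)[OF that] by (auto simp: mem_box_cart)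
  have bound: "nat \<lfloor>K * x i $ l\<rfloor> \<le> K" if "i \<in> J" for i l
  proof -
    have "real K * x i $ l \<le> real K" using x01(2)[OF that, of l] by (simp add: mult_left_le)
    then show ?thesis by linarith
  qed
  have labels: "lab i \<in> column_labels B K" if i: "i \<in> J" for i
  proof -
    have "x i $ jj i / \<rho> \<le> 1 / \<rho>" using x01[OF i] \<rho> by (simp add: divide_right_mono)
    then have "nat \<lfloor>x i $ jj i / \<rho>\<rfloor> \<le> B"
      unfolding B_def by (intro nat_mono floor_mono)
    then show ?thesis using bound[OF i] unfolding lab_def column_labels_def by auto
  qed
  have close: "K * x k $ jj i - K * x i $ jj i \<le> L" if ik: "i \<in> J" "k \<in> J" "lab i = lab k" for i k
  proof (cases "i = k")
    case False
    have jk: "jj k = jj i" and sk: "0 < ss i \<longleftrightarrow> 0 < ss k"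
      and bk: "nat \<lfloor>x i $ jj i / \<rho>\<rfloor> = nat \<lfloor>x k $ jj i / \<rho>\<rfloor>"
      and rk: "restrict (\<lambda>l. nat \<lfloor>K * x i $ l\<rfloor>) (UNIV - {jj i}) = restrict (\<lambda>l. nat \<lfloor>K * x k $ l\<rfloor>) (UNIV - {jj i})"
      using ik(3) by (auto simp: lab_def)
    have "\<lfloor>x i $ jj i / \<rho>\<rfloor> = \<lfloor>x k $ jj i / \<rho>\<rfloor>"
      using bk x01 ik \<rho> by (simp add: eq_nat_nat_iff)
    then have "\<bar>x k $ jj i / \<rho> - x i $ jj i / \<rho>\<bar> \<le> 1" by linarith
    then have vj: "\<bar>x k $ jj i - x i $ jj i\<bar> \<le> \<rho>"
      using \<rho> by (simp add: diff_divide_distrib[symmetric] pos_divide_le_eq)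
    have vl: "\<bar>x k $ l - x i $ l\<bar> \<le> 1 / real K" if l: "l \<noteq> jj i" for l
    proof -
      have "nat \<lfloor>K * x i $ l\<rfloor> = nat \<lfloor>K * x k $ l\<rfloor>"
        using fun_cong[OF rk, of l] l by auto
      then have "\<lfloor>K * x i $ l\<rfloor> = \<lfloor>K * x k $ l\<rfloor>"
        using x01 ik K by (simp add: eq_nat_nat_iff)
      then have "\<bar>K * x k $ l - K * x i $ l\<bar> \<le> 1" by linarith
      then have "\<bar>K * (x k $ l - x i $ l)\<bar> \<le> 1" by (simp add: right_diff_distrib)
      then show ?thesis using K by (simp add: abs_mult pos_le_divide_eq mult.commute)
    qed
    have "\<bar>(x k - x i) $ l\<bar> \<le> \<rho>" for l
      using vj vl[of l] K(2) by (cases "l = jj i") auto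
    from nrm_le_max[OF this] have nki: "nrm (x k - x i) \<le> c / 2" using \<rho>(2) by linarith
    \<comment> \<open>The private point of one grain has distance more than \<open>c\<close> from the other centre, which is
      near; so it is far enough from its own centre for the cone condition to apply.\<close>
    then have nik: "nrm (x i - x k) \<le> c / 2" by (subst nrm_commute)
    have qi: "c / 2 \<le> nrm (p i - x i)" using p(2)[OF ik(1,2)] False nrm_triangle3[of "p i" "x k" "x i"] nik
      by auto
    have qk: "c / 2 \<le> nrm (p k - x k)" using p(2)[OF ik(2,1)] False nrm_triangle3[of "p k" "x i" "x k"] nki
      by auto
    note fi = f[OF qi p(1)[OF ik(1)], unfolded good_def, folded jj_def ss_def]
    note fk = f[OF qk p(1)[OF ik(2)], unfolded good_def, folded jj_def ss_def, unfolded jk]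
    show ?thesis
    proof (rule ccontr)
      assume "\<not> ?thesis"
      then have "L \<le> K * (x k $ jj i - x i $ jj i)" by (simp add: right_diff_distrib)
      then have big: "L * (1 / real K) \<le> x k $ jj i - x i $ jj i"
        using K by (simp add: pos_divide_le_eq mult.commute)
      show False
      \<comment> \<open>For a positive sign \<open>x k\<close> covers the private point of \<open>i\<close>, for a negative one \<open>x i\<close> covers
        that of \<open>k\<close>.\<close>
      proof (cases "0 < ss i")
        case True
        then have "ss i = 1" using fi by auto
        then have "nrm ((p i - x i) - (x k - x i)) \<le> nrm (p i - x i)"
          using vl vj big by (intro fi[THEN conjunct2, rule_format, of "1 / real K"]) auto
        then show False using p(1)[OF ik(1)] p(2)[OF ik(1,2)] False by simp
      next
        case s: False
        then have "ss k = - 1" using fk sk by auto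
        then have "nrm ((p k - x k) - (x i - x k)) \<le> nrm (p k - x k)"
          using vl vj big by (intro fk[THEN conjunct2, rule_format, of "1 / real K"]) (auto simp: abs_minus_commute)
        then show False using p(1)[OF ik(2)] p(2)[OF ik(2,1)] False by simp
      qed
    qed
  qed (use L in simp)
  define \<phi> where "\<phi> = restrict (\<lambda>a. if \<exists>i\<in>J. lab i = a then Min (ht ` {i\<in>J. lab i = a}) else 0) (column_labels B K)"
  have "\<phi> \<in> (column_labels B K :: ('n \<times> bool \<times> nat \<times> ('n \<Rightarrow> nat)) set) \<rightarrow>\<^sub>E {..K}"
  proof (rule PiE_I)
    fix a :: "'n \<times> bool \<times> nat \<times> ('n \<Rightarrow> nat)"
    assume a: "a \<in> column_labels B K"
    show "\<phi> a \<in> {..K}"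
    proof (cases "\<exists>i\<in>J. lab i = a")
      case True
      then have "Min (ht ` {i\<in>J. lab i = a}) \<in> ht ` {i\<in>J. lab i = a}"
        using J(1) by (intro Min_in) auto
      then show ?thesis using True a bound by (auto simp: \<phi>_def ht_def)
    qed (use a in \<open>auto simp: \<phi>_def\<close>)
  qed (auto simp: \<phi>_def)
  moreover have "x k \<in> region B K (L + 1) \<phi>" if k: "k \<in> J" for k
  proof -
    have "Min (ht ` {i\<in>J. lab i = lab k}) \<in> ht ` {i\<in>J. lab i = lab k}"
      using J(1) k by (intro Min_in) auto
    then obtain i where i: "i \<in> J" "lab i = lab k" "Min (ht ` {i\<in>J. lab i = lab k}) = ht i" by auto
    have "\<phi> (lab k) = ht i" using labels[OF k] k i by (auto simp: \<phi>_def)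
    moreover have "ht i \<le> ht k"
      unfolding i(3)[symmetric] using J(1) k by (intro Min_le) auto
    moreover have jk: "jj i = jj k" using i(2) by (auto simp: lab_def)
    have "real (ht k) \<le> K * x k $ jj k" using x01[OF k] by (auto simp: ht_def)
    moreover have "K * x i $ jj k \<le> ht i + 1" using x01[OF i(1)] jk by (auto simp: ht_def) linarith
    moreover have "K * x k $ jj k - K * x i $ jj k \<le> L" using close[OF i(1) k i(2)] jk by simp
    moreover have "real (nat \<lfloor>K * x k $ l\<rfloor>) \<le> K * x k $ l \<and> K * x k $ l \<le> real (nat \<lfloor>K * x k $ l\<rfloor>) + 1" for l
      using x01[OF k, of l] by auto
    ultimately have "x k \<in> column_box K (L + 1) (jj k) (restrict (\<lambda>l. nat \<lfloor>K * x k $ l\<rfloor>) (UNIV - {jj k})) (\<phi> (lab k))"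
      by (auto simp: in_column_box_iff[OF K(1)])
    then show ?thesis
      unfolding region_def using labels[OF k] by (intro UN_I[of "lab k"]) (auto simp: lab_def)
  qed
  ultimately show ?thesis unfolding B_def by blast
qed

text \<open>
  A union bound over all height functions: their number is the first factor, and the second one
  bounds the probability that \<open>m\<close> centres fall into a given region, whose volume is of order
  \<open>1 / K\<close>. The event is replaced by a measurable set \<open>G\<close> that contains it almost surely.
\<close>
lemma (in fixed_radius_norm_model) prob_irredundant:
  fixes K m Q :: nat
  assumes ind: "indented c L \<rho>" and L: "0 < L" and \<rho>: "0 < \<rho>" "real CARD('n) * \<rho> \<le> c / 2"
    and K: "0 < K" "1 / real K \<le> \<rho>" and Q: "Q = CARD('n) * 2 * Suc (nat \<lfloor>1 / \<rho>\<rfloor>)"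
  shows "\<exists>G\<in>sets M. emeasure M G \<le> ennreal (real (Suc K) ^ (Q * Suc K ^ (CARD('n) - 1)) *
            ((rate * real Q * 2 ^ (CARD('n) - 1) * (L + 1) / real K) ^ m / fact m)) \<and>
          (\<forall>\<omega>\<in>space M. (\<forall>i. \<xi> i \<omega> \<in> cbox 0 1) \<longrightarrow>
             (\<exists>J\<subseteq>{..<N \<omega>}. card J = m \<and> irredundant c (\<lambda>i. \<xi> i \<omega>) J) \<longrightarrow> \<omega> \<in> G)"
proof -
  define B where "B = nat \<lfloor>1 / \<rho>\<rfloor>"
  let ?L = "column_labels B K :: ('n \<times> bool \<times> nat \<times> ('n \<Rightarrow> nat)) set"
  let ?\<Phi> = "?L \<rightarrow>\<^sub>E {..K}"
  define v where "v = real Q * 2 ^ (CARD('n) - 1) * (L + 1) / real K"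
  define F where "F \<phi> = {\<omega> \<in> space M. \<exists>J. J \<subseteq> {..<N \<omega>} \<and> card J = m \<and> (\<forall>i\<in>J. \<xi> i \<omega> \<in> region B K (L + 1) \<phi>)}" for \<phi>
  have card: "card ?L = Q * Suc K ^ (CARD('n) - 1)"
    unfolding card_column_labels Q B_def ..
  have v: "measure lborel (cbox 0 1 \<inter> region B K (L + 1) \<phi>) \<le> v" for \<phi> :: "('n \<times> bool \<times> nat \<times> ('n \<Rightarrow> nat)) \<Rightarrow> nat"
  proof -
    have "real (Suc K) ^ (CARD('n) - 1) \<le> (2 * real K) ^ (CARD('n) - 1)"
      using K by (intro power_mono) auto
    then have "real (Suc K) ^ (CARD('n) - 1) / real K ^ CARD('n) \<le> (2 * real K) ^ (CARD('n) - 1) / real K ^ CARD('n)"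
      by (intro divide_right_mono) auto
    also have "\<dots> = 2 ^ (CARD('n) - 1) / real K"
      using K by (cases "CARD('n)") (auto simp: power_mult_distrib field_simps)
    finally have "(real Q * (L + 1)) * (real (Suc K) ^ (CARD('n) - 1) / real K ^ CARD('n)) \<le> (real Q * (L + 1)) * (2 ^ (CARD('n) - 1) / real K)"
      using L by (intro mult_left_mono) auto
    with measure_region_le[OF K(1), of "L + 1" B \<phi>] L show ?thesis
      unfolding card v_def by (simp add: mult_ac)
  qed
  note F = prob_many_centres[OF region_measurable v, of m, folded F_def]
  have fin: "finite ?\<Phi>" by (intro finite_PiE finite_column_labels) auto
  have "emeasure M (\<Union>\<phi>\<in>?\<Phi>. F \<phi>) \<le> (\<Sum>\<phi>\<in>?\<Phi>. emeasure M (F \<phi>))"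
    by (rule emeasure_subadditive_finite[OF fin]) (use F in auto)
  also have "\<dots> \<le> (\<Sum>\<phi>\<in>?\<Phi>. ennreal ((rate * v) ^ m / fact m))"
    by (rule sum_mono) (rule F)
  also have "\<dots> = ennreal (real (card ?\<Phi>) * ((rate * v) ^ m / fact m))"
    
    unfolding sum_constant ennreal_of_nat_eq_real_of_nat by (rule ennreal_mult'[symmetric]) simp
  also have "real (card ?\<Phi>) = real (Suc K) ^ (Q * Suc K ^ (CARD('n) - 1))"
    by (simp add: card_PiE finite_column_labels card)
  finally have "emeasure M (\<Union>\<phi>\<in>?\<Phi>. F \<phi>) \<le> ennreal (real (Suc K) ^ (Q * Suc K ^ (CARD('n) - 1)) * ((rate * v) ^ m / fact m))" .
  moreover have "(\<Union>\<phi>\<in>?\<Phi>. F \<phi>) \<in> sets M"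
    using fin F by (intro sets.finite_UN) auto
  moreover have "\<omega> \<in> (\<Union>\<phi>\<in>?\<Phi>. F \<phi>)" if \<omega>: "\<omega> \<in> space M" "\<forall>i. \<xi> i \<omega> \<in> cbox 0 1" "J \<subseteq> {..<N \<omega>}" "card J = m" "irredundant c (\<lambda>i. \<xi> i \<omega>) J" for \<omega> J
  proof -
    have "finite J" using \<omega>(3) finite_subset by blast
    from irredundant_in_region[OF ind L radius_pos \<rho> K this _ \<omega>(5)] \<omega>(2)
    obtain \<phi> where "\<phi> \<in> ?\<Phi>" "\<forall>i\<in>J. \<xi> i \<omega> \<in> region B K (L + 1) \<phi>" unfolding B_def by auto
    moreover from this have "\<omega> \<in> F \<phi>" using \<omega> unfolding F_def by auto
    ultimately show ?thesis by (rule_tac UN_I)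
  qed
  ultimately show ?thesis
    unfolding v_def by (intro bexI[of _ "\<Union>\<phi>\<in>?\<Phi>. F \<phi>"]) (auto simp: mult_ac)
qed

lemma (in fixed_radius_norm_model) AE_boolean_set:
  "AE \<omega> in M. boolean_set nrm \<xi> R N \<omega> = ball_union c (\<lambda>i. \<xi> i \<omega>) {..<N \<omega>} \<and> (\<forall>i. \<xi> i \<omega> \<in> cbox 0 1)"
  using AE_radius AE_centre by eventually_elim (simp add: boolean_set_def ball_union_def)

section \<open>Optimising the upper exponent\<close>

lemma power_over_fact_le_exp: "0 \<le> x \<Longrightarrow> x ^ m / fact m \<le> exp (x :: real)"
proof -
  assume x: "0 \<le> x"
  have "sum (\<lambda>n. x ^ n /\<^sub>R fact n) {m} \<le> (\<Sum>n. x ^ n /\<^sub>R fact n)"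
    by (rule sum_le_suminf) (use x summable_exp_generic[of x] in auto)
  then show ?thesis by (simp add: exp_def divide_inverse mult.commute)
qed

text \<open>
  The number of columns, of order \<open>K ^ D\<close>, is chosen as a small multiple \<open>\<theta> m\<close> of the number of grains.
  Then even the crude count of all height functions costs only \<open>exp (\<eta> m ln m)\<close>, so their Lipschitz
  property need not be counted, and \<open>1 / K\<close> still is of the order of \<open>m\<close> to the power \<open>- 1 / D\<close>.
\<close>
lemma crowded_region_asymp:
  fixes D Q K0 :: nat and C \<eta> :: real
  assumes D: "1 \<le> D" and C: "0 < C" and \<eta>: "0 < \<eta>"
  shows "\<forall>\<^sub>F m in sequentially. \<exists>K\<ge>K0. 0 < K \<and>
    real (Suc K) ^ (Q * Suc K ^ D) * ((C / real K) ^ m / fact m) \<le> exp (- ((1 + 1 / D) * (1 - \<eta>) * m * ln m))"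
proof -
  define \<theta> where "\<theta> = min 1 (\<eta> / (2 * (real Q + 1)))"
  have \<theta>: "0 < \<theta>" "\<theta> \<le> 1" "Q * \<theta> \<le> \<eta> / 2"
  proof -
    have "real Q * \<theta> \<le> real Q * (\<eta> / (2 * (real Q + 1)))"
      unfolding \<theta>_def by (intro mult_left_mono) auto
    also have "\<dots> \<le> \<eta> / 2" using \<eta> by (simp add: field_simps)
    finally show "Q * \<theta> \<le> \<eta> / 2" .
  qed (use \<eta> in \<open>auto simp: \<theta>_def\<close>)
  define C' where "C' = ln C + 1 + ln 2 - ln \<theta> / D"
  have "filterlim (\<lambda>m. (\<theta> * real m) powr (1 / real D)) at_top sequentially"
    using \<theta>(1) D by real_asymp
  then have e1: "\<forall>\<^sub>F m in sequentially. max 4 (real K0 + 2) \<le> (\<theta> * real m) powr (1 / D)"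
    unfolding filterlim_at_top by (rule spec)
  have "filterlim (\<lambda>m. ln (real m)) at_top sequentially" by real_asymp
  then have e2: "\<forall>\<^sub>F m in sequentially. 2 * C' / \<eta> \<le> ln (real m)"
    by (simp add: filterlim_at_top)
  show ?thesis
    using e1 e2 eventually_ge_at_top[of 1]
  proof eventually_elim
    case (elim m)
    define y where "y = (\<theta> * real m) powr (1 / D)"
    define K where "K = nat \<lfloor>y\<rfloor> - 1"
    have y: "4 \<le> y" "real K0 + 2 \<le> y" using elim(1) by (auto simp: y_def)
    have K: "real (Suc K) \<le> y" "y - 2 \<le> real K" "0 < K" "K0 \<le> K"
      using y unfolding K_def by linarith+
    have \<theta>m: "0 < \<theta> * m" "\<theta> * m \<le> m"
      using \<theta> elim(3) by (auto simp: mult_left_le_one_le)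
    have "y ^ D = y powr D" using y(1) by (simp add: powr_realpow)
    then have yD: "y ^ D = \<theta> * m" using \<theta>m(1) D by (simp add: y_def powr_powr)
    have "y ^ 1 \<le> y ^ D" by (rule power_increasing) (use D y in auto)
    then have ym: "y \<le> m" using yD \<theta>m by simp
    have lnm: "0 \<le> ln (real m)" using elim(3) by simp
    have lnK: "ln (real (Suc K)) \<le> ln m" using K(1) ym by simp
    have "real (Suc K) ^ D \<le> y ^ D" by (rule power_mono) (use K in auto)
    then have sK: "real (Q * Suc K ^ D) \<le> Q * (\<theta> * m)" unfolding yD by (simp add: mult_left_mono)
    have "real (Q * Suc K ^ D) * ln (real (Suc K)) \<le> Q * (\<theta> * m) * ln m"
      by (rule mult_mono[OF sK lnK]) (use \<theta>m in auto)
    also have "\<dots> = (Q * \<theta>) * (m * ln m)" by simp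
    also have "\<dots> \<le> \<eta> / 2 * (m * ln m)"
      by (rule mult_right_mono[OF \<theta>(3)]) (use lnm in auto)
    finally have b1: "real (Q * Suc K ^ D) * ln (real (Suc K)) \<le> \<eta> / 2 * (m * ln m)" .
    have "real (Suc K) ^ (Q * Suc K ^ D) = exp (real (Q * Suc K ^ D) * ln (real (Suc K)))"
      by (subst exp_of_nat_mult) simp
    with b1 have f1: "real (Suc K) ^ (Q * Suc K ^ D) \<le> exp (\<eta> / 2 * (m * ln m))" by simp
    have "ln (C / real K) \<le> ln (C / (y / 2))"
      using C K y by (intro ln_mono divide_left_mono) auto
    also have "\<dots> = ln C + ln 2 - ln y" using C y by (simp add: ln_div ln_mult)
    also have "ln y = (ln \<theta> + ln m) / D"
      using \<theta>m \<theta> elim(3) by (simp add: y_def ln_powr ln_mult)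
    finally have "ln (C / real K) \<le> C' - 1 - ln m / D" by (simp add: C'_def add_divide_distrib)
    then have "m * ln (C / real K) \<le> m * (C' - 1 - ln m / D)" by (intro mult_left_mono) auto
    moreover have "(C / real K) ^ m = exp (m * ln (C / real K))"
      using C K by (subst exp_of_nat_mult) simp
    ultimately have f2: "(C / real K) ^ m \<le> exp (m * (C' - 1 - ln m / D))" by simp
    have "real m ^ m = exp (m * ln m)" using elim(3) by (subst exp_of_nat_mult) simp
    then have "exp (m * ln m) / fact m \<le> exp m" using power_over_fact_le_exp[of m m] by simp
    then have "exp (m * ln m) \<le> exp m * fact m" by (simp add: pos_divide_le_eq)
    then have "1 / fact m \<le> exp (m - m * ln m)" by (simp add: exp_diff field_simps)
    then have f3: "(C / real K) ^ m * (1 / fact m) \<le> exp (m * (C' - 1 - ln m / D)) * exp (m - m * ln m)"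
      by (intro mult_mono f2) auto
    have "real (Suc K) ^ (Q * Suc K ^ D) * ((C / real K) ^ m * (1 / fact m))
       \<le> exp (\<eta> / 2 * (m * ln m)) * (exp (m * (C' - 1 - ln m / D)) * exp (m - m * ln m))"
      by (rule mult_mono[OF f1 f3]) (use C in auto)
    also have "\<dots> = exp (\<eta> / 2 * (m * ln m) + (m * (C' - 1 - ln m / D) + (m - m * ln m)))"
      by (simp add: exp_add)
    also have "\<dots> \<le> exp (- ((1 + 1 / D) * (1 - \<eta>) * m * ln m))"
    proof -
      have "C' \<le> \<eta> / 2 * ln m" using elim(2) \<eta> by (simp add: field_simps)
      then have "m * C' \<le> m * (\<eta> / 2 * ln m)" by (intro mult_left_mono) auto
      moreover have "0 \<le> \<eta> / D * (m * ln m)" using \<eta> lnm by simp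
      ultimately show ?thesis by (simp add: algebra_simps diff_divide_distrib)
    qed
    finally show ?case using K by (intro exI[of _ K]) auto
  qed
qed

text \<open>
  For \<open>m\<close> below a power of \<open>r\<close> slightly less than \<open>1 / 2\<close> the precision of the code is already more
  than enough. For larger \<open>m\<close> one has \<open>ln m \<ge> (1 - \<eta>) (ln r) / 2\<close>, and the inequality between the
  arithmetic and the geometric mean bounds the sum of both exponents. Beyond \<open>sqrt r\<close> grains, the
  probability alone suffices.
\<close>
lemma upper_exponent_asymp:
  fixes D m0 :: nat and \<eta> :: real
  defines "g \<equiv> \<lambda>r. sqrt (2 / (real D - 1) * r * ln r)"
  assumes D: "2 \<le> D" and \<eta>: "0 < \<eta>" "\<eta> < 1"
  shows "\<forall>\<^sub>F r in at_top. \<forall>m::nat. 1 \<le> m \<longrightarrow> real m \<le> sqrt r \<longrightarrow>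
     (1 - \<eta>)\<^sup>2 * g r \<le> (r - ln r - 1) / (D * m) + (if m < m0 then 0 else D / (real D - 1) * (1 - \<eta>) * m * ln m)"
    and "\<forall>\<^sub>F r in at_top. \<forall>m::nat. sqrt r \<le> m \<longrightarrow> (1 - \<eta>)\<^sup>2 * g r \<le> D / (real D - 1) * (1 - \<eta>) * m * ln m"
proof -
  have cancel: "(p * r / (d * m)) * (d / a * p * m * l) = p\<^sup>2 * r / a * l"
    if "d \<noteq> 0" "m \<noteq> 0" "a \<noteq> 0" for p r d m a l :: real
    using that by (simp add: field_simps power2_eq_square)
  define a where "a = real D - 1"
  have a: "1 \<le> a" "real D = a + 1" "0 < a" using D by (auto simp: a_def)
  have sq: "(1 - \<eta>)\<^sup>2 \<le> 1" "0 \<le> (1 - \<eta>)\<^sup>2"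
    using \<eta> by (auto simp: power_le_one)
  have e1: "\<forall>\<^sub>F r in at_top. (1 - \<eta>) * r \<le> r - ln r - 1" using \<eta> by real_asymp
  have e2: "\<forall>\<^sub>F r in at_top. g r \<le> (1 - \<eta>) / D * r powr (1 / 2 + \<eta> / 2)"
    unfolding g_def a_def[symmetric] a(2) using \<eta> a(3) by real_asymp
  have "filterlim (\<lambda>r. r powr (1 / 2 - \<eta> / 2)) at_top at_top" using \<eta> by real_asymp
  then have e3: "\<forall>\<^sub>F r in at_top. real m0 + 1 \<le> r powr (1 / 2 - \<eta> / 2)"
    unfolding filterlim_at_top by (rule spec)
  have e4: "\<forall>\<^sub>F r in at_top. g r \<le> (1 - \<eta>) * (sqrt r * (ln r / 2))"
    unfolding g_def a_def[symmetric] using \<eta> a(3) by real_asymp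
  show "\<forall>\<^sub>F r in at_top. \<forall>m::nat. 1 \<le> m \<longrightarrow> real m \<le> sqrt r \<longrightarrow>
     (1 - \<eta>)\<^sup>2 * g r \<le> (r - ln r - 1) / (D * m) + (if m < m0 then 0 else D / (real D - 1) * (1 - \<eta>) * m * ln m)"
    using e1 e2 e3 eventually_gt_at_top[of 1]
  proof eventually_elim
    case (elim r)
    have r: "1 < r" "0 < ln r" using elim(4) by auto
    have g0: "0 \<le> g r" unfolding g_def a_def[symmetric] using a(3) r by auto
    have gsmall: "(1 - \<eta>)\<^sup>2 * g r \<le> g r" using sq g0 by (simp add: mult_left_le_one_le)
    show ?case
    proof (intro allI impI)
      fix m :: nat assume m: "1 \<le> m" "real m \<le> sqrt r"
      define Y where "Y = D / (real D - 1) * (1 - \<eta>) * m * ln m"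
      have Y0: "0 \<le> Y" unfolding Y_def using D \<eta> m by simp
      have u: "(1 - \<eta>) * r / (D * m) \<le> (r - ln r - 1) / (D * m)"
        using elim(1) by (intro divide_right_mono) auto
      show "(1 - \<eta>)\<^sup>2 * g r \<le> (r - ln r - 1) / (D * m) + (if m < m0 then 0 else D / (real D - 1) * (1 - \<eta>) * m * ln m)"
      proof (cases "real m \<le> r powr (1 / 2 - \<eta> / 2)")
        case True
        have "r powr (1 / 2 + \<eta> / 2) * r powr (1 / 2 - \<eta> / 2) = r"
          using r by (simp add: powr_add[symmetric])
        then have "r powr (1 / 2 + \<eta> / 2) * m \<le> r"
          using mult_left_mono[OF True, of "r powr (1 / 2 + \<eta> / 2)"] by simp
        then have "r powr (1 / 2 + \<eta> / 2) \<le> r / m" using m by (simp add: pos_le_divide_eq)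
        then have "(1 - \<eta>) / D * r powr (1 / 2 + \<eta> / 2) \<le> (1 - \<eta>) / D * (r / m)"
          using \<eta> by (intro mult_left_mono) auto
        then have "g r \<le> (1 - \<eta>) * r / (D * m)" using elim(2) by simp
        then show ?thesis using u gsmall Y0 unfolding Y_def by auto
      next
        case False
        then have m': "r powr (1 / 2 - \<eta> / 2) \<le> m" by simp
        have mm0: "\<not> m < m0" using m' elim(3) by linarith
        have "ln (r powr (1 / 2 - \<eta> / 2)) \<le> ln m" using m' r by (intro ln_mono) auto
        then have lnm: "(1 - \<eta>) / 2 * ln r \<le> ln m" using r by (simp add: ln_powr diff_divide_distrib)
        define X where "X = (1 - \<eta>) * r / (D * m)"
        have X0: "0 \<le> X" unfolding X_def using \<eta> r by simp
        have "(1 - \<eta>)\<^sup>2 * g r = sqrt (((1 - \<eta>)\<^sup>2)\<^sup>2 * (2 / a * r * ln r))"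
          unfolding g_def a_def real_sqrt_mult[of "((1 - \<eta>)\<^sup>2)\<^sup>2"] by (simp only: real_sqrt_abs) simp
        also have "\<dots> \<le> sqrt (4 * (X * Y))"
        proof (rule real_sqrt_le_mono)
          have "X * Y = (1 - \<eta>)\<^sup>2 * r / a * ln m"
            unfolding X_def Y_def a_def[symmetric] of_nat_mult by (rule cancel) (use D m a(3) in auto)
          also have "\<dots> \<ge> (1 - \<eta>)\<^sup>2 * r / a * ((1 - \<eta>) / 2 * ln r)"
            using lnm r a \<eta> by (intro mult_left_mono) auto
          finally have "(1 - \<eta>)\<^sup>2 * r / a * ((1 - \<eta>) / 2 * ln r) \<le> X * Y" .
          then have "4 * ((1 - \<eta>)\<^sup>2 * r / a * ((1 - \<eta>) / 2 * ln r)) \<le> 4 * (X * Y)"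
            by (rule mult_left_mono) simp
          moreover have "4 * ((1 - \<eta>)\<^sup>2 * r / a * ((1 - \<eta>) / 2 * ln r)) = (1 - \<eta>) ^ 3 * (2 / a * r * ln r)"
            by (simp add: power2_eq_square power3_eq_cube)
          moreover have "((1 - \<eta>)\<^sup>2)\<^sup>2 * (2 / a * r * ln r) \<le> (1 - \<eta>) ^ 3 * (2 / a * r * ln r)"
          proof (rule mult_right_mono)
            show "((1 - \<eta>)\<^sup>2)\<^sup>2 \<le> (1 - \<eta>) ^ 3"
              unfolding power_mult[symmetric] using \<eta> by (intro power_decreasing) auto
          qed (use a r in auto)
          ultimately show "((1 - \<eta>)\<^sup>2)\<^sup>2 * (2 / a * r * ln r) \<le> 4 * (X * Y)" by linarith
        qed
        also have "\<dots> = 2 * sqrt (X * Y)" by (simp add: real_sqrt_mult)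
        also have "\<dots> \<le> X + Y" using arith_geo_mean_sqrt[OF X0 Y0] by simp
        finally show ?thesis using u mm0 unfolding X_def Y_def by simp
      qed
    qed
  qed
  show "\<forall>\<^sub>F r in at_top. \<forall>m::nat. sqrt r \<le> m \<longrightarrow> (1 - \<eta>)\<^sup>2 * g r \<le> D / (real D - 1) * (1 - \<eta>) * m * ln m"
    using e4 eventually_gt_at_top[of 1]
  proof eventually_elim
    case (elim r)
    have g0: "0 \<le> g r" unfolding g_def a_def[symmetric] using a(3) elim(2) by auto
    have gsmall: "(1 - \<eta>)\<^sup>2 * g r \<le> g r" using sq g0 by (simp add: mult_left_le_one_le)
    show ?case
    proof (intro allI impI)
      fix m :: nat assume m: "sqrt r \<le> m"
      have "ln (sqrt r) \<le> ln m" using m elim(2) by (intro ln_mono) auto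
      then have lnm: "ln r / 2 \<le> ln m" using elim(2) by (simp add: ln_sqrt)
      have "sqrt r * (ln r / 2) \<le> m * ln m" by (rule mult_mono[OF m lnm]) (use elim(2) in auto)
      then have "(1 - \<eta>) * (sqrt r * (ln r / 2)) \<le> (1 - \<eta>) * (m * ln m)"
        using \<eta> by (intro mult_left_mono) auto
      also have "\<dots> \<le> D / (real D - 1) * ((1 - \<eta>) * (m * ln m))"
      proof -
        have "0 \<le> sqrt r * (ln r / 2)" using elim(2) by auto
        then have "0 \<le> m * ln m" using \<open>sqrt r * (ln r / 2) \<le> m * ln m\<close> by linarith
        then have "0 \<le> (1 - \<eta>) * (m * ln m)" using \<eta> by simp
        moreover have "1 \<le> D / (real D - 1)" using D by simp
        ultimately show ?thesis using mult_right_mono[of 1 "D / (real D - 1)"] by fastforce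
      qed
      also have "\<dots> = D / (real D - 1) * (1 - \<eta>) * m * ln m" by (simp only: mult.assoc)
      finally show "(1 - \<eta>)\<^sup>2 * g r \<le> D / (real D - 1) * (1 - \<eta>) * m * ln m"
        using elim(1) gsmall by linarith
    qed
  qed
qed

text \<open>
  Here \<open>k r m\<close> is the fineness of the grid for \<open>m\<close> grains. It is chosen such that the pictures with
  \<open>m\<close> grid centres number at most \<open>exp (r - 1) / r\<close>, which leaves room for all \<open>m \<le> sqrt r\<close> in one
  codebook.
\<close>
lemma upper_sum_asymp:
  fixes D m0 :: nat and \<eta> :: real and p :: "nat \<Rightarrow> real" and k :: "real \<Rightarrow> nat \<Rightarrow> nat" and Ms :: "real \<Rightarrow> nat"
  assumes D: "2 \<le> D" and \<eta>: "0 < \<eta>" "\<eta> < 1"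
    and p: "\<And>m. p m = (if m < m0 then 1 else exp (- (D / (real D - 1) * (1 - \<eta>) * m * ln m)))"
    and k: "\<And>r m. k r m = nat \<lfloor>exp ((r - ln r - 1) / (D * m))\<rfloor> - 1"
    and Ms: "\<And>r. Ms r = nat \<lfloor>sqrt r\<rfloor>"
  shows "\<forall>\<^sub>F r in at_top. (\<forall>m. 1 \<le> m \<longrightarrow> m \<le> Ms r \<longrightarrow> 1 \<le> k r m) \<and>
      2 + (\<Sum>m=1..Ms r. (real (k r m) + 1) ^ (D * m)) \<le> exp r \<and>
      (\<Sum>m=1..Ms r. D / k r m * p m) + D * p (Suc (Ms r)) \<le> exp (- (1 - 3 * \<eta>) * sqrt (2 / (real D - 1) * r * ln r))"
proof -
  define g where "g r = sqrt (2 / (real D - 1) * r * ln r)" for r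
  define a where "a = real D - 1"
  have a: "1 \<le> a" "real D = a + 1" "0 < a" using D by (auto simp: a_def)
  note ex = upper_exponent_asymp(1)[OF D \<eta>, of m0, folded g_def] upper_exponent_asymp(2)[OF D \<eta>, folded g_def]
  have e1: "\<forall>\<^sub>F r in at_top. ln 4 \<le> (r - ln r - 1) / (D * sqrt r)"
    unfolding a(2) using a(3) by real_asymp
  have e2: "\<forall>\<^sub>F r in at_top. 2 + exp (r - 1) \<le> exp (r :: real)" by real_asymp
  have e3: "\<forall>\<^sub>F r in at_top. ln (3 * real D * (r :: real)) \<le> \<eta> * g r"
    unfolding g_def a_def[symmetric] unfolding a(2) using a(3) \<eta> by real_asymp
  have "filterlim sqrt at_top at_top" by real_asymp
  then have e4: "\<forall>\<^sub>F r in at_top. real m0 + 1 \<le> sqrt r"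
    unfolding filterlim_at_top by (rule spec)
  show ?thesis unfolding g_def[symmetric]
    using ex e1 e2 e3 e4 eventually_gt_at_top[of 1]
  proof eventually_elim
    case (elim r)
    have r: "1 < r" "1 \<le> sqrt r" using elim(7) by auto
    have sqrt_le: "sqrt r \<le> r" using mult_left_mono[OF r(2), of "sqrt r"] r by simp
    let ?E = "\<lambda>m. exp ((r - ln r - 1) / (D * m))"
    have M: "real (Ms r) \<le> sqrt r" "sqrt r \<le> real (Suc (Ms r))" unfolding Ms using r by linarith+
    have u0: "0 \<le> r - ln r - 1" using r ln_le_minus_one[of r] by linarith
    have E4: "4 \<le> ?E m" if m: "1 \<le> m" "m \<le> Ms r" for m :: nat
    proof -
      have "real m \<le> sqrt r" using m M by linarith
      then have "(r - ln r - 1) / (D * sqrt r) \<le> (r - ln r - 1) / (D * m)"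
        using m D u0 r by (intro divide_left_mono mult_left_mono) auto
      then have "ln 4 \<le> (r - ln r - 1) / (D * m)" using elim(3) by linarith
      then have "exp (ln 4) \<le> ?E m" by (subst exp_le_cancel_iff)
      then show ?thesis by simp
    qed
    have kE: "1 \<le> k r m \<and> ?E m / 2 \<le> k r m \<and> real (k r m) + 1 \<le> ?E m" if m: "1 \<le> m" "m \<le> Ms r" for m
      using E4[OF m] unfolding k by linarith
    show ?case
    proof (intro conjI allI impI)
      fix m assume "1 \<le> m" "m \<le> Ms r"
      then show "1 \<le> k r m" using kE by blast
    next
      have "(\<Sum>m=1..Ms r. (real (k r m) + 1) ^ (D * m)) \<le> (\<Sum>m=1..Ms r. exp (r - ln r - 1))"
      proof (rule sum_mono)
        fix m assume m: "m \<in> {1..Ms r}"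
        then have "(real (k r m) + 1) ^ (D * m) \<le> ?E m ^ (D * m)" using kE by (intro power_mono) auto
        also have "\<dots> = exp (real (D * m) * ((r - ln r - 1) / (D * m)))"
          by (rule exp_of_nat_mult[symmetric])
        also have "real (D * m) * ((r - ln r - 1) / (D * m)) = r - ln r - 1" using m D by simp
        finally show "(real (k r m) + 1) ^ (D * m) \<le> exp (r - ln r - 1)" .
      qed
      also have "\<dots> = Ms r * (exp (r - 1) / r)" using r by (simp add: exp_diff)
      also have "\<dots> \<le> r * (exp (r - 1) / r)" using M sqrt_le r by (intro mult_right_mono) auto
      also have "\<dots> = exp (r - 1)" using r by simp
      finally show "2 + (\<Sum>m=1..Ms r. (real (k r m) + 1) ^ (D * m)) \<le> exp r" using elim(4) by linarith
    next
      let ?e = "exp (- ((1 - \<eta>)\<^sup>2 * g r))"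
      have "D / k r m * p m \<le> 2 * D * ?e" if m: "m \<in> {1..Ms r}" for m
      proof -
        have m': "1 \<le> m" "m \<le> Ms r" "real m \<le> sqrt r" using m M by auto
        have p0: "0 \<le> p m" unfolding p by simp
        have "D / k r m \<le> D / (?E m / 2)"
          using kE[OF m'(1,2)] by (intro divide_left_mono) auto
        then have "D / k r m * p m \<le> D / (?E m / 2) * p m" using p0 by (rule mult_right_mono)
        also have "\<dots> = 2 * D * (exp (- ((r - ln r - 1) / (D * m))) * p m)"
          by (simp add: exp_minus field_simps)
        also have "exp (- ((r - ln r - 1) / (D * m))) * p m = 
            exp (- ((r - ln r - 1) / (D * m) + (if m < m0 then 0 else D / (real D - 1) * (1 - \<eta>) * m * ln m)))"
          unfolding p by (auto simp: exp_add[symmetric])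
        also have "\<dots> \<le> ?e" using elim(1)[rule_format, OF m'(1,3)] by simp
        finally show ?thesis by (simp add: mult_left_mono)
      qed
      then have "(\<Sum>m=1..Ms r. D / k r m * p m) \<le> (\<Sum>m=1..Ms r. 2 * D * ?e)" by (rule sum_mono)
      also have "\<dots> = Ms r * (2 * D * ?e)" by simp
      also have "\<dots> \<le> r * (2 * D * ?e)" using M sqrt_le r by (intro mult_right_mono) auto
      finally have s1: "(\<Sum>m=1..Ms r. D / k r m * p m) \<le> r * (2 * D * ?e)" .
      have "\<not> Suc (Ms r) < m0" using M elim(6) by linarith
      then have "p (Suc (Ms r)) \<le> ?e" unfolding p using elim(2)[rule_format, OF M(2)] by simp
      then have "D * p (Suc (Ms r)) \<le> D * ?e" by (intro mult_left_mono) auto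
      also have "\<dots> \<le> r * (D * ?e)" using r mult_right_mono[of 1 r "D * ?e"] by simp
      finally have "(\<Sum>m=1..Ms r. D / k r m * p m) + D * p (Suc (Ms r)) \<le> 3 * D * r * ?e"
        using s1 by (simp add: algebra_simps)
      also have "3 * D * r = exp (ln (3 * D * r))" using r D by simp
      also have "\<dots> * ?e \<le> exp (\<eta> * g r) * ?e" using elim(5) by (intro mult_right_mono) auto
      also have "\<dots> = exp (\<eta> * g r - (1 - \<eta>)\<^sup>2 * g r)"
        by (simp add: exp_diff exp_minus field_simps)
      also have "\<dots> \<le> exp (- (1 - 3 * \<eta>) * g r)"
      proof -
        have "0 \<le> g r" unfolding g_def a_def[symmetric] using a r by auto
        then have "0 \<le> \<eta>\<^sup>2 * g r" by simp
        then show ?thesis by (simp add: power2_eq_square algebra_simps)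
      qed
      finally show "(\<Sum>m=1..Ms r. D / k r m * p m) + D * p (Suc (Ms r)) \<le> exp (- (1 - 3 * \<eta>) * g r)" .
    qed
  qed
qed

section \<open>A codebook of grid pictures\<close>

definition cube_grid :: "nat \<Rightarrow> (real ^ 'n) set" where
  "cube_grid k = (\<lambda>a. \<chi> l. real (a l) / real k) ` (UNIV \<rightarrow>\<^sub>E {..k})"

lemma finite_cube_grid: "finite (cube_grid k :: (real ^ 'n) set)"
  unfolding cube_grid_def by (intro finite_imageI finite_PiE) auto

lemma card_cube_grid: "card (cube_grid k :: (real ^ 'n) set) \<le> Suc k ^ CARD('n)"
proof -
  have "card (cube_grid k :: (real ^ 'n) set) \<le> card ((UNIV :: 'n set) \<rightarrow>\<^sub>E {..k})"
    unfolding cube_grid_def by (intro card_image_le finite_PiE) auto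
  then show ?thesis by (simp add: card_PiE)
qed

lemma cube_grid_subset: "0 < k \<Longrightarrow> cube_grid k \<subseteq> cbox 0 1"
  by (auto simp: cube_grid_def mem_box_cart PiE_iff pos_divide_le_eq)

lemma (in sandwiched_norm) cube_grid_dense:
  assumes k: "0 < k" and x: "x \<in> cbox 0 1"
  shows "\<exists>y\<in>cube_grid k. nrm (x - y) \<le> real CARD('n) / real k"
proof -
  have x': "0 \<le> x $ l" "x $ l \<le> 1" for l using x by (auto simp: mem_box_cart)
  define a where "a l = nat \<lfloor>k * x $ l\<rfloor>" for l
  have a: "real (a l) \<le> k * x $ l" "k * x $ l \<le> real (a l) + 1" for l
  proof -
    have "0 \<le> k * x $ l" using x'[of l] by simp
    then show "real (a l) \<le> k * x $ l" "k * x $ l \<le> real (a l) + 1" unfolding a_def by linarith+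
  qed
  have "real (a l) \<le> k" for l using a(1)[of l] x'[of l] mult_left_le[of "x $ l" "real k"] by linarith
  then have "(\<chi> l. real (a l) / real k) \<in> cube_grid k"
    unfolding cube_grid_def by (intro imageI) auto
  moreover have "nrm (x - (\<chi> l. real (a l) / real k)) \<le> real CARD('n) * (1 / k)"
  proof (rule nrm_le_max)
    fix l
    have "x $ l - real (a l) / k = (k * x $ l - real (a l)) / k" using k by (simp add: field_simps)
    moreover have "0 \<le> (k * x $ l - real (a l)) / k" "(k * x $ l - real (a l)) / k \<le> 1 / k"
      using a[of l] k by (auto intro!: divide_right_mono)
    ultimately show "\<bar>(x - (\<chi> l. real (a l) / real k)) $ l\<bar> \<le> 1 / k" by simp
  qed
  ultimately show ?thesis by (intro bexI) auto
qed

definition (in sandwiched_norm) grid_pictures :: "real \<Rightarrow> nat \<Rightarrow> nat \<Rightarrow> (real ^ 'n) set set" where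
  "grid_pictures c m k = (\<lambda>y. ball_union c y {..<m}) ` ({..<m} \<rightarrow>\<^sub>E cube_grid k)"

lemma (in sandwiched_norm) card_grid_pictures:
  "finite (grid_pictures c m k)" "card (grid_pictures c m k) \<le> Suc k ^ (CARD('n) * m)"
proof -
  show "finite (grid_pictures c m k)"
    unfolding grid_pictures_def by (intro finite_imageI finite_PiE finite_cube_grid) auto
  have "card (grid_pictures c m k) \<le> card ({..<m} \<rightarrow>\<^sub>E (cube_grid k :: (real ^ 'n) set))"
    unfolding grid_pictures_def by (intro card_image_le finite_PiE finite_cube_grid) auto
  also have "\<dots> \<le> (Suc k ^ CARD('n)) ^ m"
    by (simp add: card_PiE power_mono card_cube_grid del: power_Suc)
  finally show "card (grid_pictures c m k) \<le> Suc k ^ (CARD('n) * m)" by (simp add: power_mult)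
qed

lemma (in sandwiched_norm) grid_pictures_dense:
  assumes c: "0 < c" and k: "0 < k" and J: "finite J" "card J = m" "\<And>i. i \<in> J \<Longrightarrow> x i \<in> cbox 0 1"
  shows "\<exists>A\<in>grid_pictures c m k. hausdorff_dist nrm (ball_union c x J) A \<le> ennreal (real CARD('n) / real k)"
proof -
  obtain h where h: "bij_betw h {..<m} J"
    using ex_bij_betw_nat_finite[OF J(1)] J(2) by (auto simp: atLeast0LessThan)
  have hx: "x (h i) \<in> cbox 0 1" if "i < m" for i using h J(3) that by (auto simp: bij_betw_def)
  then have "\<forall>i\<in>{..<m}. \<exists>y. y \<in> cube_grid k \<and> nrm (x (h i) - y) \<le> real CARD('n) / real k"
    using cube_grid_dense[OF k] by (metis lessThan_iff)
  from bchoice[OF this] obtain y where y: "\<And>i. i < m \<Longrightarrow> y i \<in> cube_grid k"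
    "\<And>i. i < m \<Longrightarrow> nrm (x (h i) - y i) \<le> real CARD('n) / real k" by auto
  let ?y = "restrict y {..<m}"
  have "ball_union c x J = ball_union c (\<lambda>i. x (h i)) {..<m}"
    using h by (auto simp: ball_union_def bij_betw_def)
  moreover have "hausdorff_dist nrm (ball_union c (\<lambda>i. x (h i)) {..<m}) (ball_union c ?y {..<m}) \<le> ennreal (real CARD('n) / real k)"
    by (rule hausdorff_dist_ball_union_le[OF c]) (use hx y cube_grid_subset[OF k] in auto)
  moreover have "ball_union c ?y {..<m} \<in> grid_pictures c m k"
    unfolding grid_pictures_def by (intro imageI) (simp add: PiE_iff extensional_def y)
  ultimately show ?thesis by auto
qed

context fixed_radius_norm_model
begin

text \<open>
  Given \<open>\<omega>\<close>, let \<open>m\<close> be the size of an irredundant subset with the same union. For \<open>m \<le> K\<close> the grid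
  pictures with \<open>m\<close> grains come close. If \<open>m\<close> exceeds \<open>K\<close>, then some subset of \<open>Suc K\<close> grains is still
  irredundant, and the code word \<open>{0}\<close> costs at most the diameter of the cube. The empty picture is
  a code word of its own, since every other one has infinite distance from it.
\<close>
lemma quantization_error_le:
  assumes p: "\<And>m. 1 \<le> m \<Longrightarrow> \<exists>G\<in>sets M. emeasure M G \<le> ennreal (p m) \<and>
          (\<forall>\<omega>\<in>space M. (\<forall>i. \<xi> i \<omega> \<in> cbox 0 1) \<longrightarrow>
             (\<exists>J\<subseteq>{..<N \<omega>}. card J = m \<and> irredundant c (\<lambda>i. \<xi> i \<omega>) J) \<longrightarrow> \<omega> \<in> G)"
    and p0: "\<And>m. 0 \<le> p m"
    and k: "\<And>m. 1 \<le> m \<Longrightarrow> m \<le> K \<Longrightarrow> 1 \<le> k m"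
    and size: "2 + (\<Sum>m=1..K. (real (k m) + 1) ^ (CARD('n) * m)) \<le> exp r"
  shows "quantization_error M nrm (boolean_set nrm \<xi> R N) r
     \<le> ennreal ((\<Sum>m=1..K. real CARD('n) / k m * p m) + real CARD('n) * p (Suc K))"
proof -
  obtain G where G: "\<And>m. 1 \<le> m \<Longrightarrow> G m \<in> sets M" "\<And>m. 1 \<le> m \<Longrightarrow> emeasure M (G m) \<le> ennreal (p m)"
    "\<And>m \<omega> J. 1 \<le> m \<Longrightarrow> \<omega> \<in> space M \<Longrightarrow> (\<And>i. \<xi> i \<omega> \<in> cbox 0 1) \<Longrightarrow>
             J\<subseteq>{..<N \<omega>} \<Longrightarrow> card J = m \<Longrightarrow> irredundant c (\<lambda>i. \<xi> i \<omega>) J \<Longrightarrow> \<omega> \<in> G m"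
  proof -
    have "\<forall>m. \<exists>G. 1 \<le> m \<longrightarrow> G \<in> sets M \<and> emeasure M G \<le> ennreal (p m) \<and>
          (\<forall>\<omega>\<in>space M. (\<forall>i. \<xi> i \<omega> \<in> cbox 0 1) \<longrightarrow>
             (\<exists>J\<subseteq>{..<N \<omega>}. card J = m \<and> irredundant c (\<lambda>i. \<xi> i \<omega>) J) \<longrightarrow> \<omega> \<in> G)"
    proof
      fix m
      show "\<exists>G. 1 \<le> m \<longrightarrow> G \<in> sets M \<and> emeasure M G \<le> ennreal (p m) \<and>
          (\<forall>\<omega>\<in>space M. (\<forall>i. \<xi> i \<omega> \<in> cbox 0 1) \<longrightarrow>
             (\<exists>J\<subseteq>{..<N \<omega>}. card J = m \<and> irredundant c (\<lambda>i. \<xi> i \<omega>) J) \<longrightarrow> \<omega> \<in> G)"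
      proof (cases "1 \<le> m")
        case True
        from p[OF this] show ?thesis by blast
      qed simp
    qed
    from choice[OF this] obtain G where "\<forall>m. 1 \<le> m \<longrightarrow> G m \<in> sets M \<and> emeasure M (G m) \<le> ennreal (p m) \<and>
          (\<forall>\<omega>\<in>space M. (\<forall>i. \<xi> i \<omega> \<in> cbox 0 1) \<longrightarrow>
             (\<exists>J\<subseteq>{..<N \<omega>}. card J = m \<and> irredundant c (\<lambda>i. \<xi> i \<omega>) J) \<longrightarrow> \<omega> \<in> G m)"
      by blast
    then show ?thesis by (intro that[of G]) auto
  qed
  let ?d = "real CARD('n)"
  define C where "C = {{}, {0 :: real ^ 'n}} \<union> (\<Union>m\<in>{1..K}. grid_pictures c m (k m))"
  have finC: "finite C" unfolding C_def using card_grid_pictures(1) by auto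
  have "real (card C) \<le> exp r"
  proof -
    have "card C \<le> card {{}, {0 :: real ^ 'n}} + card (\<Union>m\<in>{1..K}. grid_pictures c m (k m))"
      unfolding C_def by (rule card_Un_le)
    also have "\<dots> \<le> 2 + (\<Sum>m=1..K. card (grid_pictures c m (k m)))"
      by (intro add_mono card_UN_le) (auto simp: card_insert_if)
    also have "\<dots> \<le> 2 + (\<Sum>m=1..K. Suc (k m) ^ (CARD('n) * m))"
      by (intro add_mono sum_mono card_grid_pictures(2)) auto
    finally have "real (card C) \<le> real (2 + (\<Sum>m=1..K. Suc (k m) ^ (CARD('n) * m)))"
      by (rule of_nat_mono)
    also have "\<dots> = 2 + (\<Sum>m=1..K. (real (k m) + 1) ^ (CARD('n) * m))" by (simp add: add.commute)
    finally show ?thesis using size by simp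
  qed
  moreover have "closed A" if A: "A \<in> C" for A
  proof -
    have "closed (ball_union c y {..<m})" for y :: "nat \<Rightarrow> real ^ 'n" and m
      by (rule closed_ball_union) simp
    then show ?thesis using A unfolding C_def grid_pictures_def by auto
  qed
  ultimately have C: "C \<in> codebooks r" using finC unfolding codebooks_def by (auto simp: C_def)
  define b where "b \<omega> = (\<Sum>m=1..K. ennreal (?d / k m) * indicator (G m) \<omega>) + ennreal ?d * indicator (G (Suc K)) \<omega>" for \<omega>
  have Gm [measurable]: "G (Suc m) \<in> sets M" for m using G(1)[of "Suc m"] by simp
  have "AE \<omega> in M. (MIN A\<in>C. hausdorff_dist nrm (boolean_set nrm \<xi> R N \<omega>) A) \<le> b \<omega>"
    using AE_boolean_set AE_space
  proof eventually_elim
    case (elim \<omega>)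
    let ?S = "boolean_set nrm \<xi> R N \<omega>"
    have Min_le': "(MIN A\<in>C. hausdorff_dist nrm ?S A) \<le> hausdorff_dist nrm ?S A" if "A \<in> C" for A
      using that finC by (intro Min_le) auto
    obtain J where J: "J \<subseteq> {..<N \<omega>}" "irredundant c (\<lambda>i. \<xi> i \<omega>) J" "ball_union c (\<lambda>i. \<xi> i \<omega>) J = ?S"
      using exists_irredundant[of "{..<N \<omega>}" c "\<lambda>i. \<xi> i \<omega>"] elim by auto
    have fJ: "finite J" using J(1) finite_subset by blast
    consider "card J = 0" | "1 \<le> card J" "card J \<le> K" | "Suc K \<le> card J" by linarith
    then show ?case
    proof cases
      case 1
      then have "?S = {}" using J(3) fJ by (auto simp: ball_union_def)
      then have "(MIN A\<in>C. hausdorff_dist nrm ?S A) \<le> 0"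
        using Min_le'[of "{}"] by (simp add: C_def hausdorff_dist_empty_empty)
      then show ?thesis by simp
    next
      case 2
      have "0 < k (card J)" using k 2 by force
      from grid_pictures_dense[OF radius_pos this fJ refl] elim J(3) obtain A
        where A: "A \<in> grid_pictures c (card J) (k (card J))" "hausdorff_dist nrm ?S A \<le> ennreal (?d / k (card J))" by metis
      have "A \<in> C" unfolding C_def using A(1) 2 by auto
      then have "(MIN A\<in>C. hausdorff_dist nrm ?S A) \<le> ennreal (?d / k (card J))"
        using Min_le' A(2) order_trans by blast
      also have "\<dots> = ennreal (?d / k (card J)) * indicator (G (card J)) \<omega>"
        using G(3)[OF 2(1) _ _ J(1) refl J(2)] elim by simp
      also have "\<dots> \<le> (\<Sum>m=1..K. ennreal (?d / k m) * indicator (G m) \<omega>)"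
        by (rule member_le_sum) (use 2 in auto)
      also have "\<dots> \<le> b \<omega>" unfolding b_def by simp
      finally show ?thesis .
    next
      case 3
      then obtain J' where J': "J' \<subseteq> J" "card J' = Suc K" using obtain_subset_with_card_n by metis
      have "\<omega> \<in> G (Suc K)"
        using G(3)[of "Suc K" \<omega> J'] irredundant_subset[OF J(2) J'(1)] J' J(1) elim by auto
      moreover have "?S \<noteq> {}"
        using ball_union_empty_iff[OF radius_pos, of J "\<lambda>i. \<xi> i \<omega>"] 3 J(3) elim by auto
      then have "hausdorff_dist nrm ?S {0} \<le> ennreal ?d"
        using ball_union_subset[of c "\<lambda>i. \<xi> i \<omega>" J] J(3) by (intro hausdorff_dist_cube_le) (auto simp: mem_box_cart)
      then have "(MIN A\<in>C. hausdorff_dist nrm ?S A) \<le> ennreal ?d" using Min_le'[of "{0}"]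
        by (auto simp: C_def)
      ultimately show ?thesis unfolding b_def by (simp add: add_increasing)
    qed
  qed
  then have "(\<integral>\<^sup>+ \<omega>. (MIN A\<in>C. hausdorff_dist nrm (boolean_set nrm \<xi> R N \<omega>) A) \<partial>M) \<le> (\<integral>\<^sup>+ \<omega>. b \<omega> \<partial>M)"
    by (rule nn_integral_mono_AE)
  also have "\<dots> = (\<Sum>m=1..K. ennreal (?d / k m) * emeasure M (G m)) + ennreal ?d * emeasure M (G (Suc K))"
  proof -
    have meas: "(\<lambda>\<omega>. ennreal (?d / k m) * indicator (G m) \<omega>) \<in> borel_measurable M" if "m \<in> {1..K}" for m
      using G(1)[of m] that by auto
    have "(\<integral>\<^sup>+ \<omega>. b \<omega> \<partial>M) = (\<integral>\<^sup>+ \<omega>. (\<Sum>m=1..K. ennreal (?d / k m) * indicator (G m) \<omega>) \<partial>M)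
        + (\<integral>\<^sup>+ \<omega>. ennreal ?d * indicator (G (Suc K)) \<omega> \<partial>M)"
      unfolding b_def by (intro nn_integral_add borel_measurable_sum meas) auto
    also have "(\<integral>\<^sup>+ \<omega>. (\<Sum>m=1..K. ennreal (?d / k m) * indicator (G m) \<omega>) \<partial>M)
        = (\<Sum>m=1..K. (\<integral>\<^sup>+ \<omega>. ennreal (?d / k m) * indicator (G m) \<omega> \<partial>M))"
      by (rule nn_integral_sum[OF meas])
    also have "\<dots> = (\<Sum>m=1..K. ennreal (?d / k m) * emeasure M (G m))"
      by (intro sum.cong refl nn_integral_cmult_indicator G(1)) auto
    also have "(\<integral>\<^sup>+ \<omega>. ennreal ?d * indicator (G (Suc K)) \<omega> \<partial>M) = ennreal ?d * emeasure M (G (Suc K))"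
      by (rule nn_integral_cmult_indicator[OF Gm])
    finally show ?thesis .
  qed
  also have "\<dots> \<le> (\<Sum>m=1..K. ennreal (?d / k m) * ennreal (p m)) + ennreal ?d * ennreal (p (Suc K))"
    by (intro add_mono sum_mono mult_left_mono G(2)) auto
  also have "\<dots> = ennreal ((\<Sum>m=1..K. ?d / k m * p m) + ?d * p (Suc K))"
  proof -
    have mult: "ennreal x * ennreal (p m) = ennreal (x * p m)" if "0 \<le> x" for x m
      using that p0[of m] by (rule ennreal_mult[symmetric])
    have "(\<Sum>m=1..K. ennreal (?d / k m) * ennreal (p m)) = (\<Sum>m=1..K. ennreal (?d / k m * p m))"
      by (rule sum.cong[OF refl mult]) simp
    also have "\<dots> = ennreal (\<Sum>m=1..K. ?d / k m * p m)"
      by (rule sum_ennreal) (simp add: p0)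
    finally show ?thesis
      unfolding mult[of ?d "Suc K", OF of_nat_0_le_iff]
      by (subst ennreal_plus) (auto intro!: sum_nonneg simp: p0)
  qed
  finally show ?thesis unfolding quantization_error_def using C by (meson INF_lower2)
qed

lemma quantization_error_upper:
  assumes ind: "indented c L \<rho>" and L: "0 < L" and \<rho>: "0 < \<rho>" "real CARD('n) * \<rho> \<le> c / 2"
  shows "exp_asymp (\<le>) (quantization_error M nrm (boolean_set nrm \<xi> R N))
           (\<lambda>r. sqrt (2 / (real CARD('n) - 1) * r * ln r))"
proof (rule exp_asymp_leI)
  define D where "D = CARD('n)"
  have D: "2 \<le> D" using dim by (simp add: D_def)
  define a where "a = real CARD('n) - 1"
  have a: "0 < a" using dim by (simp add: a_def)
  show "\<forall>\<^sub>F r in at_top. 0 < sqrt (2 / (real CARD('n) - 1) * r * ln r)"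
    unfolding a_def[symmetric] using a by real_asymp
  fix \<eta>0 :: real assume \<eta>0: "0 < \<eta>0"
  define \<eta> where "\<eta> = min (1 / 2) (\<eta>0 / 3)"
  have \<eta>: "0 < \<eta>" "\<eta> < 1" "3 * \<eta> \<le> \<eta>0" using \<eta>0 by (auto simp: \<eta>_def)
  define Q where "Q = CARD('n) * 2 * Suc (nat \<lfloor>1 / \<rho>\<rfloor>)"
  define K0 where "K0 = nat \<lceil>1 / \<rho>\<rceil>"
  define C where "C = rate * real Q * 2 ^ (CARD('n) - 1) * (L + 1)"
  have "0 < Q" unfolding Q_def by simp
  then have C: "0 < C" unfolding C_def using rate_pos L by simp
  have D1: "1 \<le> CARD('n) - 1" using dim by simp
  from crowded_region_asymp[OF D1 C \<eta>(1), of K0 Q]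
  obtain m0 where m0: "\<And>m. m0 \<le> m \<Longrightarrow> \<exists>K\<ge>K0. 0 < K \<and>
    real (Suc K) ^ (Q * Suc K ^ (CARD('n) - 1)) * ((C / real K) ^ m / fact m) \<le> exp (- ((1 + 1 / real (CARD('n) - 1)) * (1 - \<eta>) * m * ln m))"
    unfolding eventually_sequentially by blast
  have frac: "1 + 1 / real (CARD('n) - 1) = D / (real D - 1)"
    using D unfolding D_def by (simp add: field_simps of_nat_diff)
  define p where "p m = (if m < m0 then 1 else exp (- (D / (real D - 1) * (1 - \<eta>) * m * ln m)))" for m :: nat
  define k where "k r m = nat \<lfloor>exp ((r - ln r - 1) / (D * m))\<rfloor> - 1" for r and m :: nat
  define Ms where "Ms r = nat \<lfloor>sqrt r\<rfloor>" for r
  have G: "\<exists>G\<in>sets M. emeasure M G \<le> ennreal (p m) \<and>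
          (\<forall>\<omega>\<in>space M. (\<forall>i. \<xi> i \<omega> \<in> cbox 0 1) \<longrightarrow>
             (\<exists>J\<subseteq>{..<N \<omega>}. card J = m \<and> irredundant c (\<lambda>i. \<xi> i \<omega>) J) \<longrightarrow> \<omega> \<in> G)" for m
  proof (cases "m < m0")
    case True
    then show ?thesis by (intro bexI[of _ "space M"]) (auto simp: p_def emeasure_space_1)
  next
    case False
    then obtain K where K: "K0 \<le> K" "0 < K"
      and b: "real (Suc K) ^ (Q * Suc K ^ (CARD('n) - 1)) * ((C / real K) ^ m / fact m) \<le> p m"
      using m0[of m] unfolding p_def frac by auto
    have "1 / \<rho> \<le> K" using K unfolding K0_def by linarith
    then have "1 / real K \<le> \<rho>" using K \<rho> by (simp add: field_simps)
    from prob_irredundant[OF ind L \<rho> K(2) this Q_def, of m, folded C_def]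
    show ?thesis using b by (meson ennreal_leI order_trans)
  qed
  have p0: "0 \<le> p m" for m by (simp add: p_def)
  from upper_sum_asymp[OF D \<eta>(1,2) p_def k_def Ms_def, folded a_def]
  show "\<forall>\<^sub>F r in at_top. quantization_error M nrm (boolean_set nrm \<xi> R N) r
      \<le> ennreal (exp (- (1 - \<eta>0) * sqrt (2 / (real CARD('n) - 1) * r * ln r)))"
    using eventually_gt_at_top[of 1]
  proof eventually_elim
    case (elim r)
    let ?g = "sqrt (2 / (real CARD('n) - 1) * r * ln r)"
    have "quantization_error M nrm (boolean_set nrm \<xi> R N) r
       \<le> ennreal ((\<Sum>m=1..Ms r. real CARD('n) / k r m * p m) + real CARD('n) * p (Suc (Ms r)))"
      by (rule quantization_error_le) (use G p0 elim in \<open>auto simp: D_def\<close>)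
    also have "\<dots> \<le> ennreal (exp (- (1 - 3 * \<eta>) * ?g))"
      using elim by (intro ennreal_leI) (auto simp: D_def)
    also have "\<dots> \<le> ennreal (exp (- (1 - \<eta>0) * ?g))"
    proof -
      have "0 \<le> ?g" using elim a by (simp add: a_def)
      then have "- (1 - 3 * \<eta>) * ?g \<le> - (1 - \<eta>0) * ?g"
        using \<eta>(3) by (intro mult_right_mono) auto
      then show ?thesis by (intro ennreal_leI) simp
    qed
    finally show ?case .
  qed
qed
end

section \<open>Configurations of visible tips\<close>

text \<open>
  Sites are boxes over every cell of a grid in the hyperplane orthogonal to the direction \<open>j\<close>. They
  fill only half of the cell in each of its directions, so that distinct sites keep a distance of half a
  mesh (\<open>sites_apart\<close>).
\<close>
definition site_labels :: "nat \<Rightarrow> 'n::finite \<Rightarrow> ('n \<Rightarrow> nat) set" where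
  "site_labels K j = (UNIV - {j} \<rightarrow>\<^sub>E {..<K})"

lemma finite_site_labels: "finite (site_labels K j)"
  unfolding site_labels_def by (intro finite_PiE) auto

lemma card_site_labels: "card (site_labels K (j :: 'n::finite)) = K ^ (CARD('n) - 1)"
  unfolding site_labels_def by (simp add: card_PiE card_Diff_singleton)

definition site :: "nat \<Rightarrow> real \<Rightarrow> 'n::finite \<Rightarrow> ('n \<Rightarrow> nat) \<Rightarrow> (real ^ 'n) set" where
  "site K w j \<kappa> = cbox (\<chi> l. if l = j then 0 else real (\<kappa> l) / real K)
                      (\<chi> l. if l = j then w else (real (\<kappa> l) + 1 / 2) / real K)"

lemma in_site_iff:
  assumes "0 < K"
  shows "x \<in> site K w j \<kappa> \<longleftrightarrow> 0 \<le> x $ j \<and> x $ j \<le> w \<and>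
    (\<forall>l. l \<noteq> j \<longrightarrow> real (\<kappa> l) \<le> K * x $ l \<and> K * x $ l \<le> real (\<kappa> l) + 1 / 2)"
  using assms unfolding site_def mem_box_cart
  by (auto simp: pos_divide_le_eq pos_le_divide_eq mult.commute)

lemma measure_site:
  assumes "0 < K" "0 \<le> w"
  shows "measure lborel (site K w j \<kappa> :: (real ^ 'n) set) = w * (1 / (2 * real K)) ^ (CARD('n) - 1)"
proof -
  have "measure lborel (site K w j \<kappa> :: (real ^ 'n) set) = (\<Prod>l\<in>UNIV. (if l = j then w else 1 / (2 * real K)))"
    unfolding site_def
    by (subst content_cbox_cart)
      (use assms in \<open>auto simp: interval_ne_empty_cart field_simps intro!: prod.cong\<close>)
  also have "\<dots> = w * (1 / (2 * real K)) ^ (CARD('n) - 1)"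
    by (subst prod.remove[of _ j]) (auto simp: card_Diff_singleton)
  finally show ?thesis .
qed

lemma site_subset_cube:
  assumes K: "0 < K" and w: "w \<le> 1" and \<kappa>: "\<kappa> \<in> site_labels K j"
  shows "site K w j \<kappa> \<subseteq> cbox 0 1"
proof
  fix x assume x: "x \<in> site K w j \<kappa>"
  have "0 \<le> x $ l \<and> x $ l \<le> 1" for l
  proof (cases "l = j")
    case False
    then have "\<kappa> l < K" using \<kappa> by (auto simp: site_labels_def PiE_iff)
    then have "real (\<kappa> l) + 1 \<le> K" by linarith
    moreover have "real (\<kappa> l) \<le> K * x $ l" "K * x $ l \<le> real (\<kappa> l) + 1 / 2"
      using x False by (auto simp: in_site_iff[OF K])
    ultimately have "0 \<le> K * x $ l" "K * x $ l \<le> K * 1" by linarith+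
    then show ?thesis using K by (simp add: zero_le_mult_iff)
  qed (use x w in \<open>auto simp: in_site_iff[OF K]\<close>)
  then show "x \<in> cbox 0 1" by (simp add: mem_box_cart)
qed

lemma sites_apart:
  assumes K: "0 < K" and \<kappa>: "\<kappa> \<in> site_labels K j" "\<kappa>' \<in> site_labels K j" "\<kappa> \<noteq> \<kappa>'"
    and x: "x \<in> site K w j \<kappa>" "y \<in> site K w j \<kappa>'"
  shows "\<exists>l. l \<noteq> j \<and> 1 / (2 * real K) \<le> \<bar>x $ l - y $ l\<bar>"
proof -
  obtain l where l: "\<kappa> l \<noteq> \<kappa>' l" using \<kappa>(3) by auto
  have lj: "l \<noteq> j" using l \<kappa>(1,2) by (auto simp: site_labels_def PiE_iff extensional_def)
  have "real (\<kappa> l) \<le> K * x $ l" "K * x $ l \<le> real (\<kappa> l) + 1 / 2"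
    "real (\<kappa>' l) \<le> K * y $ l" "K * y $ l \<le> real (\<kappa>' l) + 1 / 2"
    using x lj by (auto simp: in_site_iff[OF K])
  moreover have "real (\<kappa> l) + 1 \<le> real (\<kappa>' l) \<or> real (\<kappa>' l) + 1 \<le> real (\<kappa> l)"
    using l by linarith
  ultimately have "1 / 2 \<le> \<bar>K * x $ l - K * y $ l\<bar>" by linarith
  also have "\<dots> = K * \<bar>x $ l - y $ l\<bar>"
    using K by (simp add: right_diff_distrib[symmetric] abs_mult)
  finally have "1 / (2 * real K) \<le> \<bar>x $ l - y $ l\<bar>" using K by (simp add: field_simps)
  with lj show ?thesis by blast
qed

text \<open>
  The geometric input of the lower bound, with the tip of a ball being its topmost point
  \<open>x + c *\<^sub>R axis j 1\<close>. The exponent \<open>p\<close> says how thin the slab must be for a tip to be outside the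
  balls of all other sites. The exponent \<open>q\<close> says how well a centre is known from the distance of its
  tip to the ball: an error \<open>t ^ q\<close> there is an error of order \<open>t\<close> for the centre.
\<close>
locale tip_model = fixed_radius_norm_model M \<xi> R N rate c nrm
  for M :: "'a measure" and \<xi> :: "nat \<Rightarrow> 'a \<Rightarrow> real ^ 'n" and R N rate c and nrm :: "real ^ 'n \<Rightarrow> real" +
  fixes p q :: nat and \<beta> \<gamma> B :: real
  assumes pq: "1 \<le> p" "1 \<le> q"
    and \<beta>: "0 < \<beta>" "\<beta> \<le> 1" and \<gamma>: "0 < \<gamma>" "\<gamma> \<le> 1" and B: "0 < B"
    and tip_far: "\<lbrakk>1 \<le> K; \<kappa> \<in> site_labels K j; \<kappa>' \<in> site_labels K j; \<kappa> \<noteq> \<kappa>';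
        x \<in> site K (\<beta> / real K ^ p) j \<kappa>; y \<in> site K (\<beta> / real K ^ p) j \<kappa>'; 0 < t; t ^ q \<le> \<gamma> / real K ^ p\<rbrakk>
        \<Longrightarrow> c + 2 * t ^ q \<le> nrm (x + c *\<^sub>R axis j 1 - y)"
    and tip_determines: "\<lbrakk>0 < t; t ^ q \<le> 1; nrm (x + c *\<^sub>R axis j 1 - y) < c + 2 * t ^ q;
        nrm (y + c *\<^sub>R axis j 1 - x) < c + 2 * t ^ q\<rbrakk> \<Longrightarrow> \<bar>x $ l - y $ l\<bar> \<le> B * t"
begin

lemma nrm_axis_le: "nrm (c *\<^sub>R axis j 1) \<le> c"
proof -
  have "nrm (axis j 1) \<le> (\<Sum>i\<in>UNIV. \<bar>axis j (1 :: real) $ i\<bar>)" by (rule nrm_le_l1)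
  also have "\<dots> = (\<Sum>i\<in>UNIV. if i = j then 1 else 0)" by (rule sum.cong) (auto simp: axis_def)
  also have "\<dots> = 1" by simp
  finally show ?thesis using radius_pos by (simp add: nrm_scaleR mult_left_le)
qed

text \<open>
  The tip belongs to the first picture, so the second picture has a point near it; this point can
  only come from the ball at the same site.
\<close>
lemma tip_close:
  assumes K: "1 \<le> K" "\<beta> / real K ^ p \<le> 1 - c" and t: "0 < t" "t ^ q \<le> \<gamma> / real K ^ p"
    and x: "\<And>\<kappa>. \<kappa> \<in> site_labels K j \<Longrightarrow> x \<kappa> \<in> site K (\<beta> / real K ^ p) j \<kappa>"
    and y: "\<And>\<kappa>. \<kappa> \<in> site_labels K j \<Longrightarrow> y \<kappa> \<in> site K (\<beta> / real K ^ p) j \<kappa>"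
    and near: "\<And>a. a \<in> ball_union c x (site_labels K j) \<Longrightarrow> \<exists>b\<in>ball_union c y (site_labels K j). nrm (a - b) < 2 * t ^ q"
    and \<kappa>: "\<kappa> \<in> site_labels K j"
  shows "nrm (x \<kappa> + c *\<^sub>R axis j 1 - y \<kappa>) < c + 2 * t ^ q"
proof -
  let ?w = "\<beta> / real K ^ p"
  let ?a = "x \<kappa> + c *\<^sub>R axis j 1"
  have K0: "0 < K" using K by simp
  have w: "0 \<le> ?w" "?w \<le> 1" using \<beta> K(2) radius_pos by (simp, linarith)
  have xc: "x \<kappa> \<in> cbox 0 1" using x[OF \<kappa>] site_subset_cube[OF K0 w(2) \<kappa>] by blast
  have "?a $ l = (if l = j then x \<kappa> $ j + c else x \<kappa> $ l)" for l by (simp add: axis_def)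
  moreover have "0 \<le> x \<kappa> $ j" "x \<kappa> $ j \<le> ?w"
    using x[OF \<kappa>] by (auto simp: in_site_iff[OF K0])
  ultimately have "?a \<in> cbox 0 1" using xc K(2) radius_pos by (auto simp: mem_box_cart)
  moreover have "nrm (?a - x \<kappa>) \<le> c" using nrm_axis_le by simp
  ultimately have "?a \<in> ball_union c x (site_labels K j)"
    using \<kappa> unfolding ball_union_def by (intro UN_I[of \<kappa>]) (auto simp: norm_cball_def)
  then obtain b where b: "b \<in> ball_union c y (site_labels K j)" "nrm (?a - b) < 2 * t ^ q"
    using near by blast
  then obtain \<kappa>' where \<kappa>': "\<kappa>' \<in> site_labels K j" "nrm (b - y \<kappa>') \<le> c"
    by (auto simp: ball_union_def norm_cball_def)
  have lt: "nrm (?a - y \<kappa>') < c + 2 * t ^ q" using nrm_triangle3[of ?a "y \<kappa>'" b] b \<kappa>'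
    by linarith
  have "\<kappa>' = \<kappa>"
  proof (rule ccontr)
    assume "\<kappa>' \<noteq> \<kappa>"
    from tip_far[OF K(1) \<kappa> \<kappa>'(1) this[symmetric] x[OF \<kappa>] y[OF \<kappa>'(1)] t] lt show False by simp
  qed
  with lt show ?thesis by simp
qed

lemma configurations_close:
  assumes K: "1 \<le> K" "\<beta> / real K ^ p \<le> 1 - c" and t: "0 < t" "t ^ q \<le> \<gamma> / real K ^ p"
    and x: "\<And>\<kappa>. \<kappa> \<in> site_labels K j \<Longrightarrow> x \<kappa> \<in> site K (\<beta> / real K ^ p) j \<kappa>"
    and y: "\<And>\<kappa>. \<kappa> \<in> site_labels K j \<Longrightarrow> y \<kappa> \<in> site K (\<beta> / real K ^ p) j \<kappa>"
    and xA: "hausdorff_dist nrm (ball_union c x (site_labels K j)) A < ennreal (t ^ q)"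
    and yA: "hausdorff_dist nrm (ball_union c y (site_labels K j)) A < ennreal (t ^ q)"
    and \<kappa>: "\<kappa> \<in> site_labels K j"
  shows "\<bar>x \<kappa> $ l - y \<kappa> $ l\<bar> \<le> B * t"
proof -
  have near: "\<exists>b\<in>ball_union c y (site_labels K j). nrm (a - b) < 2 * t ^ q"
    if xA: "hausdorff_dist nrm (ball_union c x (site_labels K j)) A < ennreal (t ^ q)"
    and yA: "hausdorff_dist nrm (ball_union c y (site_labels K j)) A < ennreal (t ^ q)"
    and a: "a \<in> ball_union c x (site_labels K j)" for a x y
  proof -
    obtain u where u: "u \<in> A" "nrm (a - u) < t ^ q" using hausdorff_dist_less(1)[OF xA a] by blast
    obtain b where b: "b \<in> ball_union c y (site_labels K j)" "nrm (b - u) < t ^ q" using hausdorff_dist_less(2)[OF yA u(1)] by blast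
    have "nrm (a - b) < 2 * t ^ q" using nrm_triangle3[of a b u] u b nrm_commute[of u b] by linarith
    with b show ?thesis by blast
  qed
  have "\<gamma> / real K ^ p \<le> 1"
    using \<gamma> K by (simp add: divide_le_eq_1 order_trans[OF _ one_le_power])
  then have "t ^ q \<le> 1" using t by linarith
  from tip_determines[OF t(1) this tip_close[OF K t x y near[OF xA yA] \<kappa>] tip_close[OF K t y x near[OF yA xA] \<kappa>]]
  show ?thesis by auto
qed

text \<open>
  A volume argument. Configurations that a fixed code word serves with error below \<open>t ^ q\<close> are all
  close to one of them, hence they fill a volume of at most \<open>(2 B t) ^ (d n)\<close>; by \<open>small\<close> all code words
  together serve at most half of the configurations. The factor \<open>fact n\<close> counts the assignments of
  the \<open>n\<close> grains to the sites, for which the events are disjoint.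
\<close>
lemma quantization_error_ge:
  assumes K: "1 \<le> K" "\<beta> / real K ^ p \<le> 1 - c" and t: "0 < t" "t ^ q \<le> \<gamma> / real K ^ p"
    and n: "n = K ^ (CARD('n) - 1)" and V: "V = \<beta> / real K ^ p * (1 / (2 * real K)) ^ (CARD('n) - 1)"
    and small: "exp r * (2 * B * t) ^ (CARD('n) * n) \<le> V ^ n / 2"
  shows "ennreal (t ^ q * (fact n * (pmf (poisson_pmf rate) n * V ^ n / 2)))
         \<le> quantization_error M nrm (boolean_set nrm \<xi> R N) r"
  unfolding quantization_error_def
proof (rule INF_greatest)
  fix C :: "(real ^ 'n) set set" assume "C \<in> codebooks r"
  then have C: "finite C" "C \<noteq> {}" "real (card C) \<le> exp r" by (auto simp: codebooks_def)
  let ?S = "boolean_set nrm \<xi> R N" and ?P = "pmf (poisson_pmf rate) n"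
  define j :: 'n where "j = undefined"
  let ?L = "site_labels K j"
  define w where "w = \<beta> / real K ^ p"
  have K0: "0 < K" using K by simp
  have w: "0 \<le> w" "w \<le> 1" unfolding w_def using \<beta> K(2) radius_pos by (simp, linarith)
  have V0: "0 \<le> V" unfolding V using \<beta> by simp
  define conf :: "(('n \<Rightarrow> nat) \<Rightarrow> real ^ 'n) \<Rightarrow> bool" where "conf x \<longleftrightarrow> (\<forall>\<kappa>\<in>?L. x \<kappa> \<in> site K w j \<kappa>)" for x
  \<comment> \<open>Each code word that serves some configuration at all gets one of these as a reference.\<close>
  define C' where "C' = {A\<in>C. \<exists>y. conf y \<and> hausdorff_dist nrm (ball_union c y ?L) A < ennreal (t ^ q)}"
  have C': "finite C'" "real (card C') \<le> exp r"
    using C card_mono[of C C'] by (auto simp: C'_def)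
  have "\<forall>A\<in>C'. \<exists>y. conf y \<and> hausdorff_dist nrm (ball_union c y ?L) A < ennreal (t ^ q)"
    by (auto simp: C'_def)
  from bchoice[OF this] obtain y where y: "\<And>A. A \<in> C' \<Longrightarrow> conf (y A)"
    "\<And>A. A \<in> C' \<Longrightarrow> hausdorff_dist nrm (ball_union c (y A) ?L) A < ennreal (t ^ q)" by blast
  obtain h where h: "bij_betw h {..<n} ?L"
    using ex_bij_betw_nat_finite[OF finite_site_labels[of K j]] n by (auto simp: atLeast0LessThan card_site_labels)
  define near where "near A \<kappa> = cbox (\<chi> l. y A \<kappa> $ l - B * t) (\<chi> l. y A \<kappa> $ l + B * t)" for A \<kappa>
  define E where "E \<sigma> = {\<omega> \<in> space M. N \<omega> = n \<and> (\<forall>i\<in>{..<n}. \<xi> i \<omega> \<in> site K w j (h (\<sigma> i)))}" for \<sigma>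
  define F where "F \<sigma> A = {\<omega> \<in> space M. N \<omega> = n \<and> (\<forall>i\<in>{..<n}. \<xi> i \<omega> \<in> near A (h (\<sigma> i)))}" for \<sigma> A
  \<comment> \<open>Every configuration served by \<open>A\<close> lies in \<open>F \<sigma> A\<close>, so those in \<open>H \<sigma>\<close> are served by no code word.
    Bounding the distance from below on this measurable set avoids any measurability
    of the distance itself.\<close>
  define H where "H \<sigma> = E \<sigma> - (\<Union>A\<in>C'. F \<sigma> A)" for \<sigma>
  define Perms where "Perms = {\<sigma>. \<sigma> permutes {..<n}}"
  have Perms: "finite Perms" "card Perms = fact n"
    unfolding Perms_def by (auto intro: finite_permutations simp: card_permutations)
  have hL: "h (\<sigma> i) \<in> ?L" if "\<sigma> \<in> Perms" "i < n" for \<sigma> i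
    using h that permutes_in_image[of \<sigma> "{..<n}" i] by (auto simp: Perms_def bij_betw_def)
  have [measurable]: "site K w j \<kappa> \<in> sets borel" "near A \<kappa> \<in> sets borel" for \<kappa> A
    by (auto simp: site_def near_def)
  have meas: "E \<sigma> \<in> sets M" "F \<sigma> A \<in> sets M" for \<sigma> A
    unfolding E_def F_def by measurable
  have FU: "(\<Union>A\<in>C'. F \<sigma> A) \<in> sets M" for \<sigma> by (intro sets.finite_UN C'(1) meas)
  have HM: "H \<sigma> \<in> sets M" for \<sigma> unfolding H_def by (intro sets.Diff meas FU)
  have PE: "prob (E \<sigma>) = ?P * V ^ n" if \<sigma>: "\<sigma> \<in> Perms" for \<sigma>
  proof -
    have "prob (E \<sigma>) = ?P * (\<Prod>i\<in>{..<n}. measure lborel (cbox 0 1 \<inter> site K w j (h (\<sigma> i))))"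
      unfolding E_def by (rule prob_grains) auto
    also have "(\<Prod>i\<in>{..<n}. measure lborel (cbox 0 1 \<inter> site K w j (h (\<sigma> i)))) = (\<Prod>i\<in>{..<n}. V)"
    proof (rule prod.cong)
      fix i assume "i \<in> {..<n}"
      then have "cbox 0 1 \<inter> site K w j (h (\<sigma> i)) = site K w j (h (\<sigma> i))"
        using site_subset_cube[OF K0 w(2) hL[OF \<sigma>]] by blast
      then show "measure lborel (cbox 0 1 \<inter> site K w j (h (\<sigma> i))) = V"
        using measure_site[OF K0 w(1)] by (simp add: V w_def)
    qed simp
    finally show ?thesis by simp
  qed
  have PF: "prob (F \<sigma> A) \<le> ?P * (2 * B * t) ^ (CARD('n) * n)" for \<sigma> A
  proof -
    have "measure lborel (cbox 0 1 \<inter> near A \<kappa>) \<le> (2 * B * t) ^ CARD('n)" for \<kappa>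
    proof -
      have "measure lborel (cbox 0 1 \<inter> near A \<kappa>) \<le> measure lborel (near A \<kappa>)"
        unfolding near_def by (intro measure_mono_fmeasurable) (auto simp: fmeasurable_cbox)
      also have "\<dots> = (\<Prod>l\<in>(UNIV :: 'n set). 2 * B * t)"
        unfolding near_def using B t(1)
        by (subst content_cbox_cart) (auto simp: interval_ne_empty_cart power_mult_distrib intro!: prod.cong)
      finally show ?thesis by simp
    qed
    then have "(\<Prod>i\<in>{..<n}. measure lborel (cbox 0 1 \<inter> near A (h (\<sigma> i)))) \<le> (\<Prod>i\<in>{..<n}. (2 * B * t) ^ CARD('n))"
      by (intro prod_mono) auto
    moreover have "prob (F \<sigma> A) = ?P * (\<Prod>i\<in>{..<n}. measure lborel (cbox 0 1 \<inter> near A (h (\<sigma> i))))"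
      unfolding F_def by (rule prob_grains) auto
    ultimately show ?thesis by (simp add: mult_left_mono power_mult)
  qed
  have PH: "?P * V ^ n / 2 \<le> prob (H \<sigma>)" if \<sigma>: "\<sigma> \<in> Perms" for \<sigma>
  proof -
    have "prob (\<Union>A\<in>C'. F \<sigma> A) \<le> (\<Sum>A\<in>C'. prob (F \<sigma> A))"
      by (rule finite_measure_subadditive_finite[OF C'(1)]) (use meas in auto)
    also have "\<dots> \<le> (\<Sum>A\<in>C'. ?P * (2 * B * t) ^ (CARD('n) * n))" by (rule sum_mono[OF PF])
    also have "\<dots> = card C' * (?P * (2 * B * t) ^ (CARD('n) * n))" by simp
    also have "\<dots> \<le> exp r * (?P * (2 * B * t) ^ (CARD('n) * n))"
      using B t by (intro mult_right_mono C'(2)) auto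
    also have "\<dots> \<le> ?P * (V ^ n / 2)" using mult_left_mono[OF small, of ?P] by (simp add: mult_ac)
    finally have "prob (\<Union>A\<in>C'. F \<sigma> A) \<le> ?P * V ^ n / 2" by simp
    moreover have "prob (E \<sigma>) - prob (\<Union>A\<in>C'. F \<sigma> A) \<le> prob (H \<sigma>)"
    proof -
      have "prob (E \<sigma>) \<le> prob (H \<sigma> \<union> (\<Union>A\<in>C'. F \<sigma> A))"
        by (rule finite_measure_mono[OF _ sets.Un[OF HM FU]]) (auto simp: H_def)
      also have "\<dots> \<le> prob (H \<sigma>) + prob (\<Union>A\<in>C'. F \<sigma> A)"
        by (rule measure_Un_le[OF HM FU])
      finally show ?thesis by simp
    qed
    ultimately show ?thesis unfolding PE[OF \<sigma>] by linarith
  qed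
  have disj: "disjoint_family_on H Perms"
    unfolding disjoint_family_on_def
  proof (intro ballI impI)
    fix \<sigma> \<sigma>' assume s: "\<sigma> \<in> Perms" "\<sigma>' \<in> Perms" "\<sigma> \<noteq> \<sigma>'"
    obtain i where i: "\<sigma> i \<noteq> \<sigma>' i" using s(3) by auto
    have il: "i < n"
    proof (rule ccontr)
      assume "\<not> i < n"
      then have "\<sigma> i = i" "\<sigma>' i = i" using s(1,2) by (auto simp: Perms_def permutes_not_in)
      with i show False by simp
    qed
    have "\<sigma> i \<in> {..<n}" "\<sigma>' i \<in> {..<n}"
      using s(1,2) il permutes_in_image[of \<sigma> "{..<n}" i] permutes_in_image[of \<sigma>' "{..<n}" i] by (auto simp: Perms_def)
    then have hne: "h (\<sigma> i) \<noteq> h (\<sigma>' i)"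
      using i inj_on_contraD[OF bij_betw_imp_inj_on[OF h]] by blast
    { fix \<omega> assume "\<omega> \<in> H \<sigma> \<inter> H \<sigma>'"
      then have "\<xi> i \<omega> \<in> site K w j (h (\<sigma> i))" "\<xi> i \<omega> \<in> site K w j (h (\<sigma>' i))"
        using il by (auto simp: H_def E_def)
      from sites_apart[OF K0 hL[OF s(1) il] hL[OF s(2) il] hne this] have False using K0 by simp }
    then show "H \<sigma> \<inter> H \<sigma>' = {}" by blast
  qed
  have far: "AE \<omega> in M. ennreal (t ^ q) * indicator (\<Union>\<sigma>\<in>Perms. H \<sigma>) \<omega> \<le> (MIN A\<in>C. hausdorff_dist nrm (?S \<omega>) A)"
    using AE_boolean_set
  proof eventually_elim
    case (elim \<omega>)
    show ?case
    proof (cases "\<omega> \<in> (\<Union>\<sigma>\<in>Perms. H \<sigma>)")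
      case True
      then obtain \<sigma> where \<sigma>: "\<sigma> \<in> Perms" "\<omega> \<in> H \<sigma>" by blast
      then have N: "N \<omega> = n" and in_site: "\<And>i. i < n \<Longrightarrow> \<xi> i \<omega> \<in> site K w j (h (\<sigma> i))"
        by (auto simp: H_def E_def)
      have bij: "bij_betw (\<lambda>i. h (\<sigma> i)) {..<n} ?L"
        using bij_betw_trans[OF permutes_imp_bij h, of \<sigma>] \<sigma>(1) by (auto simp: Perms_def comp_def)
      define g where "g = the_inv_into {..<n} (\<lambda>i. h (\<sigma> i))"
      have g: "g (h (\<sigma> i)) = i" if "i < n" for i
        unfolding g_def using bij that by (intro the_inv_into_f_f) (auto simp: bij_betw_def)
      define x where "x \<kappa> = \<xi> (g \<kappa>) \<omega>" for \<kappa>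
      have xh: "x (h (\<sigma> i)) = \<xi> i \<omega>" if "i < n" for i using g[OF that] by (simp add: x_def)
      have L: "?L = (\<lambda>i. h (\<sigma> i)) ` {..<n}" using bij by (simp add: bij_betw_def)
      have x: "conf x" unfolding conf_def L using in_site xh by auto
      have Sx: "?S \<omega> = ball_union c x ?L" using elim N xh unfolding L ball_union_def by auto
      have "ennreal (t ^ q) \<le> hausdorff_dist nrm (?S \<omega>) A" if A: "A \<in> C" for A
      proof (rule ccontr)
        assume "\<not> ?thesis"
        then have lt: "hausdorff_dist nrm (ball_union c x ?L) A < ennreal (t ^ q)" unfolding Sx by simp
        then have A': "A \<in> C'" using A x by (auto simp: C'_def)
        have "\<omega> \<in> F \<sigma> A"
          unfolding F_def
        proof (intro CollectI conjI ballI)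
          show "\<omega> \<in> space M" using \<sigma> by (auto simp: H_def E_def)
          fix i assume i: "i \<in> {..<n}"
          have "\<bar>x (h (\<sigma> i)) $ l - y A (h (\<sigma> i)) $ l\<bar> \<le> B * t" for l
            by (rule configurations_close[OF K t _ _ lt y(2)[OF A']])
              (use x y(1)[OF A'] hL[OF \<sigma>(1)] i in \<open>auto simp: conf_def w_def\<close>)
          then show "\<xi> i \<omega> \<in> near A (h (\<sigma> i))"
            using i unfolding near_def by (simp add: xh mem_box_cart abs_le_iff algebra_simps)
        qed (rule N)
        then show False using \<sigma>(2) A' by (auto simp: H_def)
      qed
      then show ?thesis using True C by simp
    qed simp
  qed
  have "ennreal (t ^ q * (fact n * (?P * V ^ n / 2))) = ennreal (t ^ q) * ennreal (\<Sum>\<sigma>\<in>Perms. ?P * V ^ n / 2)"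
    using t Perms V0 by (subst ennreal_mult[symmetric]) auto
  also have "\<dots> \<le> ennreal (t ^ q) * ennreal (\<Sum>\<sigma>\<in>Perms. prob (H \<sigma>))"
    by (intro mult_left_mono ennreal_leI sum_mono PH) auto
  also have "(\<Sum>\<sigma>\<in>Perms. prob (H \<sigma>)) = prob (\<Union>\<sigma>\<in>Perms. H \<sigma>)"
    by (rule finite_measure_finite_Union[symmetric]) (use Perms HM disj in auto)
  also have "ennreal (t ^ q) * ennreal (prob (\<Union>\<sigma>\<in>Perms. H \<sigma>)) = (\<integral>\<^sup>+ \<omega>. ennreal (t ^ q) * indicator (\<Union>\<sigma>\<in>Perms. H \<sigma>) \<omega> \<partial>M)"
    using Perms HM by (subst nn_integral_cmult_indicator) (auto simp: emeasure_eq_measure)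
  also have "\<dots> \<le> (\<integral>\<^sup>+ \<omega>. (MIN A\<in>C. hausdorff_dist nrm (?S \<omega>) A) \<partial>M)"
    by (rule nn_integral_mono_AE[OF far])
  finally show "ennreal (t ^ q * (fact n * (?P * V ^ n / 2))) \<le> (\<integral>\<^sup>+ \<omega>. (MIN A\<in>C. hausdorff_dist nrm (?S \<omega>) A) \<partial>M)" .
qed

end

section \<open>Optimising the lower exponent\<close>

text \<open>
  With \<open>n = K ^ (D - 1)\<close>, the first term is the precision that the codebook can reach and the
  third one the probability of the configurations, with \<open>ln K = ln n / (D - 1)\<close>. The two balance at
  \<open>n\<close> near \<open>\<tau> * sqrt (r / ln r)\<close>, and the remaining terms are of lower order.
\<close>
lemma lower_exponent_asymp:
  fixes D p q K0 :: nat and C1 C2 \<eta> :: real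
  defines "g \<equiv> \<lambda>r. sqrt (2 * real q * (1 + real p / (real D - 1)) / real D * r * ln r)"
  assumes D: "2 \<le> D" and q: "1 \<le> q" and \<eta>: "0 < \<eta>"
  shows "\<forall>\<^sub>F r in at_top. \<exists>K\<ge>K0. 1 \<le> K \<and>
     real q * r / (real D * real K ^ (D - 1)) + real p * real q * ln K + (p + real D - 1) * real K ^ (D - 1) * ln K
       + C1 * real K ^ (D - 1) + C2 \<le> (1 + \<eta>) * g r"
proof -
  define a where "a = real D - 1"
  have a: "1 \<le> a" "real D = a + 1" "0 < a" "real (D - 1) = a" using D by (auto simp: a_def of_nat_diff)
  define A where "A = 1 + real p / a"
  have A: "1 \<le> A" "p + real D - 1 = a * A" unfolding A_def using a by (auto simp: field_simps)
  define \<tau> where "\<tau> = sqrt (2 * q / (D * A))"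
  have "0 < real D * A" using a A by simp
  then have \<tau>: "0 < \<tau>" unfolding \<tau>_def using q by simp
  define h where "h = A * \<tau> / 2"
  have h: "0 < h" unfolding h_def using A \<tau> by simp
  have "\<tau> * \<tau> = 2 * q / (D * A)"
    unfolding \<tau>_def using \<open>0 < real D * A\<close> by (intro real_sqrt_mult_self[THEN trans]) auto
  then have \<tau>2: "\<tau> * \<tau> * (D * A) = 2 * q"
    using \<open>0 < real D * A\<close> nonzero_eq_divide_eq[of "real D * A" "\<tau> * \<tau>"] by auto
  have qD: "q / D = h * \<tau>" using \<tau>2 a unfolding h_def by (simp add: field_simps)
  have gr: "g r = 2 * h * sqrt (r * ln r)" for r
  proof -
    have "2 * real q * (1 + real p / (real D - 1)) / real D = (q / D) * (2 * A)"
      unfolding A_def a_def by simp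
    also have "\<dots> = (2 * h)\<^sup>2" unfolding qD h_def by (simp add: power2_eq_square)
    finally have "g r = sqrt ((2 * h)\<^sup>2 * (r * ln r))" unfolding g_def by (simp add: mult.assoc)
    then show ?thesis using h by (simp add: real_sqrt_mult)
  qed
  \<comment> \<open>The factor \<open>\<mu>\<close> absorbs the rounding of \<open>K\<close> to an integer.\<close>
  obtain \<mu> where \<mu>: "0 < \<mu>" "\<mu> < 1" "1 / \<mu> ^ (D - 1) \<le> 1 + \<eta> / 2"
  proof -
    have "((\<lambda>\<mu>::real. 1 / \<mu> ^ (D - 1)) \<longlongrightarrow> 1 / 1 ^ (D - 1)) (at_left 1)"
      by (intro tendsto_intros) auto
    then have "\<forall>\<^sub>F \<mu> in at_left (1::real). 1 / \<mu> ^ (D - 1) < 1 + \<eta> / 2"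
      by (rule order_tendstoD) (use \<eta> in simp)
    moreover have "\<forall>\<^sub>F \<mu> in at_left (1::real). 0 < \<mu> \<and> \<mu> < 1"
      using eventually_at_left_real[of 0 "1::real"] by (auto elim: eventually_mono)
    ultimately have "\<forall>\<^sub>F \<mu> in at_left (1::real). 1 / \<mu> ^ (D - 1) < 1 + \<eta> / 2 \<and> 0 < \<mu> \<and> \<mu> < 1"
      by (rule eventually_conj)
    then obtain \<mu> where "1 / \<mu> ^ (D - 1) < 1 + \<eta> / 2 \<and> 0 < \<mu> \<and> \<mu> < 1"
      using eventually_happens'[of "at_left (1::real)"] by auto
    then show ?thesis by (intro that[of \<mu>]) auto
  qed
  define C3 where "C3 = (\<bar>C1\<bar> + real p * real q + a * A * \<bar>ln \<tau>\<bar>) * \<tau> + 1"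
  have C3: "0 < C3" unfolding C3_def using a A \<tau> by (intro add_nonneg_pos mult_nonneg_nonneg) auto
  have "filterlim (\<lambda>r. (\<tau> * sqrt (r / ln r)) powr (1 / a)) at_top at_top"
    using \<tau> a by real_asymp
  then have e1: "\<forall>\<^sub>F r in at_top. max (real K0 + 2) (1 / (1 - \<mu>)) \<le> (\<tau> * sqrt (r / ln r)) powr (1 / a)"
    unfolding filterlim_at_top by (rule spec)
  have e2: "\<forall>\<^sub>F r in at_top. C3 * sqrt (r / ln r) + C2 \<le> \<eta> * h * sqrt (r * ln r)"
    using C3 \<eta> h by real_asymp
  show ?thesis
    using e1 e2 eventually_ge_at_top[of "exp 1"]
  proof eventually_elim
    case (elim r)
    have lnr: "1 \<le> ln r" using elim(3) by (metis exp_gt_zero ln_exp ln_mono)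
    have r: "1 < r" using elim(3) exp_gt_one[of 1] by linarith
    define s where "s = \<tau> * sqrt (r / ln r)"
    define y where "y = s powr (1 / a)"
    have y: "real K0 + 2 \<le> y" "1 / (1 - \<mu>) \<le> y" using elim(1) by (auto simp: y_def s_def)
    have s: "0 < s" unfolding s_def using \<tau> r lnr by simp
    have ys: "y ^ (D - 1) = s"
    proof -
      have "y ^ (D - 1) = y powr real (D - 1)" using y by (simp add: powr_realpow)
      then show ?thesis unfolding a(4) y_def using s a by (simp add: powr_powr)
    qed
    define K where "K = nat \<lfloor>y\<rfloor>"
    have K: "real K \<le> y" "y - 1 \<le> real K" "K0 \<le> K" "1 \<le> K"
      using y unfolding K_def by linarith+
    have "1 \<le> (1 - \<mu>) * y" using y(2) \<mu> by (simp add: pos_divide_le_eq mult.commute)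
    then have "\<mu> * y \<le> K" using K(2) by (simp add: algebra_simps)
    then have "(\<mu> * y) ^ (D - 1) \<le> real K ^ (D - 1)" using \<mu> y by (intro power_mono) auto
    then have nl: "\<mu> ^ (D - 1) * s \<le> real K ^ (D - 1)" unfolding power_mult_distrib ys .
    have nu: "real K ^ (D - 1) \<le> s" unfolding ys[symmetric] using K by (intro power_mono) auto
    have lnK: "ln K \<le> ln s / a"
    proof -
      have "ln K \<le> ln y" using K by (intro ln_mono) auto
      then show ?thesis unfolding y_def using s by (simp add: ln_powr)
    qed
    have lnK0: "0 \<le> ln (real K)" using K by simp
    have ss: "sqrt (r / ln r) * ln r = sqrt (r * ln r)" "r / sqrt (r / ln r) = sqrt (r * ln r)"
    proof -
      have "sqrt (r / ln r) * ln r = sqrt (r / ln r) * (sqrt (ln r) * sqrt (ln r))" using lnr by simp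
      also have "\<dots> = sqrt (r / ln r * ln r * ln r)" unfolding real_sqrt_mult by simp
      finally show "sqrt (r / ln r) * ln r = sqrt (r * ln r)" using lnr by simp
      have "r / sqrt (r / ln r) = sqrt r * sqrt r / (sqrt r / sqrt (ln r))"
        using r by (simp add: real_sqrt_divide)
      also have "\<dots> = sqrt (r * ln r)" using r lnr by (simp add: real_sqrt_mult field_simps)
      finally show "r / sqrt (r / ln r) = sqrt (r * ln r)" .
    qed
    have t1: "real q * r / (real D * real K ^ (D - 1)) \<le> (1 + \<eta> / 2) * (h * sqrt (r * ln r))"
    proof -
      have "real q * r / (real D * real K ^ (D - 1)) \<le> real q * r / (real D * (\<mu> ^ (D - 1) * s))"
        using nl \<mu> s r D K by (intro divide_left_mono mult_left_mono) auto
      also have "\<dots> = 1 / \<mu> ^ (D - 1) * (q / D * (r / s))" by simp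
      also have "q / D * (r / s) = h * sqrt (r * ln r)"
        unfolding qD s_def ss(2)[symmetric] using \<tau> by simp
      also have "1 / \<mu> ^ (D - 1) * (h * sqrt (r * ln r)) \<le> (1 + \<eta> / 2) * (h * sqrt (r * ln r))"
        using \<mu>(3) h r lnr by (intro mult_right_mono) auto
      finally show ?thesis .
    qed
    have lns: "ln s \<le> \<bar>ln \<tau>\<bar> + ln r / 2"
    proof -
      have "ln s = ln \<tau> + ln (r / ln r) / 2"
        unfolding s_def using \<tau> r lnr by (simp add: ln_mult ln_sqrt)
      moreover have "ln (r / ln r) \<le> ln r" using r lnr by (intro ln_mono) (auto simp: field_simps)
      ultimately show ?thesis by linarith
    qed
    have t2: "(p + real D - 1) * real K ^ (D - 1) * ln K \<le> h * sqrt (r * ln r) + a * A * \<bar>ln \<tau>\<bar> * s"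
    proof -
      have "real K ^ (D - 1) * ln K \<le> s * (ln s / a)" by (rule mult_mono[OF nu lnK]) (use s lnK0 in auto)
      then have "a * A * (real K ^ (D - 1) * ln K) \<le> a * A * (s * (ln s / a))"
        using a A by (intro mult_left_mono) auto
      also have "\<dots> = A * (s * ln s)" using a by simp
      also have "\<dots> \<le> A * (s * (\<bar>ln \<tau>\<bar> + ln r / 2))"
        using lns A s by (intro mult_left_mono) auto
      also have "\<dots> = A * \<bar>ln \<tau>\<bar> * s + A * \<tau> / 2 * (sqrt (r / ln r) * ln r)"
        unfolding s_def by (simp add: algebra_simps)
      also have "A * \<bar>ln \<tau>\<bar> * s \<le> a * (A * \<bar>ln \<tau>\<bar> * s)"
        using a A s mult_right_mono[of 1 a "A * \<bar>ln \<tau>\<bar> * s"] by simp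
      finally show ?thesis unfolding ss A(2) h_def by (simp add: mult_ac)
    qed
    have t3: "real p * real q * ln K \<le> real p * real q * s"
    proof -
      have "ln K \<le> real K" using K ln_le_minus_one[of "real K"] by simp
      also have "real K \<le> real K ^ (D - 1)" using D K by (intro self_le_power) auto
      finally show ?thesis using nu by (intro mult_left_mono) auto
    qed
    have t4: "C1 * real K ^ (D - 1) \<le> \<bar>C1\<bar> * s"
      using nu by (intro mult_mono) auto
    have "C3 * sqrt (r / ln r) = \<bar>C1\<bar> * s + real p * real q * s + a * A * \<bar>ln \<tau>\<bar> * s + sqrt (r / ln r)"
      unfolding C3_def s_def by (simp add: algebra_simps)
    moreover have "0 \<le> sqrt (r / ln r)" using r lnr by simp
    moreover have "(1 + \<eta> / 2) * (h * sqrt (r * ln r)) = h * sqrt (r * ln r) + \<eta> / 2 * (h * sqrt (r * ln r))"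
      by (rule distrib_right[THEN trans]) simp
    ultimately have "real q * r / (real D * real K ^ (D - 1)) + real p * real q * ln K + (p + real D - 1) * real K ^ (D - 1) * ln K
       + C1 * real K ^ (D - 1) + C2 \<le> (1 + \<eta> / 2) * (h * sqrt (r * ln r)) + h * sqrt (r * ln r) + \<eta> * h * sqrt (r * ln r)"
      using t1 t2 t3 t4 elim(2) by linarith
    also have "\<dots> \<le> (1 + \<eta>) * g r"
    proof -
      have "0 \<le> \<eta> * (h * sqrt (r * ln r))" using \<eta> h r lnr by simp
      then show ?thesis unfolding gr by (simp add: algebra_simps)
    qed
    finally show ?case using K(3,4) by blast
  qed
qed

text \<open>
  The value of \<open>t\<close> below is chosen such that \<open>2 B t\<close> to the power \<open>d\<close> is at most \<open>exp (- r / n)\<close> times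
  half the volume of a site; this makes the codebook too small for its task.
\<close>
lemma (in tip_model) quantization_error_lower:
  shows "exp_asymp (\<ge>) (quantization_error M nrm (boolean_set nrm \<xi> R N))
    (\<lambda>r. sqrt (2 * real q * (1 + real p / (real CARD('n) - 1)) / real CARD('n) * r * ln r))"
proof (rule exp_asymp_geI)
  define D where "D = CARD('n)"
  have D: "2 \<le> D" using dim by (simp add: D_def)
  have a: "0 < 2 * real q * (1 + real p / (real D - 1)) / real D"
    using D pq by (intro divide_pos_pos mult_pos_pos add_pos_nonneg) auto
  show "\<forall>\<^sub>F r in at_top. 0 < sqrt (2 * real q * (1 + real p / (real CARD('n) - 1)) / real CARD('n) * r * ln r)"
    unfolding D_def[symmetric] using eventually_gt_at_top[of 1]
  proof eventually_elim
    case (elim r)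
    then show ?case using a by (intro real_sqrt_gt_zero mult_pos_pos) auto
  qed
  fix \<eta> :: real assume \<eta>: "0 < \<eta>"
  define b where "b = min \<gamma> (\<beta> / (4 * B))"
  have b: "0 < b" "b \<le> \<gamma>" "2 * B * b \<le> \<beta> / 2"
  proof -
    have "2 * B * b \<le> 2 * B * (\<beta> / (4 * B))" using B unfolding b_def by (intro mult_left_mono) auto
    then show "2 * B * b \<le> \<beta> / 2" using B by simp
  qed (use B \<beta> \<gamma> in \<open>auto simp: b_def\<close>)
  define K0 where "K0 = nat \<lceil>\<beta> / (1 - c)\<rceil>"
  define C1 where "C1 = (real D - 1) * ln 2 - ln rate - ln \<beta>"
  define C2 where "C2 = rate + ln 2 - q * ln b"
  from lower_exponent_asymp[OF D pq(2) \<eta>, of K0 p C1 C2, folded D_def]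
  show "\<forall>\<^sub>F r in at_top. ennreal (exp (- (1 + \<eta>) * sqrt (2 * real q * (1 + real p / (real CARD('n) - 1)) / real CARD('n) * r * ln r)))
      \<le> quantization_error M nrm (boolean_set nrm \<xi> R N) r"
    using eventually_gt_at_top[of 1] unfolding D_def[symmetric]
  proof eventually_elim
    case (elim r)
    let ?g = "sqrt (2 * real q * (1 + real p / (real D - 1)) / real D * r * ln r)"
    from elim(1) obtain K where K: "K0 \<le> K" "1 \<le> K"
      and ex: "real q * r / (real D * real K ^ (D - 1)) + real p * real q * ln K + (p + real D - 1) * real K ^ (D - 1) * ln K
       + C1 * real K ^ (D - 1) + C2 \<le> (1 + \<eta>) * ?g" by blast
    define n where "n = K ^ (D - 1)"
    have n: "1 \<le> n" using K by (simp add: n_def)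
    have n': "real K ^ (D - 1) = n" by (simp add: n_def)
    define V where "V = \<beta> / real K ^ p * (1 / (2 * real K)) ^ (D - 1)"
    have V0: "0 < V" unfolding V_def using \<beta> K by simp
    define t where "t = exp (- (r / (D * n))) * (b / real K ^ p)"
    have Kp: "real K \<le> real K ^ p" "1 \<le> real K ^ p" using K pq by (auto intro: self_le_power)
    have t0: "0 < t" unfolding t_def using b K by simp
    have "exp (- (r / (D * n))) \<le> 1" using elim by simp
    then have tb: "t \<le> b / real K ^ p" unfolding t_def using b by (intro mult_left_le_one_le) auto
    have Kwidth: "\<beta> / real K ^ p \<le> 1 - c"
    proof -
      have "\<beta> / (1 - c) \<le> K" using K(1) unfolding K0_def by linarith
      then have "\<beta> / (1 - c) \<le> real K ^ p" using Kp by linarith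
      then have "\<beta> \<le> real K ^ p * (1 - c)" using radius_less_1 by (simp add: pos_divide_le_eq)
      moreover have "0 < real K ^ p" using Kp by linarith
      ultimately show ?thesis by (simp add: pos_divide_le_eq mult.commute)
    qed
    have tq: "t ^ q \<le> \<gamma> / real K ^ p"
    proof -
      have "b / real K ^ p \<le> \<gamma> / real K ^ p" using b by (intro divide_right_mono) auto
      then have tg: "t \<le> \<gamma> / real K ^ p" using tb by linarith
      also have "\<dots> \<le> 1"
      proof -
        have "\<gamma> \<le> real K ^ p" using \<gamma> Kp(2) by linarith
        then show ?thesis using K(2) by simp
      qed
      finally have "t \<le> 1" .
      then have "t ^ q \<le> t ^ 1" using t0 pq by (intro power_decreasing) auto
      with tg show ?thesis by simp
    qed
    have small: "exp r * (2 * B * t) ^ (D * n) \<le> V ^ n / 2"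
    proof -
      have "2 * B * t = exp (- (r / (D * n))) * (2 * B * b / real K ^ p)" by (simp add: t_def)
      also have "\<dots> \<le> exp (- (r / (D * n))) * (\<beta> / 2 / real K ^ p)"
        using b by (intro mult_left_mono divide_right_mono) auto
      finally have "(2 * B * t) ^ D \<le> (exp (- (r / (D * n))) * (\<beta> / 2 / real K ^ p)) ^ D"
        using B t0 by (intro power_mono) auto
      also have "\<dots> = exp (- (r / (D * n))) ^ D * (\<beta> ^ D / 2 ^ D / (real K ^ p) ^ D)"
        by (simp add: power_mult_distrib power_divide)
      also have "exp (- (r / (D * n))) ^ D = exp (- (r / n))"
        using D by (simp add: exp_of_nat_mult[symmetric])
      also have "\<beta> ^ D / 2 ^ D / (real K ^ p) ^ D \<le> \<beta> / 2 ^ D / (real K ^ p * real K ^ (D - 1))"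
      proof (rule frac_le)
        have "\<beta> ^ D \<le> \<beta> ^ 1" using \<beta> D by (intro power_decreasing) auto
        then show "\<beta> ^ D / 2 ^ D \<le> \<beta> / 2 ^ D" by (intro divide_right_mono) auto
        have "real K ^ (D - 1) \<le> (real K ^ p) ^ (D - 1)" using Kp by (intro power_mono) auto
        then have "real K ^ p * real K ^ (D - 1) \<le> real K ^ p * (real K ^ p) ^ (D - 1)"
          by (intro mult_left_mono) auto
        also have "\<dots> = (real K ^ p) ^ D"
          using D by (metis One_nat_def Suc_1 Suc_le_D diff_Suc_1 power_Suc)
        finally show "real K ^ p * real K ^ (D - 1) \<le> (real K ^ p) ^ D" .
      qed (use \<beta> K in auto)
      also have "\<beta> / 2 ^ D / (real K ^ p * real K ^ (D - 1)) = V / 2"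
      proof -
        obtain D' where "D = Suc D'" using D by (cases D) auto
        then show ?thesis unfolding V_def by (simp add: power_divide power_mult_distrib)
      qed
      finally have "(2 * B * t) ^ D \<le> exp (- (r / n)) * (V / 2)" by simp
      then have "((2 * B * t) ^ D) ^ n \<le> (exp (- (r / n)) * (V / 2)) ^ n"
        using B t0 by (intro power_mono) auto
      also have "\<dots> = exp (- (r / n)) ^ n * (V ^ n * (1 / 2) ^ n)"
        by (simp add: power_mult_distrib power_divide)
      also have "exp (- (r / n)) ^ n = exp (- r)" using n by (simp add: exp_of_nat_mult[symmetric])
      finally have "exp r * ((2 * B * t) ^ D) ^ n \<le> exp r * (exp (- r) * (V ^ n * (1 / 2) ^ n))"
        by (intro mult_left_mono) auto
      also have "\<dots> = V ^ n * (1 / 2) ^ n" by (simp add: exp_minus field_simps)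
      also have "\<dots> \<le> V ^ n * (1 / 2) ^ 1" using V0 n by (intro mult_left_mono power_decreasing) auto
      finally show ?thesis by (simp add: power_mult)
    qed
    have "exp (- (1 + \<eta>) * ?g) \<le> exp (- (real q * r / (real D * n) + real p * real q * ln K + (p + real D - 1) * n * ln K + C1 * n + C2))"
      using ex unfolding n' by (simp only: mult_minus_left exp_le_cancel_iff neg_le_iff_le)
    also have "\<dots> = t ^ q * (fact n * (pmf (poisson_pmf rate) n * V ^ n / 2))"
    proof -
      have ln1: "ln (real K ^ p) = p * ln K" "ln (real K ^ (D - 1)) = (real D - 1) * ln K"
        using K D by (auto simp: ln_realpow of_nat_diff)
      have "t = exp (ln b - p * ln K - r / (D * n))"
      proof -
        have "exp (p * ln K) = real K ^ p" using K by (subst exp_of_nat_mult) simp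
        then show ?thesis unfolding t_def using b(1) by (simp add: exp_diff exp_minus divide_inverse)
      qed
      then have tE: "t ^ q = exp (q * (ln b - p * ln K - r / (D * n)))" by (simp add: exp_of_nat_mult)
      have "V = exp (ln \<beta> - p * ln K - (real D - 1) * (ln 2 + ln K))"
      proof -
        have "ln (1 / (2 * real K)) = - (ln 2 + ln K)" using K by (simp add: ln_div ln_mult)
        moreover have "ln ((1 / (2 * real K)) ^ (D - 1)) = real (D - 1) * ln (1 / (2 * real K))"
          by (rule ln_realpow)
        moreover have "real (D - 1) = real D - 1" using D by (simp add: of_nat_diff)
        ultimately have "ln ((1 / (2 * real K)) ^ (D - 1)) = - ((real D - 1) * (ln 2 + ln K))"
          by (simp only: mult_minus_right)
        then have "ln V = ln \<beta> - p * ln K - (real D - 1) * (ln 2 + ln K)"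
          unfolding V_def using \<beta> K by (subst ln_mult) (auto simp: ln_div ln1)
        then show ?thesis using V0 by (metis exp_ln)
      qed
      then have VE: "V ^ n = exp (n * (ln \<beta> - p * ln K - (real D - 1) * (ln 2 + ln K)))"
        by (simp add: exp_of_nat_mult)
      have lE: "rate ^ n = exp (n * ln rate)" using rate_pos by (subst exp_of_nat_mult) simp
      have "fact n * (pmf (poisson_pmf rate) n * V ^ n / 2) = rate ^ n * exp (- rate) * V ^ n * exp (- ln 2)"
        using rate_pos by (simp add: exp_minus)
      also have "\<dots> = exp (n * ln rate - rate + n * (ln \<beta> - p * ln K - (real D - 1) * (ln 2 + ln K)) - ln 2)"
        unfolding lE VE by (simp add: exp_add[symmetric])
      finally have "t ^ q * (fact n * (pmf (poisson_pmf rate) n * V ^ n / 2))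
          = exp (q * (ln b - p * ln K - r / (D * n)) + (n * ln rate - rate + n * (ln \<beta> - p * ln K - (real D - 1) * (ln 2 + ln K)) - ln 2))"
        unfolding tE by (simp add: exp_add)
      also have "q * (ln b - p * ln K - r / (D * n)) + (n * ln rate - rate + n * (ln \<beta> - p * ln K - (real D - 1) * (ln 2 + ln K)) - ln 2)
         = - (real q * r / (real D * n) + real p * real q * ln K + (p + real D - 1) * n * ln K + C1 * n + C2)"
        unfolding C1_def C2_def by (simp add: algebra_simps)
      finally show ?thesis ..
    qed
    finally have "ennreal (exp (- (1 + \<eta>) * ?g)) \<le> ennreal (t ^ q * (fact n * (pmf (poisson_pmf rate) n * V ^ n / 2)))"
      by (rule ennreal_leI)
    also have "\<dots> \<le> quantization_error M nrm (boolean_set nrm \<xi> R N) r"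
      by (rule quantization_error_ge[OF K(2) Kwidth t0 tq n_def[unfolded D_def] V_def[unfolded D_def] small[unfolded D_def]])
    finally show ?case .
  qed
qed

lemma two_components_le_l1:
  assumes "l \<noteq> j"
  shows "\<bar>z $ j\<bar> + \<bar>z $ l\<bar> \<le> l1_norm z"
proof -
  have "(\<Sum>i\<in>{j, l}. \<bar>z $ i\<bar>) \<le> (\<Sum>i\<in>UNIV. \<bar>z $ i\<bar>)"
    by (rule sum_mono2) auto
  then show ?thesis using assms by (simp add: l1_norm_def)
qed

lemma two_components_le_l2:
  fixes z :: "real ^ 'n"
  assumes "l \<noteq> j"
  shows "(z $ j)\<^sup>2 + (z $ l)\<^sup>2 \<le> (norm z)\<^sup>2"
proof -
  have "(\<Sum>i\<in>{j, l}. (z $ i)\<^sup>2) \<le> (\<Sum>i\<in>UNIV. (z $ i)\<^sup>2)"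
    by (rule sum_mono2) auto
  moreover have "(norm z)\<^sup>2 = (\<Sum>i\<in>UNIV. (z $ i)\<^sup>2)"
    unfolding power2_norm_eq_inner inner_vec_def by (simp add: power2_eq_square)
  ultimately show ?thesis using assms by simp
qed

context fixed_radius_model
begin

text \<open>
  Near its tip the \<open>\<ell>\<^sub>1\<close> ball is a cone, and horizontal distances count in full. Therefore a slab
  a quarter as thick as the gap between sites keeps every tip visible, and the distance to the
  tip determines the centre up to a linear error.
\<close>
lemma tip_model_l1:
  assumes dim: "2 \<le> CARD('n)"
  shows "tip_model M \<xi> R N rate c (l1_norm :: real ^ 'n \<Rightarrow> real) 1 1 (1 / 8) (1 / 8) 2"
proof (intro tip_model.intro fixed_radius_norm_model.intro fixed_radius_norm_model_axioms.intro tip_model_axioms.intro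
    fixed_radius_model_axioms sandwiched_norm_l1 dim)
  fix K :: nat and j :: 'n and \<kappa> \<kappa>' and x y :: "real ^ 'n" and t :: real
  assume K: "1 \<le> K" and \<kappa>: "\<kappa> \<in> site_labels K j" "\<kappa>' \<in> site_labels K j" "\<kappa> \<noteq> \<kappa>'"
    and x: "x \<in> site K (1 / 8 / real K ^ 1) j \<kappa>" and y: "y \<in> site K (1 / 8 / real K ^ 1) j \<kappa>'"
    and t: "0 < t" "t ^ 1 \<le> 1 / 8 / real K ^ 1"
  have K0: "0 < K" using K by simp
  obtain l where l: "l \<noteq> j" "1 / (2 * real K) \<le> \<bar>x $ l - y $ l\<bar>" using sites_apart[OF K0 \<kappa> x y] by blast
  let ?z = "x + c *\<^sub>R axis j 1 - y"
  have z: "?z $ j = x $ j + c - y $ j" "?z $ l = x $ l - y $ l" using l by (auto simp: axis_def)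
  have "0 \<le> x $ j" "y $ j \<le> 1 / 8 / real K" using x y by (auto simp: in_site_iff[OF K0])
  moreover have "1 / (2 * real K) = 4 * (1 / 8 / real K)" by simp
  ultimately show "c + 2 * t ^ 1 \<le> l1_norm ?z"
    using two_components_le_l1[OF l(1), of ?z] l(2) t unfolding z by simp
next
  fix t :: real and x y :: "real ^ 'n" and j l :: 'n
  assume t: "0 < t" "l1_norm (x + c *\<^sub>R axis j 1 - y) < c + 2 * t ^ 1" "l1_norm (y + c *\<^sub>R axis j 1 - x) < c + 2 * t ^ 1"
  interpret n: sandwiched_norm "l1_norm :: real ^ 'n \<Rightarrow> real" by (rule sandwiched_norm_l1)
  show "\<bar>x $ l - y $ l\<bar> \<le> 2 * t"
  proof (cases "l = j")
    case True
    then show ?thesis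
      using n.component_le_nrm[of "x + c *\<^sub>R axis j 1 - y" j] n.component_le_nrm[of "y + c *\<^sub>R axis j 1 - x" j] t
      by (simp add: axis_def)
  next
    case False
    then show ?thesis
      using two_components_le_l1[OF False, of "x + c *\<^sub>R axis j 1 - y"] two_components_le_l1[OF False, of "y + c *\<^sub>R axis j 1 - x"] t
      by (simp add: axis_def)
  qed
qed auto

text \<open>
  Near its tip the Euclidean ball is a paraboloid. A horizontal gap of order \<open>1 / K\<close> lowers it only by
  the order of \<open>1 / K\<^sup>2\<close>, which dictates the thickness of the slab. Adding the two inequalities for
  the tips cancels the terms linear in the vertical displacement and leaves a bound for the
  square of the displacement, hence the square root.
\<close>
lemma tip_model_l2:
  assumes dim: "2 \<le> CARD('n)"
  shows "tip_model M \<xi> R N rate c (norm :: real ^ 'n \<Rightarrow> real) 2 2 (1 / 16) (1 / 64) 3"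
proof (intro tip_model.intro fixed_radius_norm_model.intro fixed_radius_norm_model_axioms.intro tip_model_axioms.intro
    fixed_radius_model_axioms sandwiched_norm_l2 dim)
  have outer: "(c + 2 * t\<^sup>2)\<^sup>2 \<le> c\<^sup>2 + 8 * t\<^sup>2" if "t\<^sup>2 \<le> 1" for t :: real
  proof -
    have "c * t\<^sup>2 \<le> 1 * t\<^sup>2" using radius_less_1 by (intro mult_right_mono) auto
    moreover have "t\<^sup>2 * t\<^sup>2 \<le> 1 * t\<^sup>2" using that by (intro mult_right_mono) auto
    ultimately show ?thesis by (simp add: power2_eq_square algebra_simps)
  qed
  {
    fix K :: nat and j :: 'n and \<kappa> \<kappa>' and x y :: "real ^ 'n" and t :: real
    assume K: "1 \<le> K" and \<kappa>: "\<kappa> \<in> site_labels K j" "\<kappa>' \<in> site_labels K j" "\<kappa> \<noteq> \<kappa>'"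
      and x: "x \<in> site K (1 / 16 / (real K)\<^sup>2) j \<kappa>" and y: "y \<in> site K (1 / 16 / (real K)\<^sup>2) j \<kappa>'"
      and t: "0 < t" "t\<^sup>2 \<le> 1 / 64 / (real K)\<^sup>2"
    have K0: "0 < K" using K by simp
    define \<delta> where "\<delta> = 1 / 64 / (real K)\<^sup>2"
    have "1 \<le> (real K)\<^sup>2" using K by simp
    then have "1 / 64 / (real K)\<^sup>2 \<le> 1 / 64 / 1" using K0 by (intro divide_left_mono) auto
    then have "\<delta> \<le> 1 / 64" by (simp only: \<delta>_def div_by_1)
    moreover have "0 < \<delta>" using K0 by (simp add: \<delta>_def)
    ultimately have \<delta>: "0 < \<delta>" "\<delta> \<le> 1" by auto
    obtain l where l: "l \<noteq> j" "1 / (2 * real K) \<le> \<bar>x $ l - y $ l\<bar>" using sites_apart[OF K0 \<kappa> x y] by blast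
    let ?z = "x + c *\<^sub>R axis j 1 - y"
    have z: "?z $ j = c + (x $ j - y $ j)" "?z $ l = x $ l - y $ l" using l by (auto simp: axis_def)
    have "0 \<le> x $ j" "y $ j \<le> 1 / 16 / (real K)\<^sup>2" using x y by (auto simp: in_site_iff[OF K0])
    then have D: "- (4 * \<delta>) \<le> x $ j - y $ j" by (simp add: \<delta>_def)
    have "c * (- (4 * \<delta>)) \<le> c * (x $ j - y $ j)" using D radius_pos by (intro mult_left_mono) auto
    moreover have "c * (4 * \<delta>) \<le> 1 * (4 * \<delta>)"
      using radius_less_1 \<delta> by (intro mult_right_mono) auto
    moreover have "(?z $ j)\<^sup>2 = c\<^sup>2 + 2 * (c * (x $ j - y $ j)) + (x $ j - y $ j)\<^sup>2"
      unfolding z by (simp add: power2_sum)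
    ultimately have zj: "c\<^sup>2 - 8 * \<delta> \<le> (?z $ j)\<^sup>2" using zero_le_power2[of "x $ j - y $ j"]
      by linarith
    have "(1 / (2 * real K))\<^sup>2 \<le> \<bar>x $ l - y $ l\<bar>\<^sup>2"
      using l(2) by (intro power_mono) auto
    moreover have "(1 / (2 * real K))\<^sup>2 = 16 * \<delta>" by (simp add: \<delta>_def power2_eq_square)
    ultimately have zl: "16 * \<delta> \<le> (?z $ l)\<^sup>2" unfolding z by simp
    have "(c + 2 * t\<^sup>2)\<^sup>2 \<le> c\<^sup>2 + 8 * \<delta>"
      using outer[of t] t(2) \<delta> unfolding \<delta>_def[symmetric] by linarith
    also have "\<dots> \<le> (norm ?z)\<^sup>2" using two_components_le_l2[OF l(1), of ?z] zj zl by linarith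
    finally show "c + 2 * t\<^sup>2 \<le> norm ?z" by (rule power2_le_imp_le) simp
  }
  fix t :: real and x y :: "real ^ 'n" and j l :: 'n
  assume t: "0 < t" "t\<^sup>2 \<le> 1" and n: "norm (x + c *\<^sub>R axis j 1 - y) < c + 2 * t\<^sup>2" "norm (y + c *\<^sub>R axis j 1 - x) < c + 2 * t\<^sup>2"
  define u where "u = x $ j - y $ j"
  define v where "v = x $ l - y $ l"
  have sq: "(norm (x + c *\<^sub>R axis j 1 - y))\<^sup>2 \<le> c\<^sup>2 + 8 * t\<^sup>2" "(norm (y + c *\<^sub>R axis j 1 - x))\<^sup>2 \<le> c\<^sup>2 + 8 * t\<^sup>2"
    using power_mono[OF less_imp_le[OF n(1)], of 2] power_mono[OF less_imp_le[OF n(2)], of 2] outer[OF t(2)] by auto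
  have "v\<^sup>2 \<le> 8 * t\<^sup>2"
  proof (cases "l = j")
    case True
    have comp: "(z $ j)\<^sup>2 \<le> (norm z)\<^sup>2" for z :: "real ^ 'n"
      using power_mono[OF component_le_norm_cart[of z j], of 2] by simp
    have "(c + u)\<^sup>2 \<le> (norm (x + c *\<^sub>R axis j 1 - y))\<^sup>2" "(c - u)\<^sup>2 \<le> (norm (y + c *\<^sub>R axis j 1 - x))\<^sup>2"
      using comp[of "x + c *\<^sub>R axis j 1 - y"] comp[of "y + c *\<^sub>R axis j 1 - x"]
      by (simp_all add: axis_def u_def algebra_simps)
    then have "u\<^sup>2 \<le> 8 * t\<^sup>2" using sq by (simp add: power2_sum power2_diff)
    then show ?thesis using True by (simp add: u_def v_def)
  next
    case False
    have "(c + u)\<^sup>2 + v\<^sup>2 \<le> c\<^sup>2 + 8 * t\<^sup>2" "(c - u)\<^sup>2 + v\<^sup>2 \<le> c\<^sup>2 + 8 * t\<^sup>2"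
      using two_components_le_l2[OF False, of "x + c *\<^sub>R axis j 1 - y"] two_components_le_l2[OF False, of "y + c *\<^sub>R axis j 1 - x"] sq False
      by (auto simp: axis_def u_def v_def algebra_simps power2_commute)
    then show ?thesis using zero_le_power2[of u] unfolding power2_sum power2_diff by linarith
  qed
  also have "\<dots> \<le> (3 * t)\<^sup>2" using t by (simp add: power_mult_distrib)
  finally show "\<bar>x $ l - y $ l\<bar> \<le> 3 * t"
    unfolding v_def using abs_le_square_iff[of "x $ l - y $ l" "3 * t"] t(1) by simp
qed auto

end

theorem theorem6:
  fixes M :: "'a measure"
    and \<xi> :: "nat \<Rightarrow> 'a \<Rightarrow> real ^ 'n"
    and R :: "nat \<Rightarrow> 'a \<Rightarrow> real"
    and N :: "'a \<Rightarrow> nat"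
    and rate c d :: real
  assumes model: "boolean_model M \<xi> R N rate"
    and dim: "CARD('n) \<ge> 2" "d = real CARD('n)"
    and radius: "0 < c" "c < 1" "AE \<omega> in M. R 0 \<omega> = c"
  shows "exp_asymp (=) (quantization_error M l1_norm (boolean_set l1_norm \<xi> R N))
           (\<lambda>r. sqrt (2 / (d - 1) * r * ln r)) \<and>
         exp_asymp (\<ge>) (quantization_error M norm (boolean_set norm \<xi> R N))
           (\<lambda>r. sqrt (4 * (d + 1) / (d * (d - 1)) * r * ln r)) \<and>
         exp_asymp (\<le>) (quantization_error M norm (boolean_set norm \<xi> R N))
           (\<lambda>r. sqrt (2 / (d - 1) * r * ln r))"
proof -
  interpret fixed_radius_model M \<xi> R N rate c
    by (intro fixed_radius_model.intro fixed_radius_model_axioms.intro model radius)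
  interpret l1: tip_model M \<xi> R N rate c "l1_norm :: real ^ 'n \<Rightarrow> real" 1 1 "1 / 8" "1 / 8" 2
    by (rule tip_model_l1[OF dim(1)])
  interpret l2: tip_model M \<xi> R N rate c "norm :: real ^ 'n \<Rightarrow> real" 2 2 "1 / 16" "1 / 64" 3
    by (rule tip_model_l2[OF dim(1)])
  have d: "2 \<le> d" using dim by simp
  have "2 * real 1 * (1 + real 1 / (d - 1)) / d = 2 / (d - 1)" using d by (simp add: field_simps)
  then have l1_ge: "exp_asymp (\<ge>) (quantization_error M l1_norm (boolean_set l1_norm \<xi> R N)) (\<lambda>r. sqrt (2 / (d - 1) * r * ln r))"
    using l1.quantization_error_lower[folded dim(2)] by simp
  have l1_le: "exp_asymp (\<le>) (quantization_error M l1_norm (boolean_set l1_norm \<xi> R N)) (\<lambda>r. sqrt (2 / (d - 1) * r * ln r))"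
    unfolding dim(2) by (rule l1.quantization_error_upper[OF indented_l1[OF radius(1)]]) (use radius in auto)
  have "\<forall>\<^sub>F r in at_top. 0 < sqrt (2 / (d - 1) * r * ln r)"
    using eventually_gt_at_top[of 1] by eventually_elim (use d in \<open>auto intro!: mult_pos_pos\<close>)
  from exp_asymp_eqI[OF this l1_le l1_ge]
  have l1_eq: "exp_asymp (=) (quantization_error M l1_norm (boolean_set l1_norm \<xi> R N)) (\<lambda>r. sqrt (2 / (d - 1) * r * ln r))" .
  have "2 * real 2 * (1 + real 2 / (d - 1)) / d = 4 * (d + 1) / (d * (d - 1))"
    using d by (simp add: field_simps)
  then have l2_ge: "exp_asymp (\<ge>) (quantization_error M norm (boolean_set norm \<xi> R N)) (\<lambda>r. sqrt (4 * (d + 1) / (d * (d - 1)) * r * ln r))"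
    using l2.quantization_error_lower[folded dim(2)] by simp
  have l2_le: "exp_asymp (\<le>) (quantization_error M norm (boolean_set norm \<xi> R N)) (\<lambda>r. sqrt (2 / (d - 1) * r * ln r))"
    unfolding dim(2) by (rule l2.quantization_error_upper[OF indented_l2[OF radius(1)]]) (use radius in auto)
  from l1_eq l2_ge l2_le show ?thesis by blast
qed

end
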